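(* The algebra $\mathbb{H}_{DO}$ is a Drinfeld algebra. More concretely, $\mathbb{H}_{DO}$ is isomorphic to $\mathbb{C}[G]\rtimes T(V)$ with the relations $$[u,v]=\sum_{g\in G}b_g(u,v)\,g\qquad\text{for all }u,v\in V,$$ where $G=G(m,1,n)$ acts on $V$ through $\rho$ and $b_g$ are the skew-symmetric forms on $V$ specified in the context.
   Context: Fix integers $m,n\ge 1$ and $\mathbf{k}\in\mathbb{C}$. Let $G=G(m,1,n)=S_n\ltimes T$, where $T=(\mathbb{Z}/m\mathbb{Z})^n$ is generated by commuting $g_1,\dots,g_n$ of order $m$ and $wg_iw^{-1}=g_{w(i)}$ for $w\in S_n$. Write $s_{ij}$ for the transposition of $i,j$ and $s_i=s_{i,i+1}$. The Dunkl-Opdam subalgebra $\mathbb{H}_{DO}$ is the unital associative $\mathbb{C}$-algebra generated by $\mathbb{C}[G]$ and $z_1,\dots,z_n$ subject to $[z_i,z_j]=0$; $[z_i,g_r]=0$ for all $i,r$; $[z_j,s_i]=0$ for $j\ne i,i+1$; $z_is_i=s_iz_{i+1}-\mathbf{k}\sum_{l=0}^{m-1}g_i^lg_{i+1}^{-l}$. Drinfeld algebra: given a finite group $G$, a (not necessarily faithful) representation $(\rho,V)$ of $G$ and skew-symmetric bilinear forms $b_g$ on $V$ ($g\in G$), let $\mathbb{H}=\mathbb{C}[G]\rtimes T(V)/R$, where $\mathbb{C}[G]\rtimes T(V)$ is the semidirect product ($gvg^{-1}=\rho(g)(v)$) and $R$ is the two-sided ideal generated by $[u,v]-\sum_gb_g(u,v)g$,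 $u,v\in V$. Filter $\mathbb{H}$ with $V$ in degree 1 and $G$ in degree 0. $\mathbb{H}$ is a Drinfeld algebra if it satisfies the PBW criterion: its associated graded algebra is naturally isomorphic to $\mathbb{C}[G]\rtimes S(V)$. Here $V=\mathbb{C}^n$ has basis $v_1,\dots,v_n$ permuted by $S_n$, and $\rho:G\to GL(V)$ is the composite of the projection $G\to S_n$ (with kernel $T$) with this permutation representation. With $\epsilon_1,\dots,\epsilon_n$ orthonormal for $\langle,\rangle$, the forms are: for $0<i<j<k\le n$, $$b_{s_{ij}s_{jk}}(v_p,v_q)=\mathbf{k}^2\bigl(\langle\epsilon_i-\epsilon_j,\epsilon_p\rangle\langle\epsilon_j-\epsilon_k,\epsilon_q\rangle-\langle\epsilon_i-\epsilon_j,\epsilon_q\rangle\langle\epsilon_j-\epsilon_k,\epsilon_p\rangle\bigr),$$ $$b_{s_{ij}g_i^lg_j^{-l}\,s_{jk}g_j^{l'}g_k^{-l'}}=b_{s_{ij}s_{jk}}\quad\text{for all }l,l'\in\{0,\dots,m-1\},$$ and $b_g=0$ otherwise.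
   Formalization: The formula for b_g is applied for i>j>k as well as i<j<k, so the inverse 3-cycles also carry nonzero forms; with b_g=0 there, as written, the forms are not G-invariant and the claim fails for n≥3, k≠0. *)

theory Defs
  imports
    "HOL-Algebra.QuotRing"
    "HOL-Algebra.Module"
    "HOL-Algebra.Product_Groups"
    "HOL-Combinatorics.Permutations"
    "Jordan_Normal_Form.Matrix"
begin

section \<open>Complex algebras\<close>

text \<open>
  A complex algebra is a record of type \<open>(complex, 'a) module\<close>: a (not necessarily commutative)
  ring together with a scalar multiplication.  The locale \<open>algebra\<close> of HOL-Algebra
  covers commutative algebras only, so it is not used.
\<close>

definition alg_iso :: "(complex, 'a) module \<Rightarrow> (complex, 'b) module \<Rightarrow> ('a \<Rightarrow> 'b) set" where
  "alg_iso A B = {\<phi> \<in> ring_iso A B. \<forall>c. \<forall>a\<in>carrier A. \<phi> (c \<odot>\<^bsub>A\<^esub> a) = c \<odot>\<^bsub>B\<^esub> \<phi> a}"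

definition alg_isomorphic :: "(complex, 'a) module \<Rightarrow> (complex, 'b) module \<Rightarrow> bool" where
  "alg_isomorphic A B \<longleftrightarrow> alg_iso A B \<noteq> {}"

text \<open>
  The union over \<open>X\<close> below is the single coset of \<open>c \<odot> a\<close> for any representative \<open>a\<close> of \<open>X\<close>
  (the plain image of \<open>X\<close> would be wrong for \<open>c = 0\<close>).
\<close>

definition quot_algebra :: "(complex, 'a) module \<Rightarrow> 'a set \<Rightarrow> (complex, 'a set) module" where
  "quot_algebra A I =
     ring.extend (A Quot I) (module.fields (\<lambda>c X. \<Union>a\<in>X. I +>\<^bsub>A\<^esub> (c \<odot>\<^bsub>A\<^esub> a)))"

text \<open>
  The free unital associative algebra on the letters \<open>X\<close>: finitely supported functions on words,
  with the convolution product.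
\<close>

definition free_algebra :: "'x set \<Rightarrow> (complex, 'x list \<Rightarrow> complex) module" where
  "free_algebra X = \<lparr>
     carrier = {f. finite {w. f w \<noteq> 0} \<and> {w. f w \<noteq> 0} \<subseteq> lists X},
     monoid.mult = (\<lambda>f g w. \<Sum>i\<le>length w. f (take i w) * g (drop i w)),
     one = (\<lambda>w. if w = [] then 1 else 0),
     zero = (\<lambda>w. 0),
     add = (\<lambda>f g w. f w + g w),
     smult = (\<lambda>c f w. c * f w)\<rparr>"

definition letter :: "'x \<Rightarrow> 'x list \<Rightarrow> complex" where
  "letter x = (\<lambda>w. if w = [x] then 1 else 0)"

section \<open>Tensor and symmetric algebra of \<open>V = \<complex>\<^sup>d\<close>\<close>

text \<open>
  The space \<open>V\<close> is \<^term>\<open>carrier_vec d :: complex vec set\<close>, with basis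
  \<^term>\<open>unit_vec d i\<close> for \<open>i < d\<close> (all indices start at 0).  The word
  \<open>[i\<^sub>1, \<dots>, i\<^sub>r]\<close> stands for the pure tensor of the corresponding basis vectors.
\<close>

definition tensor_algebra :: "nat \<Rightarrow> (complex, nat list \<Rightarrow> complex) module" where
  "tensor_algebra d = free_algebra {..<d}"

definition tensor_vec :: "complex vec \<Rightarrow> nat list \<Rightarrow> complex" where
  "tensor_vec v = (\<lambda>w. case w of [i] \<Rightarrow> (if i < dim_vec v then v $ i else 0) | _ \<Rightarrow> 0)"

text \<open>The algebra endomorphism of \<open>T(V)\<close> induced by the linear map \<open>v \<mapsto> M v\<close>.\<close>

definition tensor_act :: "nat \<Rightarrow> complex mat \<Rightarrow> (nat list \<Rightarrow> complex) \<Rightarrow> nat list \<Rightarrow> complex" where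
  "tensor_act d M f = (\<lambda>w. if set w \<subseteq> {..<d}
     then \<Sum>u | length u = length w \<and> set u \<subseteq> {..<d}. (\<Prod>k<length w. M $$ (w ! k, u ! k)) * f u
     else 0)"

definition sym_ideal :: "nat \<Rightarrow> (nat list \<Rightarrow> complex) set" where
  "sym_ideal d = (let T = tensor_algebra d in
     Idl\<^bsub>T\<^esub> {tensor_vec u \<otimes>\<^bsub>T\<^esub> tensor_vec v \<ominus>\<^bsub>T\<^esub> tensor_vec v \<otimes>\<^bsub>T\<^esub> tensor_vec u
        | u v. u \<in> carrier_vec d \<and> v \<in> carrier_vec d})"

definition sym_algebra :: "nat \<Rightarrow> (complex, (nat list \<Rightarrow> complex) set) module" where
  "sym_algebra d = quot_algebra (tensor_algebra d) (sym_ideal d)"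

definition sym_vec :: "nat \<Rightarrow> complex vec \<Rightarrow> (nat list \<Rightarrow> complex) set" where
  "sym_vec d v = sym_ideal d +>\<^bsub>tensor_algebra d\<^esub> tensor_vec v"

text \<open>For invertible \<open>M\<close> the induced automorphism of \<open>T(V)\<close> maps cosets onto cosets.\<close>

definition sym_act ::
  "nat \<Rightarrow> complex mat \<Rightarrow> (nat list \<Rightarrow> complex) set \<Rightarrow> (nat list \<Rightarrow> complex) set" where
  "sym_act d M X = tensor_act d M ` X"

section \<open>The semidirect product of a group algebra with an algebra\<close>

text \<open>
  \<open>\<complex>[G] \<rtimes> A\<close> for a finite group \<open>G\<close> acting on the algebra \<open>A\<close> by \<open>act\<close>: the function \<open>f\<close> stands
  for \<open>\<Sum>\<^sub>g f(g) g\<close>, and \<open>(a g) (b h) = (a act\<^sub>g(b)) (g h)\<close>, that is, \<open>g b g\<^sup>-\<^sup>1 = act\<^sub>g(b)\<close>.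
\<close>

definition semidirect_algebra ::
  "'g monoid \<Rightarrow> (complex, 'a) module \<Rightarrow> ('g \<Rightarrow> 'a \<Rightarrow> 'a) \<Rightarrow> (complex, 'g \<Rightarrow> 'a) module" where
  "semidirect_algebra G A act = \<lparr>
     carrier = carrier G \<rightarrow>\<^sub>E carrier A,
     monoid.mult = (\<lambda>f f'. \<lambda>x\<in>carrier G.
        \<Oplus>\<^bsub>A\<^esub>g\<in>carrier G. f g \<otimes>\<^bsub>A\<^esub> act g (f' (inv\<^bsub>G\<^esub> g \<otimes>\<^bsub>G\<^esub> x))),
     one = (\<lambda>x\<in>carrier G. if x = \<one>\<^bsub>G\<^esub> then \<one>\<^bsub>A\<^esub> else \<zero>\<^bsub>A\<^esub>),
     zero = (\<lambda>x\<in>carrier G. \<zero>\<^bsub>A\<^esub>),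
     add = (\<lambda>f f'. \<lambda>x\<in>carrier G. f x \<oplus>\<^bsub>A\<^esub> f' x),
     smult = (\<lambda>c f. \<lambda>x\<in>carrier G. c \<odot>\<^bsub>A\<^esub> f x)\<rparr>"

definition group_elt :: "'g monoid \<Rightarrow> (complex, 'a) module \<Rightarrow> 'g \<Rightarrow> 'g \<Rightarrow> 'a" where
  "group_elt G A g = (\<lambda>x\<in>carrier G. if x = g then \<one>\<^bsub>A\<^esub> else \<zero>\<^bsub>A\<^esub>)"

definition alg_elt :: "'g monoid \<Rightarrow> (complex, 'a) module \<Rightarrow> 'a \<Rightarrow> 'g \<Rightarrow> 'a" where
  "alg_elt G A a = (\<lambda>x\<in>carrier G. if x = \<one>\<^bsub>G\<^esub> then a else \<zero>\<^bsub>A\<^esub>)"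

definition tensor_semidirect ::
  "'g monoid \<Rightarrow> nat \<Rightarrow> ('g \<Rightarrow> complex mat) \<Rightarrow> (complex, 'g \<Rightarrow> nat list \<Rightarrow> complex) module" where
  "tensor_semidirect G d \<rho> =
     semidirect_algebra G (tensor_algebra d) (\<lambda>g. tensor_act d (\<rho> g))"

definition sym_semidirect ::
  "'g monoid \<Rightarrow> nat \<Rightarrow> ('g \<Rightarrow> complex mat) \<Rightarrow> (complex, 'g \<Rightarrow> (nat list \<Rightarrow> complex) set) module" where
  "sym_semidirect G d \<rho> =
     semidirect_algebra G (sym_algebra d) (\<lambda>g. sym_act d (\<rho> g))"

section \<open>Associated graded algebra\<close>

text \<open>
  For an increasing filtration \<open>F\<close> of \<open>A\<close>, put \<open>F\<^sub>-\<^sub>1 = 0\<close>.  Elements of the direct sum of the quotients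
  \<open>F\<^sub>i / F\<^sub>i\<^sub>-\<^sub>1\<close> are functions \<open>x\<close> with \<open>x i\<close> a coset of \<open>F\<^sub>i\<^sub>-\<^sub>1\<close> in \<open>F\<^sub>i\<close>, almost all of them zero.
\<close>

definition filt_below :: "(complex, 'a) module \<Rightarrow> (nat \<Rightarrow> 'a set) \<Rightarrow> nat \<Rightarrow> 'a set" where
  "filt_below A F i = (case i of 0 \<Rightarrow> {\<zero>\<^bsub>A\<^esub>} | Suc j \<Rightarrow> F j)"

definition homogeneous_class ::
  "(complex, 'a) module \<Rightarrow> (nat \<Rightarrow> 'a set) \<Rightarrow> nat \<Rightarrow> 'a \<Rightarrow> nat \<Rightarrow> 'a set" where
  "homogeneous_class A F i a =
     (\<lambda>j. if j = i then filt_below A F i +>\<^bsub>A\<^esub> a else filt_below A F j)"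

definition assoc_graded ::
  "(complex, 'a) module \<Rightarrow> (nat \<Rightarrow> 'a set) \<Rightarrow> (complex, nat \<Rightarrow> 'a set) module" where
  "assoc_graded A F = \<lparr>
     carrier = {x. (\<forall>i. \<exists>a\<in>F i. x i = filt_below A F i +>\<^bsub>A\<^esub> a)
                 \<and> finite {i. x i \<noteq> filt_below A F i}},
     monoid.mult = (\<lambda>x y k. filt_below A F k <+>\<^bsub>A\<^esub>
        {(\<Oplus>\<^bsub>A\<^esub>i\<in>{..k}. a i \<otimes>\<^bsub>A\<^esub> b (k - i)) | a b. \<forall>i\<le>k. a i \<in> x i \<and> b i \<in> y i}),
     one = homogeneous_class A F 0 \<one>\<^bsub>A\<^esub>,
     zero = filt_below A F,
     add = (\<lambda>x y i. x i <+>\<^bsub>A\<^esub> y i),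
     smult = (\<lambda>c x i. filt_below A F i <+>\<^bsub>A\<^esub> ((\<lambda>a. c \<odot>\<^bsub>A\<^esub> a) ` x i))\<rparr>"

section \<open>Drinfeld algebras\<close>

definition representation :: "'g monoid \<Rightarrow> nat \<Rightarrow> ('g \<Rightarrow> complex mat) \<Rightarrow> bool" where
  "representation G d \<rho> \<longleftrightarrow>
     (\<forall>g\<in>carrier G. \<rho> g \<in> carrier_mat d d) \<and>
     \<rho> \<one>\<^bsub>G\<^esub> = 1\<^sub>m d \<and>
     (\<forall>g\<in>carrier G. \<forall>h\<in>carrier G. \<rho> (g \<otimes>\<^bsub>G\<^esub> h) = \<rho> g * \<rho> h)"

definition skew_bilinear :: "nat \<Rightarrow> (complex vec \<Rightarrow> complex vec \<Rightarrow> complex) \<Rightarrow> bool" where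
  "skew_bilinear d \<beta> \<longleftrightarrow>
     (\<forall>u\<in>carrier_vec d. \<forall>u'\<in>carrier_vec d. \<forall>v\<in>carrier_vec d. \<forall>c.
        \<beta> (u + u') v = \<beta> u v + \<beta> u' v \<and> \<beta> v (u + u') = \<beta> v u + \<beta> v u' \<and>
        \<beta> (c \<cdot>\<^sub>v u) v = c * \<beta> u v \<and> \<beta> v (c \<cdot>\<^sub>v u) = c * \<beta> v u) \<and>
     (\<forall>u\<in>carrier_vec d. \<forall>v\<in>carrier_vec d. \<beta> u v = - \<beta> v u)"

context
  fixes G :: "'g monoid" and d :: nat and \<rho> :: "'g \<Rightarrow> complex mat"
    and b :: "'g \<Rightarrow> complex vec \<Rightarrow> complex vec \<Rightarrow> complex"
begin

text \<open>\<open>\<complex>[G] \<rtimes> T(V)\<close> modulo \<open>[u, v] = \<Sum>\<^sub>g b\<^sub>g(u, v) g\<close>.\<close>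

definition commutator_ideal :: "('g \<Rightarrow> nat list \<Rightarrow> complex) set" where
  "commutator_ideal = (let
       A = tensor_semidirect G d \<rho>;
       \<iota> = (\<lambda>v. alg_elt G (tensor_algebra d) (tensor_vec v)) in
     Idl\<^bsub>A\<^esub> {(\<iota> u \<otimes>\<^bsub>A\<^esub> \<iota> v \<ominus>\<^bsub>A\<^esub> \<iota> v \<otimes>\<^bsub>A\<^esub> \<iota> u) \<ominus>\<^bsub>A\<^esub>
           (\<Oplus>\<^bsub>A\<^esub>g\<in>carrier G. b g u v \<odot>\<^bsub>A\<^esub> group_elt G (tensor_algebra d) g)
        | u v. u \<in> carrier_vec d \<and> v \<in> carrier_vec d})"

definition commutator_algebra :: "(complex, ('g \<Rightarrow> nat list \<Rightarrow> complex) set) module" where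
  "commutator_algebra = quot_algebra (tensor_semidirect G d \<rho>) commutator_ideal"

definition quot_class :: "('g \<Rightarrow> nat list \<Rightarrow> complex) \<Rightarrow> ('g \<Rightarrow> nat list \<Rightarrow> complex) set" where
  "quot_class a = commutator_ideal +>\<^bsub>tensor_semidirect G d \<rho>\<^esub> a"

definition commutator_filtration :: "nat \<Rightarrow> ('g \<Rightarrow> nat list \<Rightarrow> complex) set set" where
  "commutator_filtration i = quot_class `
     {f \<in> carrier (tensor_semidirect G d \<rho>). \<forall>g\<in>carrier G. \<forall>w. f g w \<noteq> 0 \<longrightarrow> length w \<le> i}"

text \<open>
  The natural map sends \<open>g \<in> G\<close> and \<open>v \<in> V\<close> to their classes in degree 0 and 1;
  these elements generate \<open>\<complex>[G] \<rtimes> S(V)\<close>, so \<open>\<phi>\<close> is unique.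
\<close>

definition PBW :: bool where
  "PBW \<longleftrightarrow> (\<exists>\<phi> \<in> alg_iso (sym_semidirect G d \<rho>) (assoc_graded commutator_algebra commutator_filtration).
     (\<forall>g\<in>carrier G. \<phi> (group_elt G (sym_algebra d) g) =
        homogeneous_class commutator_algebra commutator_filtration 0
          (quot_class (group_elt G (tensor_algebra d) g))) \<and>
     (\<forall>v\<in>carrier_vec d. \<phi> (alg_elt G (sym_algebra d) (sym_vec d v)) =
        homogeneous_class commutator_algebra commutator_filtration 1
          (quot_class (alg_elt G (tensor_algebra d) (tensor_vec v)))))"

definition drinfeld_algebra :: bool where
  "drinfeld_algebra \<longleftrightarrow> group G \<and> finite (carrier G) \<and> representation G d \<rho> \<and>
     (\<forall>g\<in>carrier G. skew_bilinear d (b g)) \<and> PBW"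

end

section \<open>The group \<open>G(m,1,n)\<close>\<close>

text \<open>
  The pair \<open>(w, a)\<close> stands for \<open>w\<close> times the product of the \<open>g\<^sub>i ^ a i\<close> over \<open>i < n\<close>.  As \<open>w g\<^sub>i w\<^sup>-\<^sup>1 = g\<^bsub>w i\<^esub>\<close>, moving the torus
  part \<open>a\<close> to the right of \<open>u\<close> turns it into \<open>a \<circ> u\<close>.
\<close>

type_synonym gm1 = "(nat \<Rightarrow> nat) \<times> (nat \<Rightarrow> int)"

definition torus :: "nat \<Rightarrow> nat \<Rightarrow> (nat \<Rightarrow> int) monoid" where
  "torus m n = product_group {..<n} (\<lambda>_. integer_mod_group m)"

definition Gm1 :: "nat \<Rightarrow> nat \<Rightarrow> gm1 monoid" where
  "Gm1 m n = \<lparr>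
     carrier = {w. w permutes {..<n}} \<times> carrier (torus m n),
     monoid.mult = (\<lambda>(w, a) (u, b). (w \<circ> u, (\<lambda>i\<in>{..<n}. a (u i)) \<otimes>\<^bsub>torus m n\<^esub> b)),
     one = (id, \<one>\<^bsub>torus m n\<^esub>)\<rparr>"

definition perm_elt :: "nat \<Rightarrow> nat \<Rightarrow> (nat \<Rightarrow> nat) \<Rightarrow> gm1" where
  "perm_elt m n w = (w, \<one>\<^bsub>torus m n\<^esub>)"

abbreviation refl_elt :: "nat \<Rightarrow> nat \<Rightarrow> nat \<Rightarrow> nat \<Rightarrow> gm1" where
  "refl_elt m n i j \<equiv> perm_elt m n (Transposition.transpose i j)"

definition torus_gen :: "nat \<Rightarrow> nat \<Rightarrow> nat \<Rightarrow> gm1" where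
  "torus_gen m n i = (id, \<lambda>j\<in>{..<n}. if j = i then 1 mod int m else 0)"

definition torus_diff :: "nat \<Rightarrow> nat \<Rightarrow> nat \<Rightarrow> nat \<Rightarrow> nat \<Rightarrow> gm1" where
  "torus_diff m n i j l =
     (torus_gen m n i [^]\<^bsub>Gm1 m n\<^esub> int l) \<otimes>\<^bsub>Gm1 m n\<^esub> (torus_gen m n j [^]\<^bsub>Gm1 m n\<^esub> (- int l))"

definition perm_rep :: "nat \<Rightarrow> gm1 \<Rightarrow> complex mat" where
  "perm_rep n x = mat n n (\<lambda>(i, j). if i = fst x j then 1 else 0)"

section \<open>The Dunkl-Opdam subalgebra\<close>

datatype do_gen = Grp gm1 | Z nat

definition do_free :: "nat \<Rightarrow> nat \<Rightarrow> (complex, do_gen list \<Rightarrow> complex) module" where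
  "do_free m n = free_algebra (Grp ` carrier (Gm1 m n) \<union> Z ` {..<n})"

text \<open>The first two families of relations make the span of the letters \<^const>\<open>Grp\<close> the group algebra.\<close>

definition do_relations :: "nat \<Rightarrow> nat \<Rightarrow> complex \<Rightarrow> (do_gen list \<Rightarrow> complex) set" where
  "do_relations m n \<kappa> = (let
       G = Gm1 m n; A = do_free m n;
       e = (\<lambda>x. letter (Grp x)); z = (\<lambda>i. letter (Z i));
       s = (\<lambda>i. letter (Grp (refl_elt m n i (i + 1))));
       comm = (\<lambda>x y. x \<otimes>\<^bsub>A\<^esub> y \<ominus>\<^bsub>A\<^esub> y \<otimes>\<^bsub>A\<^esub> x)
     in {e x \<otimes>\<^bsub>A\<^esub> e y \<ominus>\<^bsub>A\<^esub> e (x \<otimes>\<^bsub>G\<^esub> y) | x y. x \<in> carrier G \<and> y \<in> carrier G}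
      \<union> {e \<one>\<^bsub>G\<^esub> \<ominus>\<^bsub>A\<^esub> \<one>\<^bsub>A\<^esub>}
      \<union> {comm (z i) (z j) | i j. i < n \<and> j < n}
      \<union> {comm (z i) (e (torus_gen m n r)) | i r. i < n \<and> r < n}
      \<union> {comm (z j) (s i) | i j. i + 1 < n \<and> j < n \<and> j \<noteq> i \<and> j \<noteq> i + 1}
      \<union> {z i \<otimes>\<^bsub>A\<^esub> s i \<ominus>\<^bsub>A\<^esub> (s i \<otimes>\<^bsub>A\<^esub> z (i + 1) \<ominus>\<^bsub>A\<^esub>
            \<kappa> \<odot>\<^bsub>A\<^esub> (\<Oplus>\<^bsub>A\<^esub>l\<in>{..<m}. e (torus_diff m n i (i + 1) l))) | i. i + 1 < n})"

definition H_DO :: "nat \<Rightarrow> nat \<Rightarrow> complex \<Rightarrow> (complex, (do_gen list \<Rightarrow> complex) set) module" where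
  "H_DO m n \<kappa> = quot_algebra (do_free m n) (Idl\<^bsub>do_free m n\<^esub> (do_relations m n \<kappa>))"

section \<open>The skew-symmetric forms\<close>

definition cycle_form ::
  "nat \<Rightarrow> complex \<Rightarrow> nat \<Rightarrow> nat \<Rightarrow> nat \<Rightarrow> complex vec \<Rightarrow> complex vec \<Rightarrow> complex" where
  "cycle_form n \<kappa> i j k u v = (let \<epsilon> = unit_vec n in \<kappa>\<^sup>2 *
     (((\<epsilon> i - \<epsilon> j) \<bullet> u) * ((\<epsilon> j - \<epsilon> k) \<bullet> v) - ((\<epsilon> i - \<epsilon> j) \<bullet> v) * ((\<epsilon> j - \<epsilon> k) \<bullet> u)))"

definition cycle_elt :: "nat \<Rightarrow> nat \<Rightarrow> nat \<Rightarrow> nat \<Rightarrow> nat \<Rightarrow> nat \<Rightarrow> nat \<Rightarrow> gm1" where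
  "cycle_elt m n i j k l l' =
     refl_elt m n i j \<otimes>\<^bsub>Gm1 m n\<^esub> torus_diff m n i j l \<otimes>\<^bsub>Gm1 m n\<^esub>
     refl_elt m n j k \<otimes>\<^bsub>Gm1 m n\<^esub> torus_diff m n j k l'"

text \<open>
  The form attached to \<open>s\<^sub>i\<^sub>j g\<^sub>i\<^sup>l g\<^sub>j\<^sup>-\<^sup>l s\<^sub>j\<^sub>k g\<^sub>j\<^sup>l\<^sup>' g\<^sub>k\<^sup>-\<^sup>l\<^sup>'\<close> is \<^term>\<open>cycle_form n \<kappa> i j k\<close>.  Indices
  \<open>i < j < k\<close> give one of the two 3-cycles on \<open>{i,j,k}\<close>, and \<open>i > j > k\<close> its inverse.  Both have to be
  included: a family of forms that vanishes on the inverses is not invariant under \<open>G\<close>, and for \<open>n \<ge> 3\<close>,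
  \<open>\<kappa> \<noteq> 0\<close> its commutator relations would not satisfy the PBW property.  At most one triple
  \<open>(i,j,k)\<close> contributes to the sum, and the value is the same for all rotations of \<open>(i,j,k)\<close>.
\<close>

definition do_form ::
  "nat \<Rightarrow> nat \<Rightarrow> complex \<Rightarrow> gm1 \<Rightarrow> complex vec \<Rightarrow> complex vec \<Rightarrow> complex" where
  "do_form m n \<kappa> g u v =
     (\<Sum>(i, j, k) | i < n \<and> j < n \<and> k < n \<and> (i < j \<and> j < k \<or> k < j \<and> j < i) \<and>
                  (\<exists>l<m. \<exists>l'<m. g = cycle_elt m n i j k l l').
        cycle_form n \<kappa> i j k u v)"

end

theory Submission
  imports Defs
begin

text \<open>
  The isomorphism is a change of generators.  Put \<open>\<tau>\<^sub>i\<^sub>j = \<Sum>\<^sub>l s\<^sub>i\<^sub>j g\<^sub>i\<^sup>l g\<^sub>j\<^sup>-\<^sup>l\<close>.  Conjugation by \<open>x \<in> G\<close> sends \<open>\<tau>\<^sub>i\<^sub>j\<close> to \<open>\<tau>\<^bsub>w(i)w(j)\<^esub>\<close>,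
  where \<open>w\<close> is the permutation of \<open>x\<close>: a torus element only shifts the summation index \<open>l\<close>.  So the
  \<open>\<tau>\<^sub>i\<^sub>j\<close> multiply among themselves like transpositions do under conjugation.  Let
  \<open>X\<^sub>p = \<Sum>\<^bsub>j\<noteq>p\<^esub> \<plusminus>\<tau>\<^sub>p\<^sub>j\<close>, with the sign \<open>+\<close> exactly if \<open>p < j\<close>.  Two facts about the signs carry
  the proof.

  \<^item> The family \<open>X\<^sub>p\<close> commutes with the torus, but \<open>s\<^sub>i X\<^sub>i - X\<^bsub>i+1\<^esub> s\<^sub>i = 2 \<tau>\<^bsub>i,i+1\<^esub> s\<^sub>i\<close>, because only the sign of
  the pair \<open>(i, i+1)\<close> changes under \<open>s\<^sub>i\<close> (\<open>e_refl_X\<close>).  This defect is the correction term of the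
  relation between \<open>z\<^sub>i\<close> and \<open>s\<^sub>i\<close>: the relations between the \<open>z\<^sub>i\<close> and \<open>G\<close> hold if and only if
  \<open>v\<^sub>i = 2 z\<^sub>i + \<kappa> X\<^sub>i\<close> is permuted by \<open>G\<close> (\<open>do_z_hecke\<close>, \<open>gm1_equivariant_of_do\<close>).

  \<^item> For any family \<open>v\<^sub>i\<close> permuted by \<open>G\<close> one has \<open>[X\<^sub>p, v\<^sub>q] + [v\<^sub>p, X\<^sub>q] = 0\<close>, and the signs \<open>\<epsilon>\<close> of
  three distinct indices satisfy
  \<open>\<epsilon>\<^sub>p\<^sub>q \<epsilon>\<^sub>q\<^sub>k + \<epsilon>\<^sub>q\<^sub>k \<epsilon>\<^sub>k\<^sub>p + \<epsilon>\<^sub>k\<^sub>p \<epsilon>\<^sub>p\<^sub>q = -1\<close>, which gives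
  \<open>[X\<^sub>p, X\<^sub>q] = -\<Sum>\<^sub>k [\<tau>\<^sub>p\<^sub>q, \<tau>\<^sub>q\<^sub>k]\<close> (\<open>bracket_X\<close>).  The right-hand side is, up to the factor \<open>\<kappa>\<^sup>2\<close>,
  minus the value of the forms \<open>b\<^sub>g\<close>, so \<open>[v\<^sub>p - \<kappa> X\<^sub>p, v\<^sub>q - \<kappa> X\<^sub>q] = [v\<^sub>p, v\<^sub>q] - \<Sum>\<^sub>g b\<^sub>g(v\<^sub>p, v\<^sub>q) g\<close>
  (\<open>bracket_shifted\<close>).  Hence the \<open>z\<^sub>i\<close> commute if and only if the \<open>v\<^sub>i\<close> satisfy the commutator relations.

  Both statements hold in every algebra with a representation of \<open>G\<close>; applied to the two algebras in question
  they provide homomorphisms in both directions, inverse to each other (\<open>H_DO_isomorphic\<close>).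

  For the PBW property, the algebra \<open>\<complex>[G] \<rtimes> T(V)\<close> maps onto \<open>\<complex>[G] \<rtimes> S(V)\<close> and, by sending an element to the
  classes of its homogeneous parts, onto the associated graded algebra.  It suffices that both maps have
  the same kernel.  One inclusion says that \<open>u v - v u\<close> lies in lower degree, which is the commutator relation.
  For the other one the quotient must be shown to be large: it acts on \<open>S(V) \<otimes> \<complex>[G]\<close> by
  \<open>v\<^sub>i \<mapsto> z\<^sub>i + \<kappa> \<Sum>\<^sub>j \<tau>\<^sub>i\<^sub>j \<sigma>\<^sub>i\<^sub>j\<close>, where \<open>z\<^sub>i\<close> is multiplication by a variable and \<open>\<sigma>\<^sub>i\<^sub>j\<close> is a sign that depends
  on the component in \<open>\<complex>[G]\<close>.  In this action a word in \<open>V\<close> has the corresponding monomial of \<open>S(V)\<close> as its leading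
  term, so an element of lower filtration degree has no symbol.  The signs \<open>\<sigma>\<^sub>i\<^sub>j\<close> are chosen such that the operators
  are permuted by \<open>G\<close> and such that \<open>v\<^sub>i - \<kappa> X\<^sub>i\<close> is just \<open>z\<^sub>i\<close> on the component of \<open>1 \<in> G\<close>.  By
  equivariance the commutator relations need to be checked on this component only, and there they say that the
  variables commute (\<open>M_bracket_shifted\<close>).
\<close>

section \<open>Complex algebras, homomorphisms and quotients\<close>

locale complex_algebra = ring A for A :: "(complex, 'a) module" (structure) +
  assumes smult_closed [simp, intro]: "x \<in> carrier A \<Longrightarrow> c \<odot> x \<in> carrier A"
    and smult_l_distr: "x \<in> carrier A \<Longrightarrow> (c + d) \<odot> x = c \<odot> x \<oplus> d \<odot> x"
    and smult_r_distr: "x \<in> carrier A \<Longrightarrow> y \<in> carrier A \<Longrightarrow> c \<odot> (x \<oplus> y) = c \<odot> x \<oplus> c \<odot> y"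
    and smult_assoc: "x \<in> carrier A \<Longrightarrow> (c * d) \<odot> x = c \<odot> (d \<odot> x)"
    and smult_one [simp]: "x \<in> carrier A \<Longrightarrow> 1 \<odot> x = x"
    and smult_mult_left: "x \<in> carrier A \<Longrightarrow> y \<in> carrier A \<Longrightarrow> (c \<odot> x) \<otimes> y = c \<odot> (x \<otimes> y)"
    and smult_mult_right: "x \<in> carrier A \<Longrightarrow> y \<in> carrier A \<Longrightarrow> x \<otimes> (c \<odot> y) = c \<odot> (x \<otimes> y)"
begin

lemma smult_zero [simp]: "c \<odot> \<zero> = \<zero>"
  using smult_r_distr[of \<zero> \<zero> c] add.l_cancel_one[of "c \<odot> \<zero>" "c \<odot> \<zero>"] by simp

lemma zero_smult [simp]:
  assumes "x \<in> carrier A" shows "0 \<odot> x = \<zero>"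
  using smult_l_distr[of x 0 0] add.l_cancel_one[of "0 \<odot> x" "0 \<odot> x"] assms by simp

lemma smult_minus [simp]: "x \<in> carrier A \<Longrightarrow> (- c) \<odot> x = \<ominus> (c \<odot> x)"
  using smult_l_distr[of x "- c" c] minus_equality by force

lemma smult_a_inv [simp]: "x \<in> carrier A \<Longrightarrow> c \<odot> (\<ominus> x) = \<ominus> (c \<odot> x)"
  using smult_r_distr[of "\<ominus> x" x c] minus_equality l_neg by force

lemma smult_minus_right: 
  "x \<in> carrier A \<Longrightarrow> y \<in> carrier A \<Longrightarrow> c \<odot> (x \<ominus> y) = c \<odot> x \<ominus> c \<odot> y"
  by (simp add: a_minus_def smult_r_distr)

lemma finsum_smult:
  assumes "f \<in> S \<rightarrow> carrier A"
  shows "c \<odot> (\<Oplus>i\<in>S. f i) = (\<Oplus>i\<in>S. c \<odot> f i)"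
  using assms
proof (induct S rule: infinite_finite_induct)
  case (insert i S)
  then have "f i \<in> carrier A" "f \<in> S \<rightarrow> carrier A" by auto
  with insert show ?case by (simp add: smult_r_distr Pi_iff)
qed simp_all

lemma finsum_smult_left:
  assumes "x \<in> carrier A"
  shows "(\<Sum>i\<in>S. c i) \<odot> x = (\<Oplus>i\<in>S. c i \<odot> x)"
  by (induct S rule: infinite_finite_induct) (simp_all add: assms smult_l_distr Pi_iff)

lemma finsum_swap:
  assumes "finite S" "finite T" "\<And>i j. i \<in> S \<Longrightarrow> j \<in> T \<Longrightarrow> f i j \<in> carrier A"
  shows "(\<Oplus>i\<in>S. \<Oplus>j\<in>T. f i j) = (\<Oplus>j\<in>T. \<Oplus>i\<in>S. f i j)"
  using assms(1,3)
proof (induct S)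
  case (insert i S)
  have "(\<Oplus>j\<in>T. \<Oplus>i\<in>insert i S. f i j) = (\<Oplus>j\<in>T. f i j \<oplus> (\<Oplus>i\<in>S. f i j))"
    by (rule add.finprod_cong') (use insert in \<open>auto intro!: add.finprod_insert finsum_closed\<close>)
  also have "\<dots> = (\<Oplus>j\<in>T. f i j) \<oplus> (\<Oplus>j\<in>T. \<Oplus>i\<in>S. f i j)"
    by (rule finsum_addf) (use insert in \<open>auto intro!: finsum_closed\<close>)
  finally show ?case using insert by (simp add: Pi_iff finsum_closed)
qed simp

lemma finsum_mult_left:
  assumes "f \<in> S \<rightarrow> carrier A" "x \<in> carrier A"
  shows "(\<Oplus>i\<in>S. f i) \<otimes> x = (\<Oplus>i\<in>S. f i \<otimes> x)"
  using assms(1)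
proof (induct S rule: infinite_finite_induct)
  case (insert i S)
  then have "f i \<in> carrier A" "f \<in> S \<rightarrow> carrier A" by auto
  with insert show ?case using assms(2) by (simp add: l_distr Pi_iff)
qed (use assms in simp_all)

lemma finsum_mult_right:
  assumes "f \<in> S \<rightarrow> carrier A" "x \<in> carrier A"
  shows "x \<otimes> (\<Oplus>i\<in>S. f i) = (\<Oplus>i\<in>S. x \<otimes> f i)"
  using assms(1)
proof (induct S rule: infinite_finite_induct)
  case (insert i S)
  then have "f i \<in> carrier A" "f \<in> S \<rightarrow> carrier A" by auto
  with insert show ?case using assms(2) by (simp add: r_distr Pi_iff)
qed (use assms in simp_all)

lemma finsum_bij:
  assumes "bij_betw h S T" "f \<in> T \<rightarrow> carrier A"
  shows "(\<Oplus>j\<in>T. f j) = (\<Oplus>i\<in>S. f (h i))"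
  using add.finprod_reindex[of f h S] assms by (auto simp: bij_betw_def)

lemma finsum_single:
  assumes "finite S" "k \<in> S" "f k \<in> carrier A" "\<And>i. i \<in> S \<Longrightarrow> i \<noteq> k \<Longrightarrow> f i = \<zero>"
  shows "(\<Oplus>i\<in>S. f i) = f k"
proof -
  have "(\<Oplus>i\<in>S. f i) = (\<Oplus>i\<in>insert k (S - {k}). f i)" using assms by (simp add: insert_absorb)
  also have "\<dots> = f k \<oplus> (\<Oplus>i\<in>S - {k}. f i)"
    using assms by (intro finsum_insert) (auto simp: Pi_iff)
  also have "(\<Oplus>i\<in>S - {k}. f i) = \<zero>" by (rule add.finprod_one_eqI) (use assms in auto)
  finally show ?thesis using assms by simp
qed

lemma minus_add_distrib:
  assumes "a \<in> carrier A" "b \<in> carrier A" "c \<in> carrier A" "d \<in> carrier A"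
  shows "(a \<oplus> b) \<ominus> (c \<oplus> d) = (a \<ominus> c) \<oplus> (b \<ominus> d)"
  using assms by (simp add: a_minus_def minus_add a_ac)

lemma finsum_minus:
  assumes "f \<in> S \<rightarrow> carrier A" "g \<in> S \<rightarrow> carrier A"
  shows "(\<Oplus>i\<in>S. f i) \<ominus> (\<Oplus>i\<in>S. g i) = (\<Oplus>i\<in>S. f i \<ominus> g i)"
  using assms
proof (induct S rule: infinite_finite_induct)
  case (insert i S)
  then have "f i \<in> carrier A" "f \<in> S \<rightarrow> carrier A" "g i \<in> carrier A" "g \<in> S \<rightarrow> carrier A" by auto
  with insert show ?case by (simp add: minus_add_distrib finsum_closed Pi_iff)
qed (simp_all add: a_minus_def)

lemma eq_iff_minus_zero:
  "a \<in> carrier A \<Longrightarrow> b \<in> carrier A \<Longrightarrow> a = b \<longleftrightarrow> a \<ominus> b = \<zero>"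
  by (metis a_minus_def add.inv_closed add.inv_equality add.r_inv minus_minus)

end

text \<open>
  Multiplication by \<open>-1\<close> provides the additive inverses.
\<close>

lemma complex_algebraI:
  fixes A (structure)
  assumes "\<And>x y. x \<in> carrier A \<Longrightarrow> y \<in> carrier A \<Longrightarrow> x \<oplus> y \<in> carrier A"
    and "\<And>x y. x \<in> carrier A \<Longrightarrow> y \<in> carrier A \<Longrightarrow> x \<otimes> y \<in> carrier A"
    and "\<And>c x. x \<in> carrier A \<Longrightarrow> c \<odot> x \<in> carrier A"
    and "\<one> \<in> carrier A" "\<zero> \<in> carrier A"
    and "\<And>x y z. x \<in> carrier A \<Longrightarrow> y \<in> carrier A \<Longrightarrow> z \<in> carrier A \<Longrightarrow> (x \<oplus> y) \<oplus> z = x \<oplus> (y \<oplus> z)"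
    and "\<And>x y. x \<in> carrier A \<Longrightarrow> y \<in> carrier A \<Longrightarrow> x \<oplus> y = y \<oplus> x"
    and "\<And>x. x \<in> carrier A \<Longrightarrow> \<zero> \<oplus> x = x"
    and "\<And>x y z. x \<in> carrier A \<Longrightarrow> y \<in> carrier A \<Longrightarrow> z \<in> carrier A \<Longrightarrow> (x \<otimes> y) \<otimes> z = x \<otimes> (y \<otimes> z)"
    and "\<And>x. x \<in> carrier A \<Longrightarrow> \<one> \<otimes> x = x" "\<And>x. x \<in> carrier A \<Longrightarrow> x \<otimes> \<one> = x"
    and "\<And>x y z. x \<in> carrier A \<Longrightarrow> y \<in> carrier A \<Longrightarrow> z \<in> carrier A \<Longrightarrow> (x \<oplus> y) \<otimes> z = x \<otimes> z \<oplus> y \<otimes> z"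
    and "\<And>x y z. x \<in> carrier A \<Longrightarrow> y \<in> carrier A \<Longrightarrow> z \<in> carrier A \<Longrightarrow> z \<otimes> (x \<oplus> y) = z \<otimes> x \<oplus> z \<otimes> y"
    and "\<And>c d x. x \<in> carrier A \<Longrightarrow> (c + d) \<odot> x = c \<odot> x \<oplus> d \<odot> x"
    and "\<And>c x y. x \<in> carrier A \<Longrightarrow> y \<in> carrier A \<Longrightarrow> c \<odot> (x \<oplus> y) = c \<odot> x \<oplus> c \<odot> y"
    and "\<And>c d x. x \<in> carrier A \<Longrightarrow> (c * d) \<odot> x = c \<odot> (d \<odot> x)"
    and "\<And>x. x \<in> carrier A \<Longrightarrow> 1 \<odot> x = x" "\<And>x. x \<in> carrier A \<Longrightarrow> 0 \<odot> x = \<zero>"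
    and "\<And>c x y. x \<in> carrier A \<Longrightarrow> y \<in> carrier A \<Longrightarrow> (c \<odot> x) \<otimes> y = c \<odot> (x \<otimes> y)"
    and "\<And>c x y. x \<in> carrier A \<Longrightarrow> y \<in> carrier A \<Longrightarrow> x \<otimes> (c \<odot> y) = c \<odot> (x \<otimes> y)"
  shows "complex_algebra A"
proof (rule complex_algebra.intro)
  have inv: "((- 1) \<odot> x) \<oplus> x = \<zero>" if "x \<in> carrier A" for x
    using assms(14)[of x "- 1" 1] assms(17,18) that by simp
  show "ring A"
  proof (rule ringI)
    show "abelian_group A" by (rule abelian_groupI) (auto intro: assms(1,2,4-8) inv assms(3))
    show "Group.monoid A" by (rule monoidI) (auto intro: assms(2,4,9-11))
  qed (auto intro: assms(12,13))
  show "complex_algebra_axioms A"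
    by (rule complex_algebra_axioms.intro) (simp_all add: assms(3,14-17,19,20))
qed

definition alg_hom :: "(complex, 'a) module \<Rightarrow> (complex, 'b) module \<Rightarrow> ('a \<Rightarrow> 'b) set" where
  "alg_hom A B = {\<phi> \<in> Ring.ring_hom A B. \<forall>c. \<forall>a\<in>carrier A. \<phi> (c \<odot>\<^bsub>A\<^esub> a) = c \<odot>\<^bsub>B\<^esub> \<phi> a}"

lemma alg_homI:
  assumes "\<And>x. x \<in> carrier A \<Longrightarrow> \<phi> x \<in> carrier B"
    and "\<And>x y. x \<in> carrier A \<Longrightarrow> y \<in> carrier A \<Longrightarrow> \<phi> (x \<otimes>\<^bsub>A\<^esub> y) = \<phi> x \<otimes>\<^bsub>B\<^esub> \<phi> y"
    and "\<And>x y. x \<in> carrier A \<Longrightarrow> y \<in> carrier A \<Longrightarrow> \<phi> (x \<oplus>\<^bsub>A\<^esub> y) = \<phi> x \<oplus>\<^bsub>B\<^esub> \<phi> y"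
    and "\<phi> \<one>\<^bsub>A\<^esub> = \<one>\<^bsub>B\<^esub>"
    and "\<And>c x. x \<in> carrier A \<Longrightarrow> \<phi> (c \<odot>\<^bsub>A\<^esub> x) = c \<odot>\<^bsub>B\<^esub> \<phi> x"
  shows "\<phi> \<in> alg_hom A B"
  using assms by (auto simp: alg_hom_def intro!: ring_hom_memI)

lemma alg_homD:
  assumes "\<phi> \<in> alg_hom A B"
  shows alg_hom_closed: "x \<in> carrier A \<Longrightarrow> \<phi> x \<in> carrier B"
    and alg_hom_mult: "x \<in> carrier A \<Longrightarrow> y \<in> carrier A \<Longrightarrow> \<phi> (x \<otimes>\<^bsub>A\<^esub> y) = \<phi> x \<otimes>\<^bsub>B\<^esub> \<phi> y"
    and alg_hom_add: "x \<in> carrier A \<Longrightarrow> y \<in> carrier A \<Longrightarrow> \<phi> (x \<oplus>\<^bsub>A\<^esub> y) = \<phi> x \<oplus>\<^bsub>B\<^esub> \<phi> y"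
    and alg_hom_one: "\<phi> \<one>\<^bsub>A\<^esub> = \<one>\<^bsub>B\<^esub>"
    and alg_hom_smult: "x \<in> carrier A \<Longrightarrow> \<phi> (c \<odot>\<^bsub>A\<^esub> x) = c \<odot>\<^bsub>B\<^esub> \<phi> x"
  using assms by (auto simp: alg_hom_def Ring.ring_hom_def)

lemma alg_hom_comp:
  "\<phi> \<in> alg_hom A B \<Longrightarrow> \<psi> \<in> alg_hom B C \<Longrightarrow> (\<lambda>x. \<psi> (\<phi> x)) \<in> alg_hom A C"
  by (auto simp: alg_homD intro!: alg_homI)

lemma alg_hom_ring_hom:
  "complex_algebra A \<Longrightarrow> complex_algebra B \<Longrightarrow> \<phi> \<in> alg_hom A B \<Longrightarrow> ring_hom_ring A B \<phi>"
  by (auto simp: alg_hom_def intro!: ring_hom_ringI2 complex_algebra.axioms(1))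

context
  fixes A :: "(complex, 'a) module" and B :: "(complex, 'b) module" and \<phi>
  assumes A: "complex_algebra A" and B: "complex_algebra B" and \<phi>: "\<phi> \<in> alg_hom A B"
begin

lemma alg_hom_zero: "\<phi> \<zero>\<^bsub>A\<^esub> = \<zero>\<^bsub>B\<^esub>"
proof -
  interpret A: complex_algebra A by fact
  interpret B: complex_algebra B by fact
  show ?thesis
    using alg_hom_smult[OF \<phi>, of "\<one>\<^bsub>A\<^esub>" 0] alg_hom_closed[OF \<phi>, of "\<one>\<^bsub>A\<^esub>"] by simp
qed

lemma alg_hom_a_inv: "x \<in> carrier A \<Longrightarrow> \<phi> (\<ominus>\<^bsub>A\<^esub> x) = \<ominus>\<^bsub>B\<^esub> \<phi> x"
proof -
  interpret A: complex_algebra A by fact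
  interpret B: complex_algebra B by fact
  assume "x \<in> carrier A"
  then show ?thesis
    using alg_hom_smult[OF \<phi>, of x "- 1"] alg_hom_closed[OF \<phi>, of x] by simp
qed

lemma alg_hom_minus: "x \<in> carrier A \<Longrightarrow> y \<in> carrier A \<Longrightarrow> \<phi> (x \<ominus>\<^bsub>A\<^esub> y) = \<phi> x \<ominus>\<^bsub>B\<^esub> \<phi> y"
proof -
  interpret A: complex_algebra A by fact
  assume "x \<in> carrier A" "y \<in> carrier A"
  then show ?thesis unfolding a_minus_def by (simp add: alg_hom_add[OF \<phi>] alg_hom_a_inv)
qed

lemma alg_hom_finsum: "f \<in> S \<rightarrow> carrier A \<Longrightarrow> \<phi> (\<Oplus>\<^bsub>A\<^esub>i\<in>S. f i) = (\<Oplus>\<^bsub>B\<^esub>i\<in>S. \<phi> (f i))"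
proof (induct S rule: infinite_finite_induct)
  interpret A: complex_algebra A by fact
  interpret B: complex_algebra B by fact
  {
    case (insert i S)
    then have "f i \<in> carrier A" "f \<in> S \<rightarrow> carrier A" by auto
    with insert show ?case
      by (simp add: alg_hom_add[OF \<phi>] alg_hom_closed[OF \<phi>] Pi_iff)
  next
    case (infinite S)
    then show ?case by (simp add: alg_hom_zero)
  next
    case empty
    then show ?case by (simp add: alg_hom_zero)
  }
qed

lemma alg_hom_kernel_ideal: "ideal {x \<in> carrier A. \<phi> x = \<zero>\<^bsub>B\<^esub>} A"
  using ring_hom_ring.kernel_is_ideal[OF alg_hom_ring_hom[OF A B \<phi>]] by (simp add: a_kernel_def kernel_def)

lemma alg_hom_kills_genideal:
  assumes "S \<subseteq> carrier A" "\<And>s. s \<in> S \<Longrightarrow> \<phi> s = \<zero>\<^bsub>B\<^esub>" "x \<in> Idl\<^bsub>A\<^esub> S"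
  shows "\<phi> x = \<zero>\<^bsub>B\<^esub>"
proof -
  have "Idl\<^bsub>A\<^esub> S \<subseteq> {x \<in> carrier A. \<phi> x = \<zero>\<^bsub>B\<^esub>}"
    using ring.genideal_minimal[OF complex_algebra.axioms(1)[OF A] alg_hom_kernel_ideal] assms by auto
  then show ?thesis using assms by auto
qed

end

text \<open>
  The homomorphism on \<open>B\<close> is computed at an arbitrary preimage in \<open>A\<close>.
\<close>

lemma alg_hom_factor:
  assumes \<phi>: "\<phi> \<in> alg_hom A B" and surj: "\<phi> ` carrier A = carrier B" and \<psi>: "\<psi> \<in> alg_hom A C"
    and ker: "\<And>x y. x \<in> carrier A \<Longrightarrow> y \<in> carrier A \<Longrightarrow> \<phi> x = \<phi> y \<Longrightarrow> \<psi> x = \<psi> y"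
    and A: "complex_algebra A"
  obtains \<chi> where "\<chi> \<in> alg_hom B C" "\<And>x. x \<in> carrier A \<Longrightarrow> \<chi> (\<phi> x) = \<psi> x"
proof
  interpret A: complex_algebra A by fact
  define \<chi> where "\<chi> y = \<psi> (SOME x. x \<in> carrier A \<and> \<phi> x = y)" for y
  show *: "\<chi> (\<phi> x) = \<psi> x" if "x \<in> carrier A" for x
  proof -
    have "\<exists>x'. x' \<in> carrier A \<and> \<phi> x' = \<phi> x" using that by blast
    from someI_ex[OF this] show ?thesis unfolding \<chi>_def using that ker by blast
  qed
  have B: "\<exists>x\<in>carrier A. y = \<phi> x" if "y \<in> carrier B" for y
    using that surj by auto
  show "\<chi> \<in> alg_hom B C"
  proof (rule alg_homI)
    show "\<chi> x \<in> carrier C" if "x \<in> carrier B" for x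
      using B[OF that] * alg_hom_closed[OF \<psi>] by auto
    show "\<chi> (x \<otimes>\<^bsub>B\<^esub> y) = \<chi> x \<otimes>\<^bsub>C\<^esub> \<chi> y" if "x \<in> carrier B" "y \<in> carrier B" for x y
      using B[OF that(1)] B[OF that(2)] * alg_hom_mult[OF \<phi>] alg_hom_mult[OF \<psi>] 
      by (metis A.m_closed)
    show "\<chi> (x \<oplus>\<^bsub>B\<^esub> y) = \<chi> x \<oplus>\<^bsub>C\<^esub> \<chi> y" if "x \<in> carrier B" "y \<in> carrier B" for x y
      using B[OF that(1)] B[OF that(2)] * alg_hom_add[OF \<phi>] alg_hom_add[OF \<psi>] 
      by (metis A.a_closed)
    show "\<chi> \<one>\<^bsub>B\<^esub> = \<one>\<^bsub>C\<^esub>" using *[of "\<one>\<^bsub>A\<^esub>"] alg_hom_one[OF \<phi>] alg_hom_one[OF \<psi>] by simp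
    show "\<chi> (c \<odot>\<^bsub>B\<^esub> x) = c \<odot>\<^bsub>C\<^esub> \<chi> x" if "x \<in> carrier B" for c x
      using B[OF that] * alg_hom_smult[OF \<phi>] alg_hom_smult[OF \<psi>] by (metis A.smult_closed)
  qed
qed

text \<open>
  This transfers the algebra laws to the associated graded algebra, whose operations are awkward sets of
  representatives, from an algebra that maps onto it.
\<close>

lemma hom_image_complex_algebra:
  assumes \<phi>: "\<phi> \<in> alg_hom A B" and surj: "\<phi> ` carrier A = carrier B" and zero: "\<phi> \<zero>\<^bsub>A\<^esub> = \<zero>\<^bsub>B\<^esub>"
    and A: "complex_algebra A"
  shows "complex_algebra B"
proof -
  interpret A: complex_algebra A by fact
  show ?thesis
    by (rule complex_algebraI; unfold surj[symmetric])
      (auto simp: alg_homD(2-5)[OF \<phi>, symmetric] zero[symmetric] A.a_ac A.m_assoc A.l_distr A.r_distr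
        A.smult_l_distr A.smult_r_distr A.smult_assoc A.smult_mult_left A.smult_mult_right)
qed

text \<open>
  Two images of \<open>A\<close> with the same kernel are isomorphic.  The PBW isomorphism arises in this way.
\<close>

lemma alg_iso_of_same_kernel:
  assumes \<phi>: "\<phi> \<in> alg_hom A B" and surj: "\<phi> ` carrier A = carrier B"
    and \<psi>: "\<psi> \<in> alg_hom A C" and surj': "\<psi> ` carrier A = carrier C"
    and ker: "\<And>x y. x \<in> carrier A \<Longrightarrow> y \<in> carrier A \<Longrightarrow> \<phi> x = \<phi> y \<longleftrightarrow> \<psi> x = \<psi> y"
    and A: "complex_algebra A"
  obtains \<chi> where "\<chi> \<in> alg_iso B C" "\<And>x. x \<in> carrier A \<Longrightarrow> \<chi> (\<phi> x) = \<psi> x"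
proof -
  obtain \<chi> where \<chi>: "\<chi> \<in> alg_hom B C" and \<chi>\<phi>: "\<And>x. x \<in> carrier A \<Longrightarrow> \<chi> (\<phi> x) = \<psi> x"
    by (rule alg_hom_factor[OF \<phi> surj \<psi> _ A]) (use ker in auto)
  have "bij_betw \<chi> (carrier B) (carrier C)"
    unfolding bij_betw_def
  proof
    show "inj_on \<chi> (carrier B)"
      unfolding inj_on_def surj[symmetric] using \<chi>\<phi> ker by auto
    show "\<chi> ` carrier B = carrier C"
      unfolding surj[symmetric] surj'[symmetric] image_image using \<chi>\<phi> by auto
  qed
  then show ?thesis using \<chi> \<chi>\<phi> that by (auto simp: alg_iso_def alg_hom_def ring_iso_def)
qed

lemma (in complex_algebra)
  assumes "ideal I A"
  shows quot_algebra_simps: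
      "carrier (quot_algebra A I) = (+>) I ` carrier A"
      "x \<in> carrier A \<Longrightarrow> y \<in> carrier A \<Longrightarrow>
         (I +> x) \<otimes>\<^bsub>quot_algebra A I\<^esub> (I +> y) = I +> x \<otimes> y"
      "x \<in> carrier A \<Longrightarrow> y \<in> carrier A \<Longrightarrow>
         (I +> x) \<oplus>\<^bsub>quot_algebra A I\<^esub> (I +> y) = I +> (x \<oplus> y)"
      "\<one>\<^bsub>quot_algebra A I\<^esub> = I +> \<one>"
      "\<zero>\<^bsub>quot_algebra A I\<^esub> = I"
      "x \<in> carrier A \<Longrightarrow> c \<odot>\<^bsub>quot_algebra A I\<^esub> (I +> x) = I +> (c \<odot> x)"
    and quot_algebra_complex_algebra: "complex_algebra (quot_algebra A I)"
    and quot_algebra_eq_iff: "x \<in> carrier A \<Longrightarrow> y \<in> carrier A \<Longrightarrow> I +> x = I +> y \<longleftrightarrow> x \<ominus> y \<in> I"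
proof -
  interpret I: ideal I A by fact
  let ?Q = "quot_algebra A I"
  have smult_I: "c \<odot> i \<in> I" if "i \<in> I" for c i
  proof -
    have "c \<odot> i = (c \<odot> \<one>) \<otimes> i" using that I.Icarr by (simp add: smult_mult_left)
    then show ?thesis using that I.I_l_closed by simp
  qed
  show eq_iff: "I +> x = I +> y \<longleftrightarrow> x \<ominus> y \<in> I" if "x \<in> carrier A" "y \<in> carrier A" for x y
    using quotient_eq_iff_same_a_r_cos[OF assms] that by blast
  show carr: "carrier ?Q = (+>) I ` carrier A"
    by (auto simp: quot_algebra_def module.defs ring.defs FactRing_def A_RCOSETS_def' a_r_coset_def')
  show mult: "(I +> x) \<otimes>\<^bsub>?Q\<^esub> (I +> y) = I +> x \<otimes> y"
    if "x \<in> carrier A" "y \<in> carrier A" for x y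
    using that by (simp add: quot_algebra_def module.defs ring.defs FactRing_def I.rcoset_mult_add)
  show add: "(I +> x) \<oplus>\<^bsub>?Q\<^esub> (I +> y) = I +> (x \<oplus> y)"
    if "x \<in> carrier A" "y \<in> carrier A" for x y
    using that by (simp add: quot_algebra_def module.defs ring.defs FactRing_def I.a_rcos_sum)
  show one: "\<one>\<^bsub>?Q\<^esub> = I +> \<one>" and zero: "\<zero>\<^bsub>?Q\<^esub> = I"
    by (simp_all add: quot_algebra_def module.defs ring.defs FactRing_def)
  have zero': "\<zero>\<^bsub>?Q\<^esub> = I +> \<zero>" using I.a_subset zero by simp
  show smult: "c \<odot>\<^bsub>?Q\<^esub> (I +> x) = I +> (c \<odot> x)" if "x \<in> carrier A" for c x
  proof -
    have "I +> (c \<odot> a) = I +> (c \<odot> x)" if "a \<in> I +> x" for a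
    proof -
      from that have "\<exists>i\<in>I. a = i \<oplus> x" by (simp add: a_r_coset_def')
      then obtain i where i: "i \<in> I" "a = i \<oplus> x" ..
      then have "c \<odot> a \<ominus> c \<odot> x = c \<odot> i"
        using \<open>x \<in> carrier A\<close> I.Icarr by (simp add: smult_r_distr a_minus_def a_assoc r_neg)
      then show ?thesis using eq_iff \<open>x \<in> carrier A\<close> i I.Icarr smult_I by simp
    qed
    moreover have "x \<in> I +> x" using that by (rule I.a_rcos_self)
    \<comment> \<open>All representatives of the coset give the same coset, so the union collapses.\<close>
    ultimately have "(\<Union>a\<in>I +> x. I +> (c \<odot> a)) = I +> (c \<odot> x)"
      by (intro SUP_eq_const) (assumption | blast)+
    then show ?thesis by (simp add: quot_algebra_def module.defs ring.defs)
  qed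
  show "complex_algebra ?Q"
    by (rule complex_algebraI)
      (auto simp: carr mult add smult one zero' smult_l_distr smult_r_distr smult_assoc
        smult_mult_left smult_mult_right a_ac m_assoc l_distr r_distr)
qed

lemma (in complex_algebra) quot_proj_hom:
  assumes "ideal I A"
  shows "(+>) I \<in> alg_hom A (quot_algebra A I)"
  by (rule alg_homI) (auto simp: quot_algebra_simps[OF assms])

lemma (in complex_algebra) quot_lift:
  assumes I: "ideal I A" and B: "complex_algebra B" and \<psi>: "\<psi> \<in> alg_hom A B"
    and kill: "\<And>x. x \<in> I \<Longrightarrow> \<psi> x = \<zero>\<^bsub>B\<^esub>"
  obtains \<chi> where "\<chi> \<in> alg_hom (quot_algebra A I) B" "\<And>x. x \<in> carrier A \<Longrightarrow> \<chi> (I +> x) = \<psi> x"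
proof (rule alg_hom_factor[OF quot_proj_hom[OF I] _ \<psi>])
  interpret B: complex_algebra B by fact
  note hom = alg_hom_minus[OF complex_algebra_axioms B \<psi>] alg_hom_closed[OF \<psi>]
  show "\<psi> x = \<psi> y" if "x \<in> carrier A" "y \<in> carrier A" "I +> x = I +> y" for x y
    using kill[of "x \<ominus> y"] that hom quot_algebra_eq_iff[OF I] B.eq_iff_minus_zero by simp
qed (use that complex_algebra_axioms in \<open>auto simp: quot_algebra_simps[OF I]\<close>)

context complex_algebra
begin

definition bracket :: "'a \<Rightarrow> 'a \<Rightarrow> 'a" where
  "bracket x y = x \<otimes> y \<ominus> y \<otimes> x"

lemma bracket_closed [simp, intro]: "x \<in> carrier A \<Longrightarrow> y \<in> carrier A \<Longrightarrow> bracket x y \<in> carrier A"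
  by (simp add: bracket_def)

lemma bracket_add_left:
  assumes "x \<in> carrier A" "y \<in> carrier A" "z \<in> carrier A"
  shows "bracket (x \<oplus> y) z = bracket x z \<oplus> bracket y z"
  unfolding bracket_def using assms by algebra

lemma bracket_add_right:
  assumes "x \<in> carrier A" "y \<in> carrier A" "z \<in> carrier A"
  shows "bracket z (x \<oplus> y) = bracket z x \<oplus> bracket z y"
  unfolding bracket_def using assms by algebra

lemma bracket_swap: "x \<in> carrier A \<Longrightarrow> y \<in> carrier A \<Longrightarrow> bracket y x = \<ominus> bracket x y"
  unfolding bracket_def by algebra

lemma bracket_self [simp]: "x \<in> carrier A \<Longrightarrow> bracket x x = \<zero>"
  unfolding bracket_def by algebra

lemma bracket_smult:
  assumes "x \<in> carrier A" "y \<in> carrier A"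
  shows "bracket (c \<odot> x) y = c \<odot> bracket x y" "bracket x (c \<odot> y) = c \<odot> bracket x y"
  unfolding bracket_def using assms
  by (simp_all add: smult_mult_left smult_mult_right smult_minus_right)

lemma bracket_finsum_left:
  assumes "f \<in> S \<rightarrow> carrier A" "x \<in> carrier A"
  shows "bracket (\<Oplus>i\<in>S. f i) x = (\<Oplus>i\<in>S. bracket (f i) x)"
  unfolding bracket_def using assms
  by (simp add: finsum_mult_left finsum_mult_right finsum_minus Pi_iff)

lemma bracket_finsum_right:
  assumes "f \<in> S \<rightarrow> carrier A" "x \<in> carrier A"
  shows "bracket x (\<Oplus>i\<in>S. f i) = (\<Oplus>i\<in>S. bracket x (f i))"
  unfolding bracket_def using assms
  by (simp add: finsum_mult_left finsum_mult_right finsum_minus Pi_iff)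

end

section \<open>Free algebras\<close>

definition monomial :: "complex \<Rightarrow> 'x list \<Rightarrow> 'x list \<Rightarrow> complex" where
  "monomial c u = (\<lambda>w. if w = u then c else 0)"

lemma free_algebra_simps:
  "f \<in> carrier (free_algebra X) \<longleftrightarrow> finite {w. f w \<noteq> 0} \<and> {w. f w \<noteq> 0} \<subseteq> lists X"
  "f \<otimes>\<^bsub>free_algebra X\<^esub> g = (\<lambda>w. \<Sum>i\<le>length w. f (take i w) * g (drop i w))"
  "\<one>\<^bsub>free_algebra X\<^esub> = monomial 1 []"
  "\<zero>\<^bsub>free_algebra X\<^esub> = (\<lambda>w. 0)"
  "f \<oplus>\<^bsub>free_algebra X\<^esub> g = (\<lambda>w. f w + g w)"
  "c \<odot>\<^bsub>free_algebra X\<^esub> f = (\<lambda>w. c * f w)"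
  by (auto simp: free_algebra_def monomial_def fun_eq_iff)

lemma monomial_closed: "u \<in> lists X \<Longrightarrow> monomial c u \<in> carrier (free_algebra X)"
  by (rule CollectI[of "\<lambda>f. f \<in> carrier (free_algebra X)", simplified])
    (auto simp: free_algebra_simps monomial_def)

lemma free_algebra_add_closed:
  assumes "f \<in> carrier (free_algebra X)" "g \<in> carrier (free_algebra X)"
  shows "(\<lambda>w. f w + g w) \<in> carrier (free_algebra X)"
proof -
  have "{w. f w + g w \<noteq> 0} \<subseteq> {w. f w \<noteq> 0} \<union> {w. g w \<noteq> 0}" by auto
  then show ?thesis using assms finite_subset unfolding free_algebra_simps by fastforce
qed

text \<open>
  An identity that is additive in each argument holds once it holds for monomials.  For the product this replaces
  computations with sums over the splittings of a word.
\<close>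

lemma free_algebra_induct [consumes 1, case_names monomial add]:
  assumes f: "f \<in> carrier (free_algebra X)"
    and mono: "\<And>c u. u \<in> lists X \<Longrightarrow> P (monomial c u)"
    and add: "\<And>f g. f \<in> carrier (free_algebra X) \<Longrightarrow> g \<in> carrier (free_algebra X) \<Longrightarrow>
      P f \<Longrightarrow> P g \<Longrightarrow> P (\<lambda>w. f w + g w)"
  shows "P f"
proof -
  define S where "S = {w. f w \<noteq> 0}"
  have S: "finite S" "S \<subseteq> lists X" using f by (auto simp: S_def free_algebra_simps)
  have "P f \<and> f \<in> carrier (free_algebra X)" if "\<And>w. w \<notin> S \<Longrightarrow> f w = 0" for f
    using S that
  proof (induct S arbitrary: f rule: finite_induct)
    case empty
    then have "f = monomial 0 []" by (auto simp: monomial_def)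
    then show ?case using mono monomial_closed by (metis lists.Nil)
  next
    case (insert u S)
    let ?g = "f(u := 0)"
    have g: "P ?g \<and> ?g \<in> carrier (free_algebra X)"
      by (rule insert.hyps(3)) (use insert.prems in auto)
    have f: "f = (\<lambda>w. monomial (f u) u w + ?g w)" by (auto simp: monomial_def)
    have u: "u \<in> lists X" using insert.prems by simp
    show ?case
      using add[OF monomial_closed[OF u] _ mono[OF u], of ?g "f u"] g f
        free_algebra_add_closed[OF monomial_closed[OF u], of ?g "f u"] by simp
  qed
  then show ?thesis using S_def by blast
qed

lemma conv_monomial:
  "monomial c u \<otimes>\<^bsub>free_algebra X\<^esub> monomial d v = monomial (c * d) (u @ v)"
proof
  fix w
  have "(\<Sum>i\<le>length w. monomial c u (take i w) * monomial d v (drop i w))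
      = (\<Sum>i\<le>length w. if i = length u then (if w = u @ v then c * d else 0) else 0)"
  proof (rule sum.cong)
    fix i assume "i \<in> {..length w}"
    \<comment> \<open>Only the splitting of \<open>w\<close> after \<open>length u\<close> letters contributes.\<close>
    then have "length (take i w) = i" by simp
    then have "take i w = u \<and> drop i w = v \<longleftrightarrow> i = length u \<and> w = u @ v"
      using append_take_drop_id[of i w] by (metis append_eq_conv_conj)
    moreover have "monomial c u (take i w) * monomial d v (drop i w)
        = (if take i w = u \<and> drop i w = v then c * d else 0)"
      by (simp add: monomial_def)
    ultimately show "monomial c u (take i w) * monomial d v (drop i w)
        = (if i = length u then (if w = u @ v then c * d else 0) else 0)"
      by simp
  qed simp
  also have "\<dots> = monomial (c * d) (u @ v) w" by (auto simp: monomial_def)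
  finally show "(monomial c u \<otimes>\<^bsub>free_algebra X\<^esub> monomial d v) w = monomial (c * d) (u @ v) w"
    by (simp add: free_algebra_simps)
qed

lemma conv_distrib:
  "(\<lambda>w. f w + f' w) \<otimes>\<^bsub>free_algebra X\<^esub> g = (\<lambda>w. (f \<otimes>\<^bsub>free_algebra X\<^esub> g) w + (f' \<otimes>\<^bsub>free_algebra X\<^esub> g) w)"
  "f \<otimes>\<^bsub>free_algebra X\<^esub> (\<lambda>w. g w + g' w) = (\<lambda>w. (f \<otimes>\<^bsub>free_algebra X\<^esub> g) w + (f \<otimes>\<^bsub>free_algebra X\<^esub> g') w)"
  by (simp_all add: free_algebra_simps distrib_left distrib_right sum.distrib)

lemma conv_closed:
  assumes "f \<in> carrier (free_algebra X)" "g \<in> carrier (free_algebra X)"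
  shows "f \<otimes>\<^bsub>free_algebra X\<^esub> g \<in> carrier (free_algebra X)"
  using assms(1)
proof (induct f rule: free_algebra_induct)
  case (monomial c u)
  from assms(2) show ?case
    by (induct g rule: free_algebra_induct)
      (use monomial in \<open>auto simp: conv_monomial conv_distrib intro!: monomial_closed free_algebra_add_closed\<close>)
qed (simp add: conv_distrib free_algebra_add_closed)

lemma conv_assoc:
  fixes X :: "'x set"
  defines "F \<equiv> free_algebra X"
  assumes "f \<in> carrier F" "g \<in> carrier F" "h \<in> carrier F"
  shows "(f \<otimes>\<^bsub>F\<^esub> g) \<otimes>\<^bsub>F\<^esub> h = f \<otimes>\<^bsub>F\<^esub> (g \<otimes>\<^bsub>F\<^esub> h)"
  using assms(2) unfolding F_def
proof (induct f rule: free_algebra_induct)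
  case (monomial c u)
  from assms(3)[unfolded F_def] show ?case
  proof (induct g rule: free_algebra_induct)
    case (monomial d v)
    from assms(4)[unfolded F_def] show ?case
      by (induct h rule: free_algebra_induct) (simp_all add: conv_monomial conv_distrib mult.assoc)
  qed (simp add: conv_distrib)
qed (simp add: conv_distrib)

lemma free_algebra_complex_algebra: "complex_algebra (free_algebra X)"
proof (rule complex_algebraI)
  let ?F = "free_algebra X"
  fix f g h and c d :: complex
  assume f: "f \<in> carrier ?F"
  show "c \<odot>\<^bsub>?F\<^esub> f \<in> carrier ?F"
    using f by (auto simp: free_algebra_simps elim: finite_subset[rotated])
  show "\<one>\<^bsub>?F\<^esub> \<otimes>\<^bsub>?F\<^esub> f = f"
    using f by (induct f rule: free_algebra_induct)
      (simp_all add: conv_distrib free_algebra_simps(3) conv_monomial)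
  show "f \<otimes>\<^bsub>?F\<^esub> \<one>\<^bsub>?F\<^esub> = f"
    using f by (induct f rule: free_algebra_induct)
      (simp_all add: conv_distrib free_algebra_simps(3) conv_monomial)
  assume g: "g \<in> carrier ?F"
  show "f \<oplus>\<^bsub>?F\<^esub> g \<in> carrier ?F" using f g free_algebra_add_closed by (simp add: free_algebra_simps(5))
  show "(c \<odot>\<^bsub>?F\<^esub> f) \<otimes>\<^bsub>?F\<^esub> g = c \<odot>\<^bsub>?F\<^esub> (f \<otimes>\<^bsub>?F\<^esub> g)"
    "f \<otimes>\<^bsub>?F\<^esub> (c \<odot>\<^bsub>?F\<^esub> g) = c \<odot>\<^bsub>?F\<^esub> (f \<otimes>\<^bsub>?F\<^esub> g)"
    by (simp_all add: free_algebra_simps sum_distrib_left algebra_simps)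
  show "f \<otimes>\<^bsub>?F\<^esub> g \<in> carrier ?F" using f g by (rule conv_closed)
  assume "h \<in> carrier ?F"
  then show "(f \<otimes>\<^bsub>?F\<^esub> g) \<otimes>\<^bsub>?F\<^esub> h = f \<otimes>\<^bsub>?F\<^esub> (g \<otimes>\<^bsub>?F\<^esub> h)"
    using f g conv_assoc by blast
next
  show "\<one>\<^bsub>free_algebra X\<^esub> \<in> carrier (free_algebra X)"
    by (simp add: free_algebra_simps(3) monomial_closed)
qed (auto simp: free_algebra_simps algebra_simps sum.distrib)

lemma free_algebra_finsum:
  assumes "f \<in> S \<rightarrow> carrier (free_algebra X)"
  shows "(\<Oplus>\<^bsub>free_algebra X\<^esub>i\<in>S. f i) = (\<lambda>w. \<Sum>i\<in>S. f i w)"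
proof -
  interpret complex_algebra "free_algebra X" by (rule free_algebra_complex_algebra)
  show ?thesis using assms
    by (induct S rule: infinite_finite_induct) (auto simp: Pi_iff free_algebra_simps)
qed

lemma letter_eq_monomial: "letter x = monomial 1 [x]"
  by (simp add: letter_def monomial_def)

lemma letter_closed [simp]: "x \<in> X \<Longrightarrow> letter x \<in> carrier (free_algebra X)"
  by (simp add: letter_eq_monomial monomial_closed)

definition word_prod :: "(complex, 'b) module \<Rightarrow> ('x \<Rightarrow> 'b) \<Rightarrow> 'x list \<Rightarrow> 'b" where
  "word_prod B h w = foldr (\<lambda>x y. h x \<otimes>\<^bsub>B\<^esub> y) w \<one>\<^bsub>B\<^esub>"

lemma word_prod_simps [simp]:
  "word_prod B h [] = \<one>\<^bsub>B\<^esub>" "word_prod B h (x # w) = h x \<otimes>\<^bsub>B\<^esub> word_prod B h w"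
  by (simp_all add: word_prod_def)

text \<open>
  The algebra homomorphism out of the free algebra with prescribed values on the letters.
\<close>

definition free_ext :: "(complex, 'b) module \<Rightarrow> ('x \<Rightarrow> 'b) \<Rightarrow> ('x list \<Rightarrow> complex) \<Rightarrow> 'b" where
  "free_ext B h f = (\<Oplus>\<^bsub>B\<^esub>w\<in>{w. f w \<noteq> 0}. f w \<odot>\<^bsub>B\<^esub> word_prod B h w)"

lemma monomial_eq_word_prod:
  "monomial c u = c \<odot>\<^bsub>free_algebra X\<^esub> word_prod (free_algebra X) letter u"
proof -
  have "word_prod (free_algebra X) letter u = monomial 1 u"
    by (induct u) (simp_all only: word_prod_simps letter_eq_monomial conv_monomial free_algebra_simps(3), simp_all)
  then show ?thesis by (auto simp: free_algebra_simps monomial_def)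
qed

context complex_algebra
begin

lemma word_prod_closed [simp]: "h \<in> X \<rightarrow> carrier A \<Longrightarrow> w \<in> lists X \<Longrightarrow> word_prod A h w \<in> carrier A"
  by (induct w) auto

lemma word_prod_append:
  "h \<in> X \<rightarrow> carrier A \<Longrightarrow> u \<in> lists X \<Longrightarrow> v \<in> lists X \<Longrightarrow>
     word_prod A h (u @ v) = word_prod A h u \<otimes> word_prod A h v"
  by (induct u) (auto simp: m_assoc Pi_iff intro!: word_prod_closed[where X=X])

context
  fixes X :: "'x set" and h :: "'x \<Rightarrow> 'a"
  assumes h: "h \<in> X \<rightarrow> carrier A"
begin

lemma free_ext_superset:
  assumes "finite W" "{w. f w \<noteq> 0} \<subseteq> W" "W \<subseteq> lists X"
  shows "free_ext A h f = (\<Oplus>w\<in>W. f w \<odot> word_prod A h w)"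
  unfolding free_ext_def
proof (rule add.finprod_mono_neutral_cong_left)
  show "f w \<odot> word_prod A h w = \<zero>" if "w \<in> W - {w. f w \<noteq> 0}" for w
    using that assms zero_smult[OF word_prod_closed[OF h, of w]] by auto
  show "(\<lambda>w. f w \<odot> word_prod A h w) \<in> W \<rightarrow> carrier A"
    using assms by (auto intro!: smult_closed word_prod_closed[OF h])
qed (use assms in auto)

lemma free_ext_closed [simp]: "f \<in> carrier (free_algebra X) \<Longrightarrow> free_ext A h f \<in> carrier A"
  unfolding free_ext_def using h by (auto simp: free_algebra_simps intro!: finsum_closed smult_closed word_prod_closed[OF h])

lemma free_ext_monomial: 
  assumes "u \<in> lists X" shows "free_ext A h (monomial c u) = c \<odot> word_prod A h u"
  using assms by (subst free_ext_superset[of "{u}"]) (use word_prod_closed[OF h] in \<open>auto simp: monomial_def Pi_iff\<close>)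

lemma free_ext_add:
  assumes "f \<in> carrier (free_algebra X)" "g \<in> carrier (free_algebra X)"
  shows "free_ext A h (\<lambda>w. f w + g w) = free_ext A h f \<oplus> free_ext A h g"
proof -
  let ?W = "{w. f w \<noteq> 0} \<union> {w. g w \<noteq> 0}"
  have W: "finite ?W" "?W \<subseteq> lists X" using assms by (auto simp: free_algebra_simps)
  have wp: "word_prod A h w \<in> carrier A" if "w \<in> ?W" for w
    using that W word_prod_closed[OF h] by blast
  have "free_ext A h (\<lambda>w. f w + g w) = (\<Oplus>w\<in>?W. (f w + g w) \<odot> word_prod A h w)"
    by (rule free_ext_superset) (use W in auto)
  also have "\<dots> = (\<Oplus>w\<in>?W. f w \<odot> word_prod A h w \<oplus> g w \<odot> word_prod A h w)"
    by (rule add.finprod_cong') (use wp in \<open>auto simp: smult_l_distr\<close>)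
  also have "\<dots> = (\<Oplus>w\<in>?W. f w \<odot> word_prod A h w) \<oplus> (\<Oplus>w\<in>?W. g w \<odot> word_prod A h w)"
    by (rule finsum_addf) (use wp in auto)
  also have "\<dots> = free_ext A h f \<oplus> free_ext A h g"
    using W by (subst (1 2) free_ext_superset[of ?W]) auto
  finally show ?thesis .
qed

lemma free_ext_letter: "x \<in> X \<Longrightarrow> free_ext A h (letter x) = h x"
  using h by (simp add: letter_eq_monomial free_ext_monomial Pi_iff)

lemma free_ext_hom: "free_ext A h \<in> alg_hom (free_algebra X) A"
proof (rule alg_homI)
  interpret F: complex_algebra "free_algebra X" by (rule free_algebra_complex_algebra)
  let ?F = "free_algebra X"
  note wp = word_prod_closed[OF h]
  note [simp] = free_ext_monomial conv_monomial wp conv_distrib free_ext_add monomial_closed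
  show "free_ext A h (f \<oplus>\<^bsub>?F\<^esub> g) = free_ext A h f \<oplus> free_ext A h g"
    if "f \<in> carrier ?F" "g \<in> carrier ?F" for f g
    using that by (simp add: free_algebra_simps(5))
  show "free_ext A h \<one>\<^bsub>?F\<^esub> = \<one>" by (simp add: free_algebra_simps(3))
  show "free_ext A h (c \<odot>\<^bsub>?F\<^esub> f) = c \<odot> free_ext A h f" if f: "f \<in> carrier ?F" for c f
    using f
  proof (induct f rule: free_algebra_induct)
    case (monomial d u)
    have "c \<odot>\<^bsub>?F\<^esub> monomial d u = monomial (c * d) u"
      by (auto simp: free_algebra_simps monomial_def)
    then show ?case using monomial by (simp add: smult_assoc)
  next
    case (add f g)
    then show ?case
      using F.smult_r_distr[of f g c] F.smult_closed[of f c] F.smult_closed[of g c]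
      by (simp add: free_algebra_simps(5) smult_r_distr)
  qed
  show "free_ext A h (f \<otimes>\<^bsub>?F\<^esub> g) = free_ext A h f \<otimes> free_ext A h g"
    if f: "f \<in> carrier ?F" and g: "g \<in> carrier ?F" for f g
    using f
  proof (induct f rule: free_algebra_induct)
    case (monomial c u)
    from g show ?case
    proof (induct g rule: free_algebra_induct)
      case (monomial d v)
      then show ?case using \<open>u \<in> lists X\<close>
        by (simp add: word_prod_append[OF h] smult_mult_left smult_mult_right mult.commute flip: smult_assoc)

    next
      case (add f g)
      then show ?case using \<open>u \<in> lists X\<close> by (simp add: conv_closed r_distr)
    qed
  next
    case (add f f')
    then show ?case using g by (simp add: conv_closed l_distr)
  qed
qed simp

end

end

text \<open>An algebra homomorphism is determined by the images of the letters.\<close>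

lemma free_algebra_hom_unique:
  assumes B: "complex_algebra B" and \<phi>: "\<phi> \<in> alg_hom (free_algebra X) B" and \<psi>: "\<psi> \<in> alg_hom (free_algebra X) B"
    and eq: "\<And>x. x \<in> X \<Longrightarrow> \<phi> (letter x) = \<psi> (letter x)" and f: "f \<in> carrier (free_algebra X)"
  shows "\<phi> f = \<psi> f"
  using f
proof (induct f rule: free_algebra_induct)
  interpret F: complex_algebra "free_algebra X" by (rule free_algebra_complex_algebra)
  let ?F = "free_algebra X"
  have wp: "word_prod ?F letter u \<in> carrier ?F" if "u \<in> lists X" for u
    by (rule F.word_prod_closed[where X=X]) (use that in auto)
  case (monomial c u)
  then have "\<phi> (word_prod ?F letter u) = \<psi> (word_prod ?F letter u)"
    by (induct u) (auto simp: alg_hom_one[OF \<phi>] alg_hom_one[OF \<psi>] alg_hom_mult[OF \<phi>] alg_hom_mult[OF \<psi>] wp eq)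
  then show ?case
    using monomial by (simp add: monomial_eq_word_prod[of c u X] alg_hom_smult[OF \<phi>] alg_hom_smult[OF \<psi>] wp)
next
  case (add f g)
  then show ?case
    using alg_hom_add[OF \<phi>, of f g] alg_hom_add[OF \<psi>, of f g] by (simp add: free_algebra_simps(5))
qed

section \<open>Semidirect products with a group algebra\<close>

text \<open>
  The product of \<open>t \<in> T\<close> and \<open>g \<in> G\<close> in the semidirect product.
\<close>

definition mon_elt :: "'g monoid \<Rightarrow> (complex, 'a) module \<Rightarrow> 'g \<Rightarrow> 'a \<Rightarrow> 'g \<Rightarrow> 'a" where
  "mon_elt G T g t = (\<lambda>x\<in>carrier G. if x = g then t else \<zero>\<^bsub>T\<^esub>)"

lemma group_elt_eq_mon: "group_elt G T g = mon_elt G T g \<one>\<^bsub>T\<^esub>"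
  and alg_elt_eq_mon: "alg_elt G T t = mon_elt G T \<one>\<^bsub>G\<^esub> t"
  by (simp_all add: group_elt_def alg_elt_def mon_elt_def)

lemma mon_elt_apply: "x \<in> carrier G \<Longrightarrow> mon_elt G T g t x = (if x = g then t else \<zero>\<^bsub>T\<^esub>)"
  by (simp add: mon_elt_def)

lemma semidirect_algebra_simps:
  "carrier (semidirect_algebra G T act) = carrier G \<rightarrow>\<^sub>E carrier T"
  "f \<otimes>\<^bsub>semidirect_algebra G T act\<^esub> f' = (\<lambda>x\<in>carrier G.
        \<Oplus>\<^bsub>T\<^esub>g\<in>carrier G. f g \<otimes>\<^bsub>T\<^esub> act g (f' (inv\<^bsub>G\<^esub> g \<otimes>\<^bsub>G\<^esub> x)))"
  "\<one>\<^bsub>semidirect_algebra G T act\<^esub> = mon_elt G T \<one>\<^bsub>G\<^esub> \<one>\<^bsub>T\<^esub>"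
  "\<zero>\<^bsub>semidirect_algebra G T act\<^esub> = (\<lambda>x\<in>carrier G. \<zero>\<^bsub>T\<^esub>)"
  "f \<oplus>\<^bsub>semidirect_algebra G T act\<^esub> f' = (\<lambda>x\<in>carrier G. f x \<oplus>\<^bsub>T\<^esub> f' x)"
  "c \<odot>\<^bsub>semidirect_algebra G T act\<^esub> f = (\<lambda>x\<in>carrier G. c \<odot>\<^bsub>T\<^esub> f x)"
  by (auto simp: semidirect_algebra_def mon_elt_def)

locale semidirect = T: complex_algebra T + G: group G
  for T :: "(complex, 'a) module" and G :: "'g monoid" +
  fixes act :: "'g \<Rightarrow> 'a \<Rightarrow> 'a"
  assumes finite_G: "finite (carrier G)"
    and act_hom: "g \<in> carrier G \<Longrightarrow> act g \<in> alg_hom T T"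
    and act_one: "t \<in> carrier T \<Longrightarrow> act \<one>\<^bsub>G\<^esub> t = t"
    and act_mult: "g \<in> carrier G \<Longrightarrow> h \<in> carrier G \<Longrightarrow> t \<in> carrier T \<Longrightarrow>
      act (g \<otimes>\<^bsub>G\<^esub> h) t = act g (act h t)"
begin

abbreviation "S \<equiv> semidirect_algebra G T act"
abbreviation "gmon \<equiv> mon_elt G T"

lemma act_closed [simp, intro]: "g \<in> carrier G \<Longrightarrow> t \<in> carrier T \<Longrightarrow> act g t \<in> carrier T"
  using act_hom alg_hom_closed by fast

lemma act_simps [simp]:
  assumes "g \<in> carrier G"
  shows "act g \<zero>\<^bsub>T\<^esub> = \<zero>\<^bsub>T\<^esub>" "act g \<one>\<^bsub>T\<^esub> = \<one>\<^bsub>T\<^esub>"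
    "t \<in> carrier T \<Longrightarrow> s \<in> carrier T \<Longrightarrow> act g (t \<oplus>\<^bsub>T\<^esub> s) = act g t \<oplus>\<^bsub>T\<^esub> act g s"
    "t \<in> carrier T \<Longrightarrow> s \<in> carrier T \<Longrightarrow> act g (t \<otimes>\<^bsub>T\<^esub> s) = act g t \<otimes>\<^bsub>T\<^esub> act g s"
    "t \<in> carrier T \<Longrightarrow> act g (c \<odot>\<^bsub>T\<^esub> t) = c \<odot>\<^bsub>T\<^esub> act g t"
  using alg_hom_zero[OF T.complex_algebra_axioms T.complex_algebra_axioms act_hom[OF assms]]
    alg_homD[OF act_hom[OF assms]] by auto

lemma carrier_apply: "f \<in> carrier S \<Longrightarrow> x \<in> carrier G \<Longrightarrow> f x \<in> carrier T"
  by (auto simp: semidirect_algebra_simps)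

lemma S_eqI: "f \<in> carrier S \<Longrightarrow> f' \<in> carrier S \<Longrightarrow> (\<And>x. x \<in> carrier G \<Longrightarrow> f x = f' x) \<Longrightarrow> f = f'"
  by (auto simp: semidirect_algebra_simps intro: PiE_ext)

lemma mon_closed [simp, intro]: "t \<in> carrier T \<Longrightarrow> gmon g t \<in> carrier S"
  by (auto simp: semidirect_algebra_simps mon_elt_def)

lemma mult_term_closed:
  assumes "f \<in> carrier S" "f' \<in> carrier S" "x \<in> carrier G" "g \<in> carrier G"
  shows "f g \<otimes>\<^bsub>T\<^esub> act g (f' (inv\<^bsub>G\<^esub> g \<otimes>\<^bsub>G\<^esub> x)) \<in> carrier T"
  using assms by (intro T.m_closed act_closed carrier_apply) auto

lemma S_closed:
  assumes "f \<in> carrier S" "f' \<in> carrier S"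
  shows "f \<otimes>\<^bsub>S\<^esub> f' \<in> carrier S" "f \<oplus>\<^bsub>S\<^esub> f' \<in> carrier S" "c \<odot>\<^bsub>S\<^esub> f \<in> carrier S"
    "\<zero>\<^bsub>S\<^esub> \<in> carrier S" "\<one>\<^bsub>S\<^esub> \<in> carrier S"
proof -
  show "f \<otimes>\<^bsub>S\<^esub> f' \<in> carrier S"
    using mult_term_closed[OF assms] by (auto simp: semidirect_algebra_simps(1,2) intro!: T.finsum_closed)
qed (use assms in \<open>auto simp: semidirect_algebra_simps mon_elt_def\<close>)

text \<open>
  The crossed product rule \<open>(t g) (s h) = (t g(s)) (g h)\<close>.  As the elements \<open>t g\<close> generate the semidirect
  product additively, all algebra laws are derived from this rule.
\<close>

lemma mon_mult:
  assumes g: "g \<in> carrier G" and h: "h \<in> carrier G" and t: "t \<in> carrier T" and s: "s \<in> carrier T"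
  shows "gmon g t \<otimes>\<^bsub>S\<^esub> gmon h s = gmon (g \<otimes>\<^bsub>G\<^esub> h) (t \<otimes>\<^bsub>T\<^esub> act g s)"
proof (rule S_eqI)
  fix x assume x: "x \<in> carrier G"
  have "(gmon g t \<otimes>\<^bsub>S\<^esub> gmon h s) x = (\<Oplus>\<^bsub>T\<^esub>k\<in>carrier G. gmon g t k \<otimes>\<^bsub>T\<^esub> act k (gmon h s (inv\<^bsub>G\<^esub> k \<otimes>\<^bsub>G\<^esub> x)))"
    using x by (simp add: semidirect_algebra_simps)
  also have "\<dots> = gmon g t g \<otimes>\<^bsub>T\<^esub> act g (gmon h s (inv\<^bsub>G\<^esub> g \<otimes>\<^bsub>G\<^esub> x))"
    by (rule T.finsum_single[OF finite_G g])
      (use assms x in \<open>auto intro!: mult_term_closed simp: mon_elt_apply\<close>)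
  also have "\<dots> = gmon (g \<otimes>\<^bsub>G\<^esub> h) (t \<otimes>\<^bsub>T\<^esub> act g s) x"
  proof -
    \<comment> \<open>In the convolution sum only the index \<open>g\<close> contributes, and only at \<open>x = g h\<close>.\<close>
    have "inv\<^bsub>G\<^esub> g \<otimes>\<^bsub>G\<^esub> x = h \<longleftrightarrow> x = g \<otimes>\<^bsub>G\<^esub> h"
      using g h x by (metis G.inv_solve_left)
    then show ?thesis using assms x by (simp add: mon_elt_apply)
  qed
  finally show "(gmon g t \<otimes>\<^bsub>S\<^esub> gmon h s) x = gmon (g \<otimes>\<^bsub>G\<^esub> h) (t \<otimes>\<^bsub>T\<^esub> act g s) x" .
qed (use assms in \<open>auto intro!: S_closed(1) mon_closed\<close>)

lemma S_distrib:
  assumes f: "f \<in> carrier S" and f': "f' \<in> carrier S" and h: "h \<in> carrier S"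
  shows "(f \<oplus>\<^bsub>S\<^esub> f') \<otimes>\<^bsub>S\<^esub> h = f \<otimes>\<^bsub>S\<^esub> h \<oplus>\<^bsub>S\<^esub> f' \<otimes>\<^bsub>S\<^esub> h"
    "h \<otimes>\<^bsub>S\<^esub> (f \<oplus>\<^bsub>S\<^esub> f') = h \<otimes>\<^bsub>S\<^esub> f \<oplus>\<^bsub>S\<^esub> h \<otimes>\<^bsub>S\<^esub> f'"
proof -
  note [simp] = carrier_apply[OF f] carrier_apply[OF f'] carrier_apply[OF h]
  show "(f \<oplus>\<^bsub>S\<^esub> f') \<otimes>\<^bsub>S\<^esub> h = f \<otimes>\<^bsub>S\<^esub> h \<oplus>\<^bsub>S\<^esub> f' \<otimes>\<^bsub>S\<^esub> h"
  proof (rule S_eqI)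
    fix x assume x: "x \<in> carrier G"
    have "((f \<oplus>\<^bsub>S\<^esub> f') \<otimes>\<^bsub>S\<^esub> h) x = (\<Oplus>\<^bsub>T\<^esub>g\<in>carrier G. (f g \<oplus>\<^bsub>T\<^esub> f' g) \<otimes>\<^bsub>T\<^esub> act g (h (inv\<^bsub>G\<^esub> g \<otimes>\<^bsub>G\<^esub> x)))"
      using x by (auto simp: semidirect_algebra_simps intro!: T.add.finprod_cong')
    also have "\<dots> = (\<Oplus>\<^bsub>T\<^esub>g\<in>carrier G. f g \<otimes>\<^bsub>T\<^esub> act g (h (inv\<^bsub>G\<^esub> g \<otimes>\<^bsub>G\<^esub> x)) \<oplus>\<^bsub>T\<^esub> f' g \<otimes>\<^bsub>T\<^esub> act g (h (inv\<^bsub>G\<^esub> g \<otimes>\<^bsub>G\<^esub> x)))"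
      by (rule T.add.finprod_cong') (use x in \<open>auto simp: T.l_distr\<close>)
    also have "\<dots> = (f \<otimes>\<^bsub>S\<^esub> h \<oplus>\<^bsub>S\<^esub> f' \<otimes>\<^bsub>S\<^esub> h) x"
      by (subst T.finsum_addf) (use x in \<open>auto simp: semidirect_algebra_simps\<close>)
    finally show "((f \<oplus>\<^bsub>S\<^esub> f') \<otimes>\<^bsub>S\<^esub> h) x = (f \<otimes>\<^bsub>S\<^esub> h \<oplus>\<^bsub>S\<^esub> f' \<otimes>\<^bsub>S\<^esub> h) x" .
  qed (use assms S_closed in auto)
  show "h \<otimes>\<^bsub>S\<^esub> (f \<oplus>\<^bsub>S\<^esub> f') = h \<otimes>\<^bsub>S\<^esub> f \<oplus>\<^bsub>S\<^esub> h \<otimes>\<^bsub>S\<^esub> f'"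
  proof (rule S_eqI)
    fix x assume x: "x \<in> carrier G"
    have "(h \<otimes>\<^bsub>S\<^esub> (f \<oplus>\<^bsub>S\<^esub> f')) x = (\<Oplus>\<^bsub>T\<^esub>g\<in>carrier G. h g \<otimes>\<^bsub>T\<^esub> act g (f (inv\<^bsub>G\<^esub> g \<otimes>\<^bsub>G\<^esub> x) \<oplus>\<^bsub>T\<^esub> f' (inv\<^bsub>G\<^esub> g \<otimes>\<^bsub>G\<^esub> x)))"
      using x by (auto simp: semidirect_algebra_simps intro!: T.add.finprod_cong')
    also have "\<dots> = (\<Oplus>\<^bsub>T\<^esub>g\<in>carrier G. h g \<otimes>\<^bsub>T\<^esub> act g (f (inv\<^bsub>G\<^esub> g \<otimes>\<^bsub>G\<^esub> x)) \<oplus>\<^bsub>T\<^esub> h g \<otimes>\<^bsub>T\<^esub> act g (f' (inv\<^bsub>G\<^esub> g \<otimes>\<^bsub>G\<^esub> x)))"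
      by (rule T.add.finprod_cong') (use x in \<open>auto simp: T.r_distr\<close>)
    also have "\<dots> = (h \<otimes>\<^bsub>S\<^esub> f \<oplus>\<^bsub>S\<^esub> h \<otimes>\<^bsub>S\<^esub> f') x"
      by (subst T.finsum_addf) (use x in \<open>auto simp: semidirect_algebra_simps\<close>)
    finally show "(h \<otimes>\<^bsub>S\<^esub> (f \<oplus>\<^bsub>S\<^esub> f')) x = (h \<otimes>\<^bsub>S\<^esub> f \<oplus>\<^bsub>S\<^esub> h \<otimes>\<^bsub>S\<^esub> f') x" .
  qed (use assms S_closed in auto)
qed

lemma S_induct [consumes 1, case_names mon add]:
  assumes f: "f \<in> carrier S"
    and mon: "\<And>g t. g \<in> carrier G \<Longrightarrow> t \<in> carrier T \<Longrightarrow> P (gmon g t)"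
    and add: "\<And>f f'. f \<in> carrier S \<Longrightarrow> f' \<in> carrier S \<Longrightarrow> P f \<Longrightarrow> P f' \<Longrightarrow> P (f \<oplus>\<^bsub>S\<^esub> f')"
  shows "P f"
proof -
  have "P f" if "f \<in> carrier S" "C \<subseteq> carrier G" "\<And>x. x \<in> carrier G - C \<Longrightarrow> f x = \<zero>\<^bsub>T\<^esub>" for C f
    using finite_subset[OF that(2) finite_G] that
  proof (induct C arbitrary: f rule: finite_induct)
    case empty
    then have "f = gmon \<one>\<^bsub>G\<^esub> \<zero>\<^bsub>T\<^esub>" by (intro S_eqI) (auto simp: mon_elt_apply)
    then show ?case using mon by simp
  next
    case (insert g C)
    let ?f = "f(g := \<zero>\<^bsub>T\<^esub>)"
    have g: "g \<in> carrier G" using insert by auto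
    have f': "?f \<in> carrier S"
      using insert.prems g by (auto simp: semidirect_algebra_simps PiE_iff extensional_def)
    have "P ?f" by (rule insert.hyps(3)[OF f']) (use insert.prems in auto)
    moreover have "f = gmon g (f g) \<oplus>\<^bsub>S\<^esub> ?f"
    proof (rule S_eqI[OF insert.prems(1)])
      show "gmon g (f g) \<oplus>\<^bsub>S\<^esub> ?f \<in> carrier S"
        by (intro S_closed(2) mon_closed f' carrier_apply[OF insert.prems(1) g])
    qed (use carrier_apply[OF insert.prems(1)] g in \<open>auto simp: semidirect_algebra_simps mon_elt_apply\<close>)
    ultimately show ?case
      using add[OF mon_closed f' mon, of "f g" g] carrier_apply[OF insert.prems(1) g] g by metis
  qed
  from this[OF f subset_refl] show ?thesis by simp
qed

lemma S_complex_algebra: "complex_algebra S"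
proof (rule complex_algebraI)
  fix f g h and c d :: complex
  assume f: "f \<in> carrier S"
  show "c \<odot>\<^bsub>S\<^esub> f \<in> carrier S" using f S_closed by auto
  show "\<one>\<^bsub>S\<^esub> \<otimes>\<^bsub>S\<^esub> f = f"
    using f by (induct f rule: S_induct)
      (simp_all add: S_distrib S_closed semidirect_algebra_simps(3) mon_mult act_one)
  show "f \<otimes>\<^bsub>S\<^esub> \<one>\<^bsub>S\<^esub> = f"
    using f by (induct f rule: S_induct)
      (simp_all add: S_distrib S_closed semidirect_algebra_simps(3) mon_mult)
  assume g: "g \<in> carrier S"
  show "f \<oplus>\<^bsub>S\<^esub> g \<in> carrier S" "f \<otimes>\<^bsub>S\<^esub> g \<in> carrier S" using f g S_closed by auto
  have smult_mon: "c \<odot>\<^bsub>S\<^esub> gmon x t = gmon x (c \<odot>\<^bsub>T\<^esub> t)" for x t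
    by (auto simp: semidirect_algebra_simps mon_elt_def)
  have smult_add: "c \<odot>\<^bsub>S\<^esub> (x \<oplus>\<^bsub>S\<^esub> y) = c \<odot>\<^bsub>S\<^esub> x \<oplus>\<^bsub>S\<^esub> c \<odot>\<^bsub>S\<^esub> y" if "x \<in> carrier S" "y \<in> carrier S" for x y
    using that carrier_apply by (auto simp: semidirect_algebra_simps(5,6) T.smult_r_distr)
  then show "c \<odot>\<^bsub>S\<^esub> (f \<oplus>\<^bsub>S\<^esub> g) = c \<odot>\<^bsub>S\<^esub> f \<oplus>\<^bsub>S\<^esub> c \<odot>\<^bsub>S\<^esub> g" using f g .
  show "(c \<odot>\<^bsub>S\<^esub> f) \<otimes>\<^bsub>S\<^esub> g = c \<odot>\<^bsub>S\<^esub> (f \<otimes>\<^bsub>S\<^esub> g)"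
    using f
  proof (induct f rule: S_induct)
    case (mon x t)
    show ?case using g
      by (induct g rule: S_induct)
        (simp_all add: S_distrib S_closed smult_add smult_mon mon_mult T.smult_mult_left mon)
  qed (simp add: S_distrib S_closed smult_add g)
  show "f \<otimes>\<^bsub>S\<^esub> (c \<odot>\<^bsub>S\<^esub> g) = c \<odot>\<^bsub>S\<^esub> (f \<otimes>\<^bsub>S\<^esub> g)"
    using f
  proof (induct f rule: S_induct)
    case (mon x t)
    show ?case using g
      by (induct g rule: S_induct)
        (simp_all add: S_distrib S_closed smult_add smult_mon mon_mult T.smult_mult_right mon)
  qed (simp add: S_distrib S_closed smult_add g)
  assume h: "h \<in> carrier S"
  show "(f \<oplus>\<^bsub>S\<^esub> g) \<otimes>\<^bsub>S\<^esub> h = f \<otimes>\<^bsub>S\<^esub> h \<oplus>\<^bsub>S\<^esub> g \<otimes>\<^bsub>S\<^esub> h"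
    "h \<otimes>\<^bsub>S\<^esub> (f \<oplus>\<^bsub>S\<^esub> g) = h \<otimes>\<^bsub>S\<^esub> f \<oplus>\<^bsub>S\<^esub> h \<otimes>\<^bsub>S\<^esub> g"
    using f g h by (simp_all add: S_distrib)
  show add_assoc: "(f \<oplus>\<^bsub>S\<^esub> g) \<oplus>\<^bsub>S\<^esub> h = f \<oplus>\<^bsub>S\<^esub> (g \<oplus>\<^bsub>S\<^esub> h)"
    using carrier_apply f g h by (auto simp: semidirect_algebra_simps(5) T.a_assoc)
  show "(f \<otimes>\<^bsub>S\<^esub> g) \<otimes>\<^bsub>S\<^esub> h = f \<otimes>\<^bsub>S\<^esub> (g \<otimes>\<^bsub>S\<^esub> h)"
    using f
  proof (induct f rule: S_induct)
    case (mon x t)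
    show ?case using g
    proof (induct g rule: S_induct)
      case (mon y s)
      show ?case using h
      proof (induct h rule: S_induct)
        case (mon z r)
        then show ?case using \<open>x \<in> _\<close> \<open>y \<in> _\<close> \<open>t \<in> _\<close> \<open>s \<in> _\<close>
          by (simp add: mon_mult G.m_assoc T.m_assoc act_mult)
      qed (use \<open>x \<in> _\<close> \<open>y \<in> _\<close> \<open>t \<in> _\<close> \<open>s \<in> _\<close> in \<open>simp add: S_distrib S_closed\<close>)
    qed (use \<open>x \<in> _\<close> \<open>t \<in> _\<close> h in \<open>simp add: S_distrib S_closed\<close>)
  qed (simp add: S_distrib S_closed g h)
qed (auto simp: semidirect_algebra_simps(1,4,5,6) mon_elt_def semidirect_algebra_simps(3) PiE_iff extensional_def
      restrict_def fun_eq_iff T.a_comm T.smult_l_distr T.smult_assoc)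

sublocale S: complex_algebra S by (rule S_complex_algebra)

lemma mon_add: "t \<in> carrier T \<Longrightarrow> s \<in> carrier T \<Longrightarrow> gmon g (t \<oplus>\<^bsub>T\<^esub> s) = gmon g t \<oplus>\<^bsub>S\<^esub> gmon g s"
  by (auto simp: semidirect_algebra_simps mon_elt_def)

lemma mon_smult: "gmon g (c \<odot>\<^bsub>T\<^esub> t) = c \<odot>\<^bsub>S\<^esub> gmon g t"
  by (auto simp: semidirect_algebra_simps mon_elt_def)

lemma group_elt_closed [simp, intro]: "group_elt G T g \<in> carrier S"
  by (simp add: group_elt_eq_mon)

lemma alg_elt_closed [simp, intro]: "t \<in> carrier T \<Longrightarrow> alg_elt G T t \<in> carrier S"
  by (simp add: alg_elt_eq_mon)

lemma mon_eq_mult: "g \<in> carrier G \<Longrightarrow> t \<in> carrier T \<Longrightarrow> gmon g t = alg_elt G T t \<otimes>\<^bsub>S\<^esub> group_elt G T g"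
  by (simp add: alg_elt_eq_mon group_elt_eq_mon mon_mult)

lemma alg_elt_hom: "alg_elt G T \<in> alg_hom T S"
  by (rule alg_homI)
    (auto simp: alg_elt_eq_mon mon_mult act_one mon_add mon_smult semidirect_algebra_simps(3))

lemma group_elt_mult:
  "g \<in> carrier G \<Longrightarrow> h \<in> carrier G \<Longrightarrow> group_elt G T (g \<otimes>\<^bsub>G\<^esub> h) = group_elt G T g \<otimes>\<^bsub>S\<^esub> group_elt G T h"
  by (simp add: group_elt_eq_mon mon_mult)

lemma group_elt_one: "group_elt G T \<one>\<^bsub>G\<^esub> = \<one>\<^bsub>S\<^esub>"
  by (simp add: group_elt_eq_mon semidirect_algebra_simps)

lemma group_elt_alg_elt: "g \<in> carrier G \<Longrightarrow> t \<in> carrier T \<Longrightarrow>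
  group_elt G T g \<otimes>\<^bsub>S\<^esub> alg_elt G T t = alg_elt G T (act g t) \<otimes>\<^bsub>S\<^esub> group_elt G T g"
  by (simp add: alg_elt_eq_mon group_elt_eq_mon mon_mult)

lemma mon_decomp:
  assumes "f \<in> carrier S" shows "f = (\<Oplus>\<^bsub>S\<^esub>g\<in>carrier G. gmon g (f g))"
proof -
  have fin: "(\<Oplus>\<^bsub>S\<^esub>g\<in>C. F g) x = (\<Oplus>\<^bsub>T\<^esub>g\<in>C. F g x)"
    if "F \<in> C \<rightarrow> carrier S" "x \<in> carrier G" for F and C :: "'g set" and x
    using that(1)
  proof (induct C rule: infinite_finite_induct)
    case (insert g C)
    then show ?case using that(2)
      by (simp add: Pi_iff carrier_apply) (simp add: semidirect_algebra_simps)
  qed (use that(2) in \<open>simp_all add: semidirect_algebra_simps\<close>)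
  note [simp] = carrier_apply[OF assms]
  show ?thesis
  proof (rule S_eqI[OF assms])
    fix x assume x: "x \<in> carrier G"
    have "(\<Oplus>\<^bsub>T\<^esub>g\<in>carrier G. gmon g (f g) x) = gmon x (f x) x"
      by (rule T.finsum_single[OF finite_G x]) (use x in \<open>auto simp: mon_elt_apply\<close>)
    then show "f x = (\<Oplus>\<^bsub>S\<^esub>g\<in>carrier G. gmon g (f g)) x"
      using x by (subst fin) (auto simp: mon_elt_apply)
  qed (auto intro!: S.finsum_closed)
qed

text \<open>
  The universal property of the semidirect product: a homomorphism \<open>\<phi>\<close> on \<open>T\<close> and a representation \<open>e\<close> of \<open>G\<close>
  combine to a homomorphism if \<open>e g \<otimes> \<phi> t = \<phi> (act g t) \<otimes> e g\<close>.
\<close>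

definition sd_ext :: "(complex, 'b) module \<Rightarrow> ('a \<Rightarrow> 'b) \<Rightarrow> ('g \<Rightarrow> 'b) \<Rightarrow> ('g \<Rightarrow> 'a) \<Rightarrow> 'b" where
  "sd_ext B \<phi> e f = (\<Oplus>\<^bsub>B\<^esub>g\<in>carrier G. \<phi> (f g) \<otimes>\<^bsub>B\<^esub> e g)"

context
  fixes B :: "(complex, 'b) module" and \<phi> :: "'a \<Rightarrow> 'b" and e :: "'g \<Rightarrow> 'b"
  assumes B: "complex_algebra B" and \<phi>: "\<phi> \<in> alg_hom T B"
    and e: "\<And>g. g \<in> carrier G \<Longrightarrow> e g \<in> carrier B"
    and e_one: "e \<one>\<^bsub>G\<^esub> = \<one>\<^bsub>B\<^esub>"
    and e_mult: "\<And>g h. g \<in> carrier G \<Longrightarrow> h \<in> carrier G \<Longrightarrow> e (g \<otimes>\<^bsub>G\<^esub> h) = e g \<otimes>\<^bsub>B\<^esub> e h"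
    and cross: "\<And>g t. g \<in> carrier G \<Longrightarrow> t \<in> carrier T \<Longrightarrow> e g \<otimes>\<^bsub>B\<^esub> \<phi> t = \<phi> (act g t) \<otimes>\<^bsub>B\<^esub> e g"
begin

interpretation B: complex_algebra B by (rule B)

lemma sd_ext_mon: 
  assumes "g \<in> carrier G" "t \<in> carrier T"
  shows "sd_ext B \<phi> e (gmon g t) = \<phi> t \<otimes>\<^bsub>B\<^esub> e g"
proof -
  have "sd_ext B \<phi> e (gmon g t) = \<phi> (gmon g t g) \<otimes>\<^bsub>B\<^esub> e g"
    unfolding sd_ext_def
    by (rule B.finsum_single[OF finite_G assms(1)])
      (use assms e alg_hom_closed[OF \<phi>] alg_hom_zero[OF T.complex_algebra_axioms B \<phi>] in \<open>auto simp: mon_elt_apply\<close>)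
  then show ?thesis using assms by (simp add: mon_elt_apply)
qed

lemma sd_ext_closed: "f \<in> carrier S \<Longrightarrow> sd_ext B \<phi> e f \<in> carrier B"
  unfolding sd_ext_def using alg_hom_closed[OF \<phi>] carrier_apply e by (auto intro!: B.finsum_closed)

lemma sd_ext_add: 
  assumes "f \<in> carrier S" "f' \<in> carrier S"
  shows "sd_ext B \<phi> e (f \<oplus>\<^bsub>S\<^esub> f') = sd_ext B \<phi> e f \<oplus>\<^bsub>B\<^esub> sd_ext B \<phi> e f'"
proof -
  note [simp] = alg_hom_closed[OF \<phi>] carrier_apply[OF assms(1)] carrier_apply[OF assms(2)] e
  have "sd_ext B \<phi> e (f \<oplus>\<^bsub>S\<^esub> f') = (\<Oplus>\<^bsub>B\<^esub>g\<in>carrier G. \<phi> (f g) \<otimes>\<^bsub>B\<^esub> e g \<oplus>\<^bsub>B\<^esub> \<phi> (f' g) \<otimes>\<^bsub>B\<^esub> e g)"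
    unfolding sd_ext_def
    by (rule B.add.finprod_cong') (auto simp: semidirect_algebra_simps alg_hom_add[OF \<phi>] B.l_distr)
  also have "\<dots> = sd_ext B \<phi> e f \<oplus>\<^bsub>B\<^esub> sd_ext B \<phi> e f'"
    unfolding sd_ext_def by (rule B.finsum_addf) auto
  finally show ?thesis .
qed

lemma sd_ext_hom: "sd_ext B \<phi> e \<in> alg_hom S B"
proof (rule alg_homI)
  note [simp] = alg_hom_closed[OF \<phi>] e sd_ext_mon sd_ext_add S_closed S_distrib sd_ext_closed
  show "sd_ext B \<phi> e \<one>\<^bsub>S\<^esub> = \<one>\<^bsub>B\<^esub>"
    by (simp add: semidirect_algebra_simps(3) alg_hom_one[OF \<phi>] e_one)
  show "sd_ext B \<phi> e (c \<odot>\<^bsub>S\<^esub> f) = c \<odot>\<^bsub>B\<^esub> sd_ext B \<phi> e f" if "f \<in> carrier S" for c f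
    using that
    by (induct f rule: S_induct)
      (auto simp: mon_smult[symmetric] alg_hom_smult[OF \<phi>] S.smult_r_distr B.smult_r_distr B.smult_mult_left)
  show "sd_ext B \<phi> e (f \<otimes>\<^bsub>S\<^esub> f') = sd_ext B \<phi> e f \<otimes>\<^bsub>B\<^esub> sd_ext B \<phi> e f'"
    if f: "f \<in> carrier S" and f': "f' \<in> carrier S" for f f'
    using f
  proof (induct f rule: S_induct)
    case (mon g t)
    show ?case using f'
    proof (induct f' rule: S_induct)
      case (mon h s)
      note [simp] = \<open>g \<in> _\<close> \<open>t \<in> _\<close> \<open>h \<in> _\<close> \<open>s \<in> _\<close>
      have "\<phi> t \<otimes>\<^bsub>B\<^esub> e g \<otimes>\<^bsub>B\<^esub> (\<phi> s \<otimes>\<^bsub>B\<^esub> e h) = \<phi> t \<otimes>\<^bsub>B\<^esub> (e g \<otimes>\<^bsub>B\<^esub> \<phi> s) \<otimes>\<^bsub>B\<^esub> e h"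
        by (simp add: B.m_assoc)
      then show ?case
        by (simp add: mon_mult alg_hom_mult[OF \<phi>] cross B.m_assoc e_mult)
    next
      case (add f f')
      then show ?case using mon by (simp add: B.r_distr)
    qed
  next
    case (add f f'')
    then show ?case using f' by (simp add: B.l_distr)
  qed
qed (simp_all add: sd_ext_add sd_ext_closed)

end

lemma S_hom_unique:
  assumes \<phi>: "\<phi> \<in> alg_hom S B" and \<psi>: "\<psi> \<in> alg_hom S B"
    and "\<And>t. t \<in> carrier T \<Longrightarrow> \<phi> (alg_elt G T t) = \<psi> (alg_elt G T t)"
    and "\<And>g. g \<in> carrier G \<Longrightarrow> \<phi> (group_elt G T g) = \<psi> (group_elt G T g)"
    and f: "f \<in> carrier S"
  shows "\<phi> f = \<psi> f"
  using f
  by (induct f rule: S_induct)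
    (simp_all add: mon_eq_mult alg_hom_mult[OF \<phi>] alg_hom_mult[OF \<psi>] alg_hom_add[OF \<phi>] alg_hom_add[OF \<psi>] assms(3,4))

end

section \<open>The group \<open>G(m,1,n)\<close>\<close>

locale gm1 =
  fixes m n :: nat
  assumes m_pos: "m \<ge> 1"
begin

abbreviation "G \<equiv> Gm1 m n"

lemma Gm1_carrier: "x \<in> carrier G \<longleftrightarrow> fst x permutes {..<n} \<and> snd x \<in> {..<n} \<rightarrow>\<^sub>E {0..<int m}"
  using m_pos by (cases x) (auto simp: Gm1_def torus_def carrier_integer_mod_group)

lemma Gm1_mult: "x \<otimes>\<^bsub>G\<^esub> y = (fst x \<circ> fst y, \<lambda>i\<in>{..<n}. (snd x (fst y i) + snd y i) mod int m)"
  by (auto simp: Gm1_def torus_def product_group_def split: prod.splits)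

lemma Gm1_one: "\<one>\<^bsub>G\<^esub> = (id, \<lambda>i\<in>{..<n}. 0)"
  by (simp add: Gm1_def torus_def product_group_def)

lemma Gm1_carrierI:
  "w permutes {..<n} \<Longrightarrow> (\<And>i. i < n \<Longrightarrow> 0 \<le> a i \<and> a i < int m) \<Longrightarrow> (w, \<lambda>i\<in>{..<n}. a i) \<in> carrier G"
  by (auto simp: Gm1_carrier)

lemma Gm1_eqI:
  assumes "x \<in> carrier G" "y \<in> carrier G" "fst x = fst y" "\<And>i. i < n \<Longrightarrow> snd x i = snd y i"
  shows "x = y"
proof (rule prod_eqI)
  show "snd x = snd y"
    by (rule PiE_ext[of _ "{..<n}" "\<lambda>_. {0..<int m}"]) (use assms in \<open>auto simp: Gm1_carrier\<close>)
qed (use assms in simp)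

lemma permutes_less: "w permutes {..<n} \<Longrightarrow> w i < n \<longleftrightarrow> i < n"
  using permutes_in_image[of w "{..<n}" i] by simp

lemma Gm1_snd: "x \<in> carrier G \<Longrightarrow> i < n \<Longrightarrow> 0 \<le> snd x i \<and> snd x i < int m"
  using PiE_mem[of "snd x" "{..<n}" "\<lambda>_. {0..<int m}" i] by (simp add: Gm1_carrier)

lemma Gm1_mult_closed: "x \<in> carrier G \<Longrightarrow> y \<in> carrier G \<Longrightarrow> x \<otimes>\<^bsub>G\<^esub> y \<in> carrier G"
  unfolding Gm1_mult by (rule Gm1_carrierI) (use m_pos in \<open>simp_all add: Gm1_carrier permutes_compose\<close>)

lemma Gm1_group: "group G"
proof (rule groupI)
  show "\<one>\<^bsub>G\<^esub> \<in> carrier G" using m_pos by (auto simp: Gm1_carrier Gm1_one permutes_id)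
  fix x assume x: "x \<in> carrier G"
  show "\<one>\<^bsub>G\<^esub> \<otimes>\<^bsub>G\<^esub> x = x"
  proof (rule Gm1_eqI)
    show "snd (\<one>\<^bsub>G\<^esub> \<otimes>\<^bsub>G\<^esub> x) i = snd x i" if "i < n" for i
      using that Gm1_snd[OF x that] x by (simp add: Gm1_mult Gm1_one Gm1_carrier permutes_less)
  qed (simp_all add: x Gm1_mult_closed[OF \<open>\<one>\<^bsub>G\<^esub> \<in> carrier G\<close> x], simp add: Gm1_mult Gm1_one)
  define y where "y = (inv_into UNIV (fst x), \<lambda>i\<in>{..<n}. (- snd x (inv_into UNIV (fst x) i)) mod int m)"
  have w: "fst x permutes {..<n}" using x by (simp add: Gm1_carrier)
  have "y \<in> carrier G" unfolding y_def
    using m_pos by (intro Gm1_carrierI permutes_inv w) auto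
  moreover have "y \<otimes>\<^bsub>G\<^esub> x = \<one>\<^bsub>G\<^esub>"
    using permutes_inv_o[OF w] permutes_less[OF w] permutes_inverses[OF w]
    by (auto simp: y_def Gm1_mult Gm1_one fun_eq_iff mod_add_left_eq)
  ultimately show "\<exists>y\<in>carrier G. y \<otimes>\<^bsub>G\<^esub> x = \<one>\<^bsub>G\<^esub>" by blast
  fix y z assume y: "y \<in> carrier G" and z: "z \<in> carrier G"
  show "x \<otimes>\<^bsub>G\<^esub> y \<in> carrier G" using x y by (rule Gm1_mult_closed)
  show "x \<otimes>\<^bsub>G\<^esub> y \<otimes>\<^bsub>G\<^esub> z = x \<otimes>\<^bsub>G\<^esub> (y \<otimes>\<^bsub>G\<^esub> z)"
    using z by (auto simp: Gm1_mult fun_eq_iff mod_simps algebra_simps permutes_less Gm1_carrier)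
qed

sublocale G: group G by (rule Gm1_group)

lemma Gm1_finite: "finite (carrier G)"
proof (rule finite_subset)
  show "carrier G \<subseteq> {w. w permutes {..<n}} \<times> ({..<n} \<rightarrow>\<^sub>E {0..<int m})"
    by (simp add: subset_iff mem_Times_iff Gm1_carrier)
qed (auto intro: finite_PiE finite_permutations)

lemma Gm1_fst_permutes: "x \<in> carrier G \<Longrightarrow> fst x permutes {..<n}"
  by (simp add: Gm1_carrier)

lemma Gm1_fst_less: "x \<in> carrier G \<Longrightarrow> fst x i < n \<longleftrightarrow> i < n"
  using permutes_less Gm1_fst_permutes by blast

lemma Gm1_fst_mult: "fst (x \<otimes>\<^bsub>G\<^esub> y) = fst x \<circ> fst y"
  by (simp add: Gm1_mult)

lemma Gm1_fst_one: "fst \<one>\<^bsub>G\<^esub> = id"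
  by (simp add: Gm1_one)

lemma Gm1_fst_inj: "x \<in> carrier G \<Longrightarrow> fst x i = fst x j \<longleftrightarrow> i = j"
  by (rule inj_eq) (rule permutes_inj[OF Gm1_fst_permutes])

lemma Gm1_fst_inv: "x \<in> carrier G \<Longrightarrow> fst (inv\<^bsub>G\<^esub> x) = inv_into UNIV (fst x)"
proof -
  assume x: "x \<in> carrier G"
  have "fst x \<circ> fst (inv\<^bsub>G\<^esub> x) = id"
    using G.r_inv[OF x] Gm1_fst_mult[of x "inv\<^bsub>G\<^esub> x"] Gm1_fst_one by simp
  then show ?thesis
    using permutes_inv_o(2)[OF Gm1_fst_permutes[OF x]] by (metis comp_assoc comp_id id_comp)
qed

abbreviation "swap i j \<equiv> Transposition.transpose i j"

lemma swap_permutes: "i < n \<Longrightarrow> j < n \<Longrightarrow> swap i j permutes {..<n}"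
  by (rule permutes_swap_id) auto

lemma perm_elt_eq: "perm_elt m n w = (w, \<lambda>i\<in>{..<n}. 0)"
  by (simp add: perm_elt_def torus_def product_group_def)

lemma perm_elt_closed: "w permutes {..<n} \<Longrightarrow> perm_elt m n w \<in> carrier G"
  using m_pos by (auto simp: perm_elt_eq Gm1_carrier)

lemma torus_gen_closed: "torus_gen m n i \<in> carrier G"
  using m_pos by (auto simp: torus_gen_def Gm1_carrier permutes_id)

lemma torus_gen_nat_pow:
  "torus_gen m n i [^]\<^bsub>G\<^esub> (k::nat) = (id, \<lambda>j\<in>{..<n}. if j = i then int k mod int m else 0)"
proof (induct k)
  case 0 show ?case by (simp add: Gm1_one fun_eq_iff)
next
  case (Suc k)
  show ?case
    by (simp add: Suc Gm1_mult) (auto simp: torus_gen_def fun_eq_iff mod_simps algebra_simps)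
qed

lemma torus_gen_int_pow:
  "torus_gen m n i [^]\<^bsub>G\<^esub> (k::int) = (id, \<lambda>j\<in>{..<n}. if j = i then k mod int m else 0)"
proof (cases "k \<ge> 0")
  case True
  then show ?thesis
    using int_pow_int[of G "torus_gen m n i" "nat k"] torus_gen_nat_pow[of i "nat k"]
    by (simp cong: if_cong)
next
  case False
  define l where "l = nat (- k)"
  have k: "k = - int l" using False by (simp add: l_def)
  have "inv\<^bsub>G\<^esub> (torus_gen m n i [^]\<^bsub>G\<^esub> l) = (id, \<lambda>j\<in>{..<n}. if j = i then k mod int m else 0)"
  proof (rule G.inv_equality)
    show "torus_gen m n i [^]\<^bsub>G\<^esub> l \<in> carrier G" using torus_gen_closed by simp
    show "(id, \<lambda>j\<in>{..<n}. if j = i then k mod int m else 0) \<in> carrier G"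
      using m_pos by (intro Gm1_carrierI) (auto simp: permutes_id)
    show "(id, \<lambda>j\<in>{..<n}. if j = i then k mod int m else 0) \<otimes>\<^bsub>G\<^esub> torus_gen m n i [^]\<^bsub>G\<^esub> l = \<one>\<^bsub>G\<^esub>"
      by (auto simp: torus_gen_nat_pow Gm1_mult Gm1_one fun_eq_iff k mod_simps)
  qed
  then show ?thesis using G.int_pow_neg_int[of "torus_gen m n i" l] torus_gen_closed k by simp
qed

lemma torus_diff_eq:
  "i \<noteq> j \<Longrightarrow> torus_diff m n i j l =
    (id, \<lambda>p\<in>{..<n}. if p = i then int l mod int m else if p = j then (- int l) mod int m else 0)"
  by (auto simp: torus_diff_def torus_gen_int_pow Gm1_mult fun_eq_iff)

lemma fst_torus_gen [simp]: "fst (torus_gen m n r) = id"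
  by (simp add: torus_gen_def)

lemma fst_refl_elt [simp]: "fst (refl_elt m n i j) = swap i j"
  by (simp add: perm_elt_eq)

text \<open>
  The summands \<open>s\<^sub>i\<^sub>j g\<^sub>i\<^sup>l g\<^sub>j\<^sup>-\<^sup>l\<close> of \<open>\<tau>\<^sub>i\<^sub>j\<close>.
\<close>

definition tau_elt :: "nat \<Rightarrow> nat \<Rightarrow> nat \<Rightarrow> gm1" where
  "tau_elt i j l = refl_elt m n i j \<otimes>\<^bsub>G\<^esub> torus_diff m n i j l"

lemma tau_elt_eq:
  "i \<noteq> j \<Longrightarrow> tau_elt i j l =
    (swap i j, \<lambda>p\<in>{..<n}. if p = i then int l mod int m else if p = j then (- int l) mod int m else 0)"
  by (auto simp: tau_elt_def torus_diff_eq perm_elt_eq Gm1_mult fun_eq_iff)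

lemma torus_diff_closed: "i \<noteq> j \<Longrightarrow> torus_diff m n i j l \<in> carrier G"
  using m_pos by (auto simp: torus_diff_eq permutes_id intro!: Gm1_carrierI)

lemma refl_elt_closed: "i < n \<Longrightarrow> j < n \<Longrightarrow> refl_elt m n i j \<in> carrier G"
  by (intro perm_elt_closed swap_permutes)

lemma tau_elt_closed: "i < n \<Longrightarrow> j < n \<Longrightarrow> i \<noteq> j \<Longrightarrow> tau_elt i j l \<in> carrier G"
  by (simp add: tau_elt_def torus_diff_closed refl_elt_closed)

lemma fst_tau_elt: "fst (tau_elt i j l) = swap i j"
  by (simp add: tau_elt_def Gm1_mult perm_elt_eq torus_diff_def torus_gen_int_pow)

text \<open>
  Conjugation by the permutation part renames the indices.  Conjugation by the torus part \<open>a\<close> multiplies by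
  \<open>g\<^sub>i\<close> and \<open>g\<^sub>j\<close> to the powers \<open>\<plusminus>(a\<^sub>j - a\<^sub>i)\<close>, because \<open>s\<^sub>i\<^sub>j\<close> exchanges the two coordinates of \<open>a\<close>; this is again a
  summand of \<open>\<tau>\<^sub>i\<^sub>j\<close>.
\<close>

lemma tau_elt_conj:
  assumes x: "x \<in> carrier G" and ij: "i < n" "j < n" "i \<noteq> j"
  shows "x \<otimes>\<^bsub>G\<^esub> tau_elt i j l =
    tau_elt (fst x i) (fst x j) (nat ((int l + snd x j - snd x i) mod int m)) \<otimes>\<^bsub>G\<^esub> x"
proof -
  have ne: "fst x i \<noteq> fst x j" using ij Gm1_fst_inj[OF x] by simp
  have less: "fst x i < n" "fst x j < n" using ij Gm1_fst_less[OF x] by auto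
  have [simp]: "int (nat (k mod int m)) = k mod int m" "0 \<le> k mod int m" for k using m_pos by simp_all
  show ?thesis
  proof (rule Gm1_eqI)
    show "fst (x \<otimes>\<^bsub>G\<^esub> tau_elt i j l) =
       fst (tau_elt (fst x i) (fst x j) (nat ((int l + snd x j - snd x i) mod int m)) \<otimes>\<^bsub>G\<^esub> x)"
      using Gm1_fst_inj[OF x]
      by (auto simp: Gm1_fst_mult fst_tau_elt fun_eq_iff Transposition.transpose_def)
    show "snd (x \<otimes>\<^bsub>G\<^esub> tau_elt i j l) p =
       snd (tau_elt (fst x i) (fst x j) (nat ((int l + snd x j - snd x i) mod int m)) \<otimes>\<^bsub>G\<^esub> x) p" if p: "p < n" for p
    proof -
      have "(- ((int l + snd x j - snd x i) mod int m) mod int m + snd x j) mod int m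
          = (snd x i - int l) mod int m"
        by (simp add: mod_simps)
      then show ?thesis
        using p ij less ne Gm1_fst_inj[OF x] Gm1_fst_less[OF x]
        by (auto simp: tau_elt_eq Gm1_mult Transposition.transpose_def mod_simps algebra_simps)
    qed
  qed (use x ij less ne in \<open>auto intro!: tau_elt_closed\<close>)
qed

lemma shift_bij: "bij_betw (\<lambda>l. nat ((int l + c) mod int m)) {..<m} {..<m}"
proof -
  have "inj_on (\<lambda>l. nat ((int l + c) mod int m)) {..<m}"
  proof (rule inj_onI)
    fix x y assume xy: "x \<in> {..<m}" "y \<in> {..<m}" "nat ((int x + c) mod int m) = nat ((int y + c) mod int m)"
    then have "(int x + c) mod int m = (int y + c) mod int m" using m_pos
      by (simp add: nat_eq_iff2)
    then have "(int x + c - c) mod int m = (int y + c - c) mod int m" by (rule mod_diff_cong) simp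
    then have "int x mod int m = int y mod int m" by simp
    then show "x = y" using xy by simp
  qed
  moreover have "(\<lambda>l. nat ((int l + c) mod int m)) ` {..<m} \<subseteq> {..<m}"
    using m_pos by (auto simp: nat_less_iff)
  ultimately show ?thesis by (simp add: bij_betw_def endo_inj_surj)
qed

lemma neg_bij: "bij_betw (\<lambda>l. (m - l) mod m) {..<m} {..<m}"
proof -
  have "inj_on (\<lambda>l. (m - l) mod m) {..<m}"
  proof (rule inj_onI)
    fix x y assume xy: "x \<in> {..<m}" "y \<in> {..<m}" "(m - x) mod m = (m - y) mod m"
    then show "x = y" by (cases "x = 0"; cases "y = 0") auto
  qed
  moreover have "(\<lambda>l. (m - l) mod m) ` {..<m} \<subseteq> {..<m}" using m_pos by auto
  ultimately show ?thesis by (simp add: bij_betw_def endo_inj_surj)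
qed

lemma tau_elt_flip:
  assumes "i \<noteq> j" "l < m" shows "tau_elt j i l = tau_elt i j ((m - l) mod m)"
proof -
  have "(- ((int m - int l) mod int m)) mod int m = int l mod int m" by (simp add: mod_simps)
  moreover have "(int m - int l) mod int m = (- int l) mod int m" by (simp add: mod_simps)
  ultimately show ?thesis
    using assms by (auto simp: tau_elt_eq fun_eq_iff zmod_int of_nat_diff transpose_commute)
qed

lemma cycle_elt_eq:
  "\<lbrakk>i < n; j < n; k < n; i \<noteq> j; j \<noteq> k\<rbrakk> \<Longrightarrow> cycle_elt m n i j k l l' = tau_elt i j l \<otimes>\<^bsub>G\<^esub> tau_elt j k l'"
  by (simp add: cycle_elt_def tau_elt_def G.m_assoc torus_diff_closed refl_elt_closed)

lemma cycle_elt_closed: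
  "\<lbrakk>i < n; j < n; k < n; i \<noteq> j; j \<noteq> k\<rbrakk> \<Longrightarrow> cycle_elt m n i j k l l' \<in> carrier G"
  by (simp add: cycle_elt_eq tau_elt_closed)

lemma cycle_elt_inj:
  assumes "i < n" "j < n" "k < n" "i \<noteq> j" "j \<noteq> k" "i \<noteq> k"
  shows "inj_on (\<lambda>(l, l'). cycle_elt m n i j k l l') ({..<m} \<times> {..<m})"
proof -
  have "snd (cycle_elt m n i j k l l') i = int l" "snd (cycle_elt m n i j k l l') j = int l'"
    if "l < m" "l' < m" for l l'
    using assms that by (auto simp: cycle_elt_eq tau_elt_eq Gm1_mult Transposition.transpose_def)
  then show ?thesis by (auto simp: inj_on_def) (metis of_nat_eq_iff)+
qed

text \<open>
  A transposition of \<open>i\<close> and \<open>i + k + 1\<close> is a conjugate of a shorter one by an adjacent transposition; transpositions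
  generate the permutations; a torus element is built up one coordinate at a time.
\<close>

lemma Gm1_generate:
  assumes one: "P \<one>\<^bsub>G\<^esub>"
    and mult: "\<And>x y. x \<in> carrier G \<Longrightarrow> y \<in> carrier G \<Longrightarrow> P x \<Longrightarrow> P y \<Longrightarrow> P (x \<otimes>\<^bsub>G\<^esub> y)"
    and tor: "\<And>i. i < n \<Longrightarrow> P (torus_gen m n i)"
    and refl: "\<And>i. i + 1 < n \<Longrightarrow> P (refl_elt m n i (i + 1))"
    and x: "x \<in> carrier G"
  shows "P x"
proof -
  have perm_mult: "perm_elt m n (v \<circ> w) = perm_elt m n v \<otimes>\<^bsub>G\<^esub> perm_elt m n w"
    if "w permutes {..<n}" for v w
    using that by (auto simp: perm_elt_eq Gm1_mult fun_eq_iff permutes_less)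
  have refl': "P (refl_elt m n i (i + k + 1))" if "i + k + 1 < n" for i k
    using that
  proof (induct k)
    case 0 then show ?case using refl by simp
  next
    case (Suc k)
    let ?a = "swap (i + k + 1) (i + k + 1 + 1)" and ?b = "swap i (i + k + 1)"
    have "swap i (i + Suc k + 1) = ?a \<circ> (?b \<circ> ?a)"
      by (auto simp: fun_eq_iff Transposition.transpose_def)
    moreover have a: "?a permutes {..<n}" and b: "?b permutes {..<n}" using Suc by (auto intro!: swap_permutes)
    moreover have "P (perm_elt m n ?a)" "P (perm_elt m n ?b)" using Suc refl[of "i + k + 1"] by auto
    ultimately show ?case
      by (simp only: perm_mult[OF a] perm_mult[OF permutes_compose[OF a b]])
        (intro mult perm_elt_closed G.m_closed)
  qed
  have swap: "P (refl_elt m n i j)" if "i < n" "j < n" "i \<noteq> j" for i j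
    using that refl'[of i "j - i - 1"] refl'[of j "i - j - 1"]
    by (cases "i < j") (auto simp: transpose_commute)
  have perm: "P (perm_elt m n w)" if "w permutes {..<n}" for w
    using finite_lessThan[of n] that
  proof (induct rule: permutes_rev_induct)
    case id
    show ?case using one unfolding perm_elt_eq Gm1_one .
  next
    case (swap a b p)
    then have ab: "swap a b permutes {..<n}" by (auto intro: swap_permutes)
    show ?case
      unfolding perm_mult[OF ab]
      using swap \<open>\<And>i j. i < n \<Longrightarrow> j < n \<Longrightarrow> i \<noteq> j \<Longrightarrow> P (refl_elt m n i j)\<close>[of a b]
      by (intro mult perm_elt_closed ab) auto
  qed
  have pow: "P (torus_gen m n i [^]\<^bsub>G\<^esub> (k::nat))" if "i < n" for i k
    using that torus_gen_closed by (induct k) (auto intro!: one mult tor)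
  have tor': "P (id, a)" if "(id, a) \<in> carrier G" "\<And>i. i < n \<Longrightarrow> j \<le> i \<Longrightarrow> a i = 0" "j \<le> n" for a j
    using that
  proof (induct j arbitrary: a)
    case 0
    then have "(id, a) = \<one>\<^bsub>G\<^esub>" by (intro Gm1_eqI[OF 0(1) G.one_closed]) (use 0(2) in \<open>auto simp: Gm1_one fun_eq_iff\<close>)
    then show ?case using one by (simp only:)
  next
    case (Suc j)
    let ?a = "a(j := 0)" and ?g = "torus_gen m n j [^]\<^bsub>G\<^esub> nat (a j)"
    have aj: "0 \<le> a j" "a j < int m" using Gm1_snd[OF Suc.prems(1), of j] Suc.prems by auto
    have a: "(id, ?a) \<in> carrier G" using Suc.prems(1,3) m_pos by (auto simp: Gm1_carrier PiE_iff extensional_def)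
    have g: "?g \<in> carrier G" using torus_gen_closed by simp
    have "(id, a) = (id, ?a) \<otimes>\<^bsub>G\<^esub> ?g"
    proof (rule Gm1_eqI[OF Suc.prems(1) G.m_closed[OF a g]])
      show "snd (id, a) i = snd ((id, ?a) \<otimes>\<^bsub>G\<^esub> ?g) i" if "i < n" for i
        using that aj Gm1_snd[OF Suc.prems(1) that] by (auto simp: torus_gen_nat_pow Gm1_mult)
    qed (simp add: torus_gen_nat_pow Gm1_mult fun_eq_iff)
    moreover have "P (id, ?a)" by (rule Suc.hyps[OF a]) (use Suc.prems in auto)
    moreover have "P ?g" using pow Suc.prems(3) by simp
    ultimately show ?case using mult[OF a g] by (simp only:)
  qed
  have x1: "(id, snd x) \<in> carrier G" using x by (simp add: Gm1_carrier permutes_id)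
  have x2: "perm_elt m n (fst x) \<in> carrier G" using x perm_elt_closed Gm1_carrier by simp
  have "x = perm_elt m n (fst x) \<otimes>\<^bsub>G\<^esub> (id, snd x)"
    by (rule Gm1_eqI[OF x G.m_closed[OF x2 x1]])
      (use Gm1_snd[OF x] in \<open>auto simp: perm_elt_eq Gm1_mult\<close>)
  then show ?thesis
    using mult[OF x2 x1 perm tor'[OF x1, of n]] x by (auto simp: Gm1_carrier)
qed

lemma perm_rep_mult: 
  assumes "x \<in> carrier G" "y \<in> carrier G"
  shows "perm_rep n (x \<otimes>\<^bsub>G\<^esub> y) = perm_rep n x * perm_rep n y"
proof (rule eq_matI)
  fix i j assume ij: "i < dim_row (perm_rep n x * perm_rep n y)" "j < dim_col (perm_rep n x * perm_rep n y)"
  then have ij: "i < n" "j < n" by (auto simp: perm_rep_def)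
  then have yj: "fst y j < n" using Gm1_fst_less[OF assms(2)] by simp
  have "(perm_rep n x * perm_rep n y) $$ (i, j) = (\<Sum>k = 0..<n. (if i = fst x k then 1 else 0) * (if k = fst y j then 1 else 0))"
    using ij by (simp add: perm_rep_def scalar_prod_def)
  also have "\<dots> = (\<Sum>k = 0..<n. if k = fst y j then (if i = fst x k then 1 else 0) else 0)"
    by (rule sum.cong) auto
  also have "\<dots> = (if i = fst x (fst y j) then 1 else 0)" using yj by simp
  finally show "perm_rep n (x \<otimes>\<^bsub>G\<^esub> y) $$ (i, j) = (perm_rep n x * perm_rep n y) $$ (i, j)"
    using ij by (simp add: perm_rep_def Gm1_fst_mult)
qed (auto simp: perm_rep_def)

lemma perm_rep_representation: "representation G n (perm_rep n)"
  unfolding representation_def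
  by (auto simp: perm_rep_mult) (auto simp: perm_rep_def Gm1_fst_one)

end

section \<open>The elements \<open>\<tau>\<^sub>i\<^sub>j\<close> and \<open>X\<^sub>p\<close>\<close>

text \<open>
  The sign of \<open>\<tau>\<^sub>p\<^sub>j\<close> in \<open>X\<^sub>p\<close>.
\<close>

definition sgn_ij :: "nat \<Rightarrow> nat \<Rightarrow> complex" where
  "sgn_ij p j = (if p < j then 1 else - 1)"

definition cycle_triples :: "nat \<Rightarrow> (nat \<times> nat \<times> nat) set" where
  "cycle_triples n = {(i, j, k). i < n \<and> j < n \<and> k < n \<and> (i < j \<and> j < k \<or> k < j \<and> j < i)}"

lemma finite_cycle_triples [simp]: "finite (cycle_triples n)"
proof (rule finite_subset)
  show "cycle_triples n \<subseteq> {..<n} \<times> {..<n} \<times> {..<n}" by (auto simp: cycle_triples_def)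
qed simp

lemma cycle_form_eq:
  assumes "u \<in> carrier_vec n" "v \<in> carrier_vec n" "i < n" "j < n" "k < n"
  shows "cycle_form n \<kappa> i j k u v = \<kappa>\<^sup>2 * ((u $ i - u $ j) * (v $ j - v $ k) - (v $ i - v $ j) * (u $ j - u $ k))"
proof -
  have "(unit_vec n a - unit_vec n b) \<bullet> w = w $ a - w $ b"
    if "w \<in> carrier_vec n" "a < n" "b < n" for w :: "complex vec" and a b
    using that by (simp add: minus_scalar_prod_distrib[of _ n])
  then show ?thesis using assms by (simp add: cycle_form_def Let_def)
qed

definition (in gm1) cycle_elts :: "nat \<times> nat \<times> nat \<Rightarrow> gm1 set" where
  "cycle_elts = (\<lambda>(i, j, k). (\<lambda>(l, l'). cycle_elt m n i j k l l') ` ({..<m} \<times> {..<m}))"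

lemma (in gm1) do_form_eq:
  "do_form m n \<kappa> g u v =
    (\<Sum>t\<in>cycle_triples n. if g \<in> cycle_elts t then (\<lambda>(i, j, k). cycle_form n \<kappa> i j k u v) t else 0)"
proof -
  let ?D = "{(i, j, k). i < n \<and> j < n \<and> k < n \<and> (i < j \<and> j < k \<or> k < j \<and> j < i) \<and>
      (\<exists>l<m. \<exists>l'<m. g = cycle_elt m n i j k l l')}"
  have "?D = {t \<in> cycle_triples n. g \<in> cycle_elts t}"
    by (auto simp: cycle_triples_def cycle_elts_def)
  then show ?thesis
    unfolding do_form_def by (simp add: sum.inter_filter)
qed

lemma cycle_form_expand:
  assumes "u \<in> carrier_vec n" "v \<in> carrier_vec n" "i < n" "j < n" "k < n"
  shows "cycle_form n \<kappa> i j k u v =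
    (\<Sum>a<n. \<Sum>b<n. (u $ a * v $ b) * cycle_form n \<kappa> i j k (unit_vec n a) (unit_vec n b))"
proof -
  have coord: "w $ i - w $ j = (\<Sum>a<n. w $ a * (unit_vec n a $ i - unit_vec n a $ j))"
    if "w \<in> carrier_vec n" "i < n" "j < n" for w :: "complex vec" and i j
    using that by (simp add: unit_vec_def algebra_simps sum_subtractf if_distrib[of "\<lambda>x. _ * x"] cong: if_cong)
  have "cycle_form n \<kappa> i j k u v = \<kappa>\<^sup>2 *
     ((\<Sum>a<n. u $ a * (unit_vec n a $ i - unit_vec n a $ j)) * (\<Sum>b<n. v $ b * (unit_vec n b $ j - unit_vec n b $ k))
      - (\<Sum>a<n. u $ a * (unit_vec n a $ j - unit_vec n a $ k)) * (\<Sum>b<n. v $ b * (unit_vec n b $ i - unit_vec n b $ j)))"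
    unfolding cycle_form_eq[OF assms] coord[OF assms(1,3,4)] coord[OF assms(1,4,5)]
      coord[OF assms(2,3,4)] coord[OF assms(2,4,5)] by (simp add: mult.commute)
  also have "\<dots> = (\<Sum>a<n. \<Sum>b<n. (u $ a * v $ b) * cycle_form n \<kappa> i j k (unit_vec n a) (unit_vec n b))"
    unfolding sum_product unfolding sum_subtractf[symmetric] sum_distrib_left
    using assms by (intro sum.cong refl) (simp add: cycle_form_eq algebra_simps del: index_unit_vec)
  finally show ?thesis .
qed

lemma (in gm1) do_form_expand:
  assumes "u \<in> carrier_vec n" "v \<in> carrier_vec n"
  shows "do_form m n \<kappa> g u v =
    (\<Sum>a<n. \<Sum>b<n. (u $ a * v $ b) * do_form m n \<kappa> g (unit_vec n a) (unit_vec n b))"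
proof -
  have "do_form m n \<kappa> g u v = (\<Sum>t\<in>cycle_triples n. \<Sum>a<n. \<Sum>b<n. (u $ a * v $ b) *
     (if g \<in> cycle_elts t then (\<lambda>(i, j, k). cycle_form n \<kappa> i j k (unit_vec n a) (unit_vec n b)) t else 0))"
    unfolding do_form_eq
  proof (rule sum.cong)
    fix t assume t: "t \<in> cycle_triples n"
    obtain i j k where t': "t = (i, j, k)" by (cases t)
    have ijk: "i < n" "j < n" "k < n" using t by (auto simp: t' cycle_triples_def)
    show "(if g \<in> cycle_elts t then (\<lambda>(i, j, k). cycle_form n \<kappa> i j k u v) t else 0) =
      (\<Sum>a<n. \<Sum>b<n. (u $ a * v $ b) *
       (if g \<in> cycle_elts t then (\<lambda>(i, j, k). cycle_form n \<kappa> i j k (unit_vec n a) (unit_vec n b)) t else 0))"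
      using cycle_form_expand[OF assms ijk, of \<kappa>] by (simp add: t')
  qed simp
  also have "\<dots> = (\<Sum>a<n. \<Sum>b<n. (u $ a * v $ b) * do_form m n \<kappa> g (unit_vec n a) (unit_vec n b))"
    unfolding do_form_eq sum_distrib_left
    by (subst sum.swap, rule sum.cong[OF refl], rule sum.swap)
  finally show ?thesis .
qed

lemma (in gm1) do_form_skew_bilinear: "skew_bilinear n (do_form m n \<kappa> g)"
proof -
  have cf: "cycle_form n \<kappa> i j k (u + u') v = cycle_form n \<kappa> i j k u v + cycle_form n \<kappa> i j k u' v"
    "cycle_form n \<kappa> i j k v u = - cycle_form n \<kappa> i j k u v"
    "cycle_form n \<kappa> i j k (c \<cdot>\<^sub>v u) v = c * cycle_form n \<kappa> i j k u v"
    if "u \<in> carrier_vec n" "u' \<in> carrier_vec n" "v \<in> carrier_vec n" "(i, j, k) \<in> cycle_triples n" for u u' v i j k c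
    using that by (auto simp: cycle_triples_def cycle_form_eq algebra_simps)
  have add: "do_form m n \<kappa> g (u + u') v = do_form m n \<kappa> g u v + do_form m n \<kappa> g u' v"
    and skew: "do_form m n \<kappa> g v u = - do_form m n \<kappa> g u v"
    and smult: "do_form m n \<kappa> g (c \<cdot>\<^sub>v u) v = c * do_form m n \<kappa> g u v"
    if "u \<in> carrier_vec n" "u' \<in> carrier_vec n" "v \<in> carrier_vec n" for u u' v c
    unfolding do_form_eq sum.distrib[symmetric] sum_negf[symmetric] sum_distrib_left
    by (auto intro!: sum.cong simp: cf[OF that])
  show ?thesis
    unfolding skew_bilinear_def
  proof (intro conjI ballI allI)
    fix u u' v :: "complex vec" and c assume *: "u \<in> carrier_vec n" "u' \<in> carrier_vec n" "v \<in> carrier_vec n"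
    show "do_form m n \<kappa> g (u + u') v = do_form m n \<kappa> g u v + do_form m n \<kappa> g u' v"
      "do_form m n \<kappa> g (c \<cdot>\<^sub>v u) v = c * do_form m n \<kappa> g u v" using add smult * by auto
    show "do_form m n \<kappa> g v (u + u') = do_form m n \<kappa> g v u + do_form m n \<kappa> g v u'"
      using skew[of "u + u'" "u" v] skew[of u u v] skew[of u' u v] add[of u u' v] * by simp
    show "do_form m n \<kappa> g v (c \<cdot>\<^sub>v u) = c * do_form m n \<kappa> g v u"
      using skew[of "c \<cdot>\<^sub>v u" "u" v] skew[of u u v] smult[of u u v c] * by simp
  next
    fix u v :: "complex vec" assume *: "u \<in> carrier_vec n" "v \<in> carrier_vec n"
    show "do_form m n \<kappa> g u v = - do_form m n \<kappa> g v u" using skew[of v v u] * by simp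
  qed
qed

lemma (in gm1) refl_elt_square:
  "i < n \<Longrightarrow> j < n \<Longrightarrow> refl_elt m n i j \<otimes>\<^bsub>G\<^esub> refl_elt m n i j = \<one>\<^bsub>G\<^esub>"
  using permutes_less[OF swap_permutes[of i j]]
  by (auto simp: perm_elt_eq Gm1_mult Gm1_one fun_eq_iff)

text \<open>
  An algebra with a representation \<open>e\<close> of \<open>G\<close> by elements.  It is instantiated with both algebras of the theorem and
  with an algebra of operators.
\<close>

locale gm1_rep = gm1 m n + B: complex_algebra B
  for m n :: nat and B :: "(complex, 'b) module" (structure) +
  fixes e :: "gm1 \<Rightarrow> 'b"
  assumes e_closed [simp, intro]: "x \<in> carrier (Gm1 m n) \<Longrightarrow> e x \<in> carrier B"
    and e_one: "e \<one>\<^bsub>Gm1 m n\<^esub> = \<one>"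
    and e_mult: "x \<in> carrier (Gm1 m n) \<Longrightarrow> y \<in> carrier (Gm1 m n) \<Longrightarrow> e (x \<otimes>\<^bsub>Gm1 m n\<^esub> y) = e x \<otimes> e y"
begin

definition tau :: "nat \<Rightarrow> nat \<Rightarrow> 'b" where
  "tau i j = (\<Oplus>l\<in>{..<m}. e (tau_elt i j l))"

definition X :: "nat \<Rightarrow> 'b" where
  "X p = (\<Oplus>j\<in>{..<n} - {p}. sgn_ij p j \<odot> tau p j)"

lemma tau_closed [simp, intro]: "i < n \<Longrightarrow> j < n \<Longrightarrow> i \<noteq> j \<Longrightarrow> tau i j \<in> carrier B"
  by (auto simp: tau_def tau_elt_closed intro!: B.finsum_closed)

lemma tau_closed' [simp, intro]: "i < n \<Longrightarrow> j < n \<Longrightarrow> j \<noteq> i \<Longrightarrow> tau i j \<in> carrier B"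
  by auto

lemma X_closed [simp, intro]: "p < n \<Longrightarrow> X p \<in> carrier B"
  by (auto simp: X_def intro!: B.finsum_closed)

lemma tau_flip: "i < n \<Longrightarrow> j < n \<Longrightarrow> i \<noteq> j \<Longrightarrow> tau j i = tau i j"
proof -
  assume ij: "i < n" "j < n" "i \<noteq> j"
  have "tau i j = (\<Oplus>l\<in>{..<m}. e (tau_elt i j ((m - l) mod m)))"
    unfolding tau_def by (rule B.finsum_bij[OF neg_bij]) (use ij tau_elt_closed in auto)
  also have "\<dots> = tau j i"
    unfolding tau_def by (rule B.add.finprod_cong') (use ij in \<open>auto simp: tau_elt_flip[of i j] tau_elt_closed\<close>)
  finally show ?thesis ..
qed

text \<open>
  By \<open>tau_elt_conj\<close> conjugation by \<open>x\<close> maps the summands of \<open>\<tau>\<^sub>i\<^sub>j\<close> to those of \<open>\<tau>\<^bsub>w(i)w(j)\<^esub>\<close>, up to a shift of the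
  exponent \<open>l\<close> modulo \<open>m\<close>, which does not affect the sum.
\<close>

lemma e_tau:
  assumes x: "x \<in> carrier G" and ij: "i < n" "j < n" "i \<noteq> j"
  shows "e x \<otimes> tau i j = tau (fst x i) (fst x j) \<otimes> e x"
proof -
  have ne: "fst x i \<noteq> fst x j" and less: "fst x i < n" "fst x j < n"
    using ij Gm1_fst_inj[OF x] Gm1_fst_less[OF x] by auto
  define c where "c = snd x j - snd x i"
  have "e x \<otimes> tau i j = (\<Oplus>l\<in>{..<m}. e x \<otimes> e (tau_elt i j l))"
    unfolding tau_def by (rule B.finsum_mult_right) (use x ij tau_elt_closed in auto)
  also have "\<dots> = (\<Oplus>l\<in>{..<m}. e (tau_elt (fst x i) (fst x j) (nat ((int l + c) mod int m))) \<otimes> e x)"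
    by (rule B.add.finprod_cong')
      (use x ij ne less tau_elt_closed tau_elt_conj[OF x ij] in \<open>auto simp: c_def add_diff_eq simp flip: e_mult\<close>)
  also have "\<dots> = (\<Oplus>l\<in>{..<m}. e (tau_elt (fst x i) (fst x j) l) \<otimes> e x)"
    by (rule B.finsum_bij[OF shift_bij, symmetric]) (use x ne less tau_elt_closed in auto)
  also have "\<dots> = tau (fst x i) (fst x j) \<otimes> e x"
    unfolding tau_def by (rule B.finsum_mult_left[symmetric]) (use x ne less tau_elt_closed in auto)
  finally show ?thesis .
qed

text \<open>
  Every summand of \<open>\<tau>\<^sub>a\<^sub>b\<close> has the permutation part \<open>s\<^sub>a\<^sub>b\<close>, so all of them conjugate \<open>\<tau>\<^sub>c\<^sub>d\<close> in the same way.
\<close>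

lemma tau_tau:
  assumes "a < n" "b < n" "a \<noteq> b" "c < n" "d < n" "c \<noteq> d"
  shows "tau a b \<otimes> tau c d = tau (swap a b c) (swap a b d) \<otimes> tau a b"
proof -
  have sw: "swap a b c < n" "swap a b d < n" "swap a b c \<noteq> swap a b d"
    using assms by (auto simp: Transposition.transpose_def)
  have "tau a b \<otimes> tau c d = (\<Oplus>l\<in>{..<m}. e (tau_elt a b l) \<otimes> tau c d)"
    unfolding tau_def[of a b] by (rule B.finsum_mult_left) (use assms tau_elt_closed in auto)
  also have "\<dots> = (\<Oplus>l\<in>{..<m}. tau (swap a b c) (swap a b d) \<otimes> e (tau_elt a b l))"
    by (rule B.add.finprod_cong') (use assms tau_elt_closed sw in \<open>auto simp: e_tau fst_tau_elt\<close>)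
  also have "\<dots> = tau (swap a b c) (swap a b d) \<otimes> tau a b"
    unfolding tau_def[of a b] by (rule B.finsum_mult_right[symmetric]) (use assms tau_elt_closed sw in auto)
  finally show ?thesis .
qed

lemma tau_commute:
  assumes "a < n" "b < n" "c < n" "d < n" "a \<noteq> b" "c \<noteq> d" "a \<noteq> c" "a \<noteq> d" "b \<noteq> c" "b \<noteq> d"
  shows "B.bracket (tau a b) (tau c d) = \<zero>"
proof -
  have "tau a b \<otimes> tau c d = tau c d \<otimes> tau a b" using assms tau_tau[of a b c d] by (simp add: Transposition.transpose_def)
  then show ?thesis unfolding B.bracket_def using assms by (simp add: B.r_neg a_minus_def)
qed

text \<open>
  The three factorizations of a 3-cycle into transpositions.
\<close>

lemma tau_cycle:
  assumes "p < n" "q < n" "k < n" "p \<noteq> q" "q \<noteq> k" "p \<noteq> k"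
  shows "tau q k \<otimes> tau k p = tau p q \<otimes> tau q k" "tau k p \<otimes> tau p q = tau p q \<otimes> tau q k"
proof -
  have cyc: "tau k p \<otimes> tau p q = tau p q \<otimes> tau q k" 
    if "p < n" "q < n" "k < n" "p \<noteq> q" "q \<noteq> k" "p \<noteq> k" for p q k
    using tau_tau[of p q q k] that tau_flip[of p k] by (simp add: Transposition.transpose_def)
  show "tau k p \<otimes> tau p q = tau p q \<otimes> tau q k" using cyc[of p q k] assms by simp
  show "tau q k \<otimes> tau k p = tau p q \<otimes> tau q k" using cyc[of k p q] cyc[of p q k] assms by simp
qed

lemma bracket_tau:
  assumes "p < n" "q < n" "k < n" "p \<noteq> q" "q \<noteq> k" "p \<noteq> k"
  defines "C \<equiv> B.bracket (tau p q) (tau q k)"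
  shows "B.bracket (tau p k) (tau p q) = C" "B.bracket (tau p k) (tau q k) = \<ominus> C"
proof -
  have 1: "tau p k \<otimes> tau p q = tau p q \<otimes> tau q k"
    using tau_cycle(2)[of p q k] tau_flip[of p k] assms(1-6) by simp
  have 2: "tau p q \<otimes> tau p k = tau q k \<otimes> tau p q"
    using tau_cycle[of k q p] tau_flip[of p k] tau_flip[of p q] tau_flip[of q k] assms(1-6) by simp
  have 3: "tau p k \<otimes> tau q k = tau q k \<otimes> tau p q"
    using tau_cycle[of k q p] tau_flip[of p k] tau_flip[of p q] tau_flip[of q k] assms(1-6) by simp
  have 4: "tau q k \<otimes> tau p k = tau p q \<otimes> tau q k"
    using tau_cycle[of p q k] tau_flip[of p k] assms(1-6) by simp
  show "B.bracket (tau p k) (tau p q) = C" unfolding C_def B.bracket_def 1 2 ..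
  show "B.bracket (tau p k) (tau q k) = \<ominus> C" unfolding C_def B.bracket_def 3 4
    using assms(1-6) by (simp add: a_minus_def B.minus_add B.a_comm)
qed

text \<open>
  Split off the common index pair: \<open>X\<^sub>p = \<plusminus>\<tau>\<^sub>p\<^sub>q + P\<close> and \<open>X\<^sub>q = \<mp>\<tau>\<^sub>p\<^sub>q + Q\<close>.  In \<open>[P, Q]\<close> only pairs
  \<open>\<tau>\<^sub>p\<^sub>k, \<tau>\<^sub>q\<^sub>k\<close> with a common third index contribute.  By \<open>bracket_tau\<close> all remaining commutators with third index \<open>k\<close>
  are multiples of \<open>[\<tau>\<^sub>p\<^sub>q, \<tau>\<^sub>q\<^sub>k]\<close>, and for each order of \<open>p\<close>, \<open>q\<close>, \<open>k\<close> the signs add up to \<open>-1\<close>.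
\<close>

lemma bracket_X:
  assumes pq: "p < n" "q < n" "p \<noteq> q"
  shows "B.bracket (X p) (X q) = (\<Oplus>k\<in>{..<n} - {p, q}. \<ominus> B.bracket (tau p q) (tau q k))"
proof -
  let ?S = "{..<n} - {p, q}"
  define P where "P = (\<Oplus>k\<in>?S. sgn_ij p k \<odot> tau p k)"
  define Q where "Q = (\<Oplus>k\<in>?S. sgn_ij q k \<odot> tau q k)"
  define C where "C k = B.bracket (tau p q) (tau q k)" for k
  have C [simp]: "C k \<in> carrier B" if "k \<in> ?S" for k using that pq by (auto simp: C_def)
  have PQ: "P \<in> carrier B" "Q \<in> carrier B" using pq by (auto simp: P_def Q_def intro!: B.finsum_closed)
  have t: "tau p q \<in> carrier B" using pq by simp
  have ins: "{..<n} - {p} = insert q ?S" "{..<n} - {q} = insert p ?S" using pq by auto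
  have Xp: "X p = sgn_ij p q \<odot> tau p q \<oplus> P"
    unfolding X_def P_def ins using pq by (intro B.finsum_insert) auto
  have Xq: "X q = sgn_ij q p \<odot> tau p q \<oplus> Q"
    unfolding X_def Q_def ins using pq tau_flip[of p q] by (subst B.finsum_insert) auto
  have tQ: "B.bracket (tau p q) Q = (\<Oplus>k\<in>?S. sgn_ij q k \<odot> C k)"
    unfolding Q_def C_def using pq
    by (subst B.bracket_finsum_right, simp_all add: Pi_iff, intro B.add.finprod_cong')
      (simp_all add: B.bracket_smult Pi_iff)
  have Pt: "B.bracket P (tau p q) = (\<Oplus>k\<in>?S. sgn_ij p k \<odot> C k)"
    unfolding P_def C_def using pq bracket_tau(1)[of p q]
    by (subst B.bracket_finsum_left, simp_all add: Pi_iff, intro B.add.finprod_cong')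
      (simp_all add: B.bracket_smult Pi_iff)
  have tt: "B.bracket (tau p j) Q = sgn_ij q j \<odot> (\<ominus> C j)" if j: "j \<in> ?S" for j
  proof -
    have "B.bracket (tau p j) Q = (\<Oplus>k\<in>?S. sgn_ij q k \<odot> B.bracket (tau p j) (tau q k))"
      unfolding Q_def using pq j
      by (subst B.bracket_finsum_right, simp_all add: Pi_iff, intro B.add.finprod_cong')
        (simp_all add: B.bracket_smult Pi_iff)
    also have "\<dots> = sgn_ij q j \<odot> B.bracket (tau p j) (tau q j)"
      by (rule B.finsum_single) (use pq j tau_commute in auto)
    finally show ?thesis using bracket_tau(2)[of p q j] pq j by (auto simp: C_def)
  qed
  have PQ': "B.bracket P Q = (\<Oplus>k\<in>?S. (- (sgn_ij p k * sgn_ij q k)) \<odot> C k)"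
    unfolding P_def using pq PQ tt
    by (subst B.bracket_finsum_left, simp_all add: Pi_iff, intro B.add.finprod_cong')
      (simp_all add: B.bracket_smult B.smult_assoc Pi_iff)
  have sm: "a \<odot> (\<Oplus>k\<in>?S. b k \<odot> C k) = (\<Oplus>k\<in>?S. (a * b k) \<odot> C k)" for a b
    by (subst B.finsum_smult, simp add: Pi_iff, intro B.add.finprod_cong')
      (simp_all add: B.smult_assoc Pi_iff)
  have "B.bracket (X p) (X q) = sgn_ij p q \<odot> B.bracket (tau p q) Q \<oplus> (sgn_ij q p \<odot> B.bracket P (tau p q) \<oplus> B.bracket P Q)"
    unfolding Xp Xq using t PQ by (simp add: B.bracket_add_left B.bracket_add_right B.bracket_smult B.a_ac)
  also have "\<dots> = (\<Oplus>k\<in>?S. (sgn_ij p q * sgn_ij q k) \<odot> C k \<oplus> ((sgn_ij q p * sgn_ij p k) \<odot> C k \<oplus> (- (sgn_ij p k * sgn_ij q k)) \<odot> C k))"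
    unfolding tQ Pt PQ' sm by (simp add: Pi_iff)
  also have "\<dots> = (\<Oplus>k\<in>?S. \<ominus> C k)"
  proof (rule B.add.finprod_cong')
    fix k assume k: "k \<in> ?S"
    \<comment> \<open>This holds for each of the six orders of \<open>p\<close>, \<open>q\<close>, \<open>k\<close>.\<close>
    have "sgn_ij p q * sgn_ij q k + (sgn_ij q p * sgn_ij p k + - (sgn_ij p k * sgn_ij q k)) = - 1"
      using k pq by (auto simp: sgn_ij_def)
    then have "(sgn_ij p q * sgn_ij q k + (sgn_ij q p * sgn_ij p k + - (sgn_ij p k * sgn_ij q k))) \<odot> C k = \<ominus> C k"
      using C[OF k] by simp
    then show "(sgn_ij p q * sgn_ij q k) \<odot> C k \<oplus> ((sgn_ij q p * sgn_ij p k) \<odot> C k \<oplus> (- (sgn_ij p k * sgn_ij q k)) \<odot> C k) = \<ominus> C k"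
      unfolding B.smult_l_distr[OF C[OF k]] .
  qed auto
  finally show ?thesis unfolding C_def .
qed

text \<open>
  The right-hand side of the commutator relation.
\<close>

definition form_elt :: "complex \<Rightarrow> complex vec \<Rightarrow> complex vec \<Rightarrow> 'b" where
  "form_elt \<kappa> u v = (\<Oplus>g\<in>carrier G. do_form m n \<kappa> g u v \<odot> e g)"

lemma form_elt_closed [simp, intro]: "form_elt \<kappa> u v \<in> carrier B"
  by (auto simp: form_elt_def intro!: B.finsum_closed)

text \<open>
  The pairs of exponents \<open>(l, l')\<close> give different group elements, so the double sum that multiplies out
  \<open>\<tau>\<^sub>i\<^sub>j \<tau>\<^sub>j\<^sub>k\<close> runs through them once.
\<close>

lemma sum_cycle_elts:
  assumes "(i, j, k) \<in> cycle_triples n"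
  shows "cycle_elts (i, j, k) \<subseteq> carrier G" "(\<Oplus>g\<in>cycle_elts (i, j, k). e g) = tau i j \<otimes> tau j k"
proof -
  have ijk: "i < n" "j < n" "k < n" "i \<noteq> j" "j \<noteq> k" "i \<noteq> k"
    using assms by (auto simp: cycle_triples_def)
  show sub: "cycle_elts (i, j, k) \<subseteq> carrier G"
    using ijk cycle_elt_closed by (auto simp: cycle_elts_def)
  have bij: "bij_betw (\<lambda>(l, l'). cycle_elt m n i j k l l') ({..<m} \<times> {..<m}) (cycle_elts (i, j, k))"
    unfolding bij_betw_def using cycle_elt_inj[OF ijk] by (simp add: cycle_elts_def)
  have te: "e (tau_elt i j l) \<in> carrier B" "e (tau_elt j k l) \<in> carrier B" for l
    using ijk tau_elt_closed by auto
  have "(\<Oplus>g\<in>cycle_elts (i, j, k). e g) = (\<Oplus>p\<in>{..<m} \<times> {..<m}. e (cycle_elt m n i j k (fst p) (snd p)))"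
    by (subst B.finsum_bij[OF bij]) (use sub in \<open>auto simp: case_prod_beta\<close>)
  also have "{..<m} \<times> {..<m} = (\<Union>l\<in>{..<m}. (\<lambda>l'. (l, l')) ` {..<m})" by auto
  also have "(\<Oplus>p\<in>(\<Union>l\<in>{..<m}. (\<lambda>l'. (l, l')) ` {..<m}). e (cycle_elt m n i j k (fst p) (snd p)))
    = (\<Oplus>l\<in>{..<m}. \<Oplus>p\<in>(\<lambda>l'. (l, l')) ` {..<m}. e (cycle_elt m n i j k (fst p) (snd p)))"
    by (rule B.add.finprod_UN_disjoint) (use ijk cycle_elt_closed in \<open>auto simp: pairwise_def disjnt_def\<close>)
  also have "\<dots> = (\<Oplus>l\<in>{..<m}. \<Oplus>l'\<in>{..<m}. e (tau_elt i j l) \<otimes> e (tau_elt j k l'))"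
  proof (rule B.add.finprod_cong')
    fix l assume "l \<in> {..<m}"
    show "(\<Oplus>p\<in>(\<lambda>l'. (l, l')) ` {..<m}. e (cycle_elt m n i j k (fst p) (snd p))) =
      (\<Oplus>l'\<in>{..<m}. e (tau_elt i j l) \<otimes> e (tau_elt j k l'))"
      by (subst B.add.finprod_reindex)
        (use ijk te in \<open>auto simp: inj_on_def cycle_elt_eq e_mult tau_elt_closed intro!: B.add.finprod_cong'\<close>)
  qed (auto simp: te intro!: B.finsum_closed)
  also have "\<dots> = (\<Oplus>l\<in>{..<m}. e (tau_elt i j l) \<otimes> tau j k)"
    unfolding tau_def by (rule B.add.finprod_cong') (auto simp: te B.finsum_mult_right intro!: B.finsum_closed)
  also have "\<dots> = tau i j \<otimes> tau j k"
    unfolding tau_def[of i j] by (rule B.finsum_mult_left[symmetric]) (use ijk te in auto)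
  finally show "(\<Oplus>g\<in>cycle_elts (i, j, k). e g) = tau i j \<otimes> tau j k" .
qed

lemma form_elt_triples:
  "form_elt \<kappa> u v = (\<Oplus>t\<in>cycle_triples n. (\<lambda>(i, j, k). cycle_form n \<kappa> i j k u v \<odot> (tau i j \<otimes> tau j k)) t)"
proof -
  let ?cf = "\<lambda>t. (\<lambda>(i, j, k). cycle_form n \<kappa> i j k u v) t"
  have "form_elt \<kappa> u v = (\<Oplus>g\<in>carrier G. \<Oplus>t\<in>cycle_triples n. (if g \<in> cycle_elts t then ?cf t else 0) \<odot> e g)"
    unfolding form_elt_def do_form_eq
    by (rule B.add.finprod_cong') (auto simp: B.finsum_smult_left intro!: B.finsum_closed)
  also have "\<dots> = (\<Oplus>t\<in>cycle_triples n. \<Oplus>g\<in>carrier G. (if g \<in> cycle_elts t then ?cf t else 0) \<odot> e g)"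
    by (rule B.finsum_swap) (auto simp: Gm1_finite)
  also have "\<dots> = (\<Oplus>t\<in>cycle_triples n. (\<lambda>(i, j, k). cycle_form n \<kappa> i j k u v \<odot> (tau i j \<otimes> tau j k)) t)"
  proof (rule B.add.finprod_cong')
    fix t assume t: "t \<in> cycle_triples n"
    obtain i j k where t': "t = (i, j, k)" by (cases t)
    note sum = sum_cycle_elts[OF t[unfolded t']]
    have "(\<Oplus>g\<in>carrier G. (if g \<in> cycle_elts t then ?cf t else 0) \<odot> e g) = (\<Oplus>g\<in>cycle_elts t. ?cf t \<odot> e g)"
      by (rule B.add.finprod_mono_neutral_cong_right) (use sum Gm1_finite in \<open>auto simp: t'\<close>)
    also have "\<dots> = ?cf t \<odot> (\<Oplus>g\<in>cycle_elts t. e g)"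
      by (rule B.finsum_smult[symmetric]) (use sum in \<open>auto simp: t'\<close>)
    finally show "(\<Oplus>g\<in>carrier G. (if g \<in> cycle_elts t then ?cf t else 0) \<odot> e g) =
      (\<lambda>(i, j, k). cycle_form n \<kappa> i j k u v \<odot> (tau i j \<otimes> tau j k)) t"
      using sum by (simp add: t')
  qed (auto simp: cycle_triples_def)
  finally show ?thesis .
qed

text \<open>
  For each third index \<open>k\<close> exactly two of the six orders of \<open>p\<close>, \<open>q\<close>, \<open>k\<close> are monotone.  One of them is a rotation of
  \<open>(p, q, k)\<close> and contributes \<open>\<kappa>\<^sup>2 \<tau>\<^sub>p\<^sub>q \<tau>\<^sub>q\<^sub>k\<close>, the other one is a rotation of \<open>(k, q, p)\<close> and contributes
  \<open>-\<kappa>\<^sup>2 \<tau>\<^sub>q\<^sub>k \<tau>\<^sub>p\<^sub>q\<close>.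
\<close>

lemma form_elt_basis:
  assumes pq: "p < n" "q < n" "p \<noteq> q"
  shows "form_elt \<kappa> (unit_vec n p) (unit_vec n q) =
    \<kappa>\<^sup>2 \<odot> (\<Oplus>k\<in>{..<n} - {p, q}. B.bracket (tau p q) (tau q k))"
proof -
  let ?S = "{..<n} - {p, q}"
  define W where "W = (\<lambda>(i, j, k). cycle_form n \<kappa> i j k (unit_vec n p) (unit_vec n q) \<odot> (tau i j \<otimes> tau j k))"
  define six where "six k = {(p, q, k), (q, k, p), (k, p, q), (k, q, p), (q, p, k), (p, k, q)}" for k
  define Tk where "Tk k = cycle_triples n \<inter> six k" for k
  have W_closed: "W t \<in> carrier B" if "t \<in> cycle_triples n" for t
    using that by (auto simp: W_def cycle_triples_def)
  have W_Tk: "(\<Oplus>t\<in>Tk k. W t) = \<kappa>\<^sup>2 \<odot> B.bracket (tau p q) (tau q k)" if k: "k \<in> ?S" for k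
  proof -
    define D where "D = tau p q \<otimes> tau q k"
    define E where "E = tau q k \<otimes> tau p q"
    have pqk: "p < n" "q < n" "k < n" "p \<noteq> q" "q \<noteq> k" "p \<noteq> k" using k pq by auto
    have DE: "D \<in> carrier B" "E \<in> carrier B" using pqk by (auto simp: D_def E_def)
    have cf: "cycle_form n \<kappa> i j l (unit_vec n p) (unit_vec n q) =
      \<kappa>\<^sup>2 * (((if i = p then 1 else 0) - (if j = p then 1 else 0)) * ((if j = q then 1 else 0) - (if l = q then 1 else 0)) -
            ((if i = q then 1 else 0) - (if j = q then 1 else 0)) * ((if j = p then 1 else 0) - (if l = p then 1 else 0)))"
      if "i < n" "j < n" "l < n" for i j l
      using that by (simp add: cycle_form_eq unit_vec_def)
    have even: "W (p, q, k) = \<kappa>\<^sup>2 \<odot> D" "W (q, k, p) = \<kappa>\<^sup>2 \<odot> D" "W (k, p, q) = \<kappa>\<^sup>2 \<odot> D"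
      using pqk tau_cycle[OF pqk] by (simp_all add: W_def cf D_def)
    have "tau k q \<otimes> tau q p = E" using pqk tau_flip[of q k] tau_flip[of p q] by (simp add: E_def)
    then have odd: "W (k, q, p) = \<ominus> (\<kappa>\<^sup>2 \<odot> E)" "W (q, p, k) = \<ominus> (\<kappa>\<^sup>2 \<odot> E)" "W (p, k, q) = \<ominus> (\<kappa>\<^sup>2 \<odot> E)"
      using pqk tau_cycle[of k q p] DE by (simp_all add: W_def cf)
    have "(\<Oplus>t\<in>Tk k. W t) = \<kappa>\<^sup>2 \<odot> D \<oplus> \<ominus> (\<kappa>\<^sup>2 \<odot> E)"
    proof -
      have two: "(\<Oplus>t\<in>Tk k. W t) = \<kappa>\<^sup>2 \<odot> D \<oplus> \<ominus> (\<kappa>\<^sup>2 \<odot> E)"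
        if "Tk k = {s, t}" "s \<noteq> t" "W s = \<kappa>\<^sup>2 \<odot> D" "W t = \<ominus> (\<kappa>\<^sup>2 \<odot> E)" for s t
        using that DE by (simp add: Pi_iff)
      consider "Tk k = {(p, q, k), (k, q, p)}" | "Tk k = {(q, k, p), (p, k, q)}" | "Tk k = {(k, p, q), (q, p, k)}"
      proof -
        have "p < q \<and> q < k \<or> k < q \<and> q < p \<Longrightarrow> Tk k = {(p, q, k), (k, q, p)}"
          "q < k \<and> k < p \<or> p < k \<and> k < q \<Longrightarrow> Tk k = {(q, k, p), (p, k, q)}"
          "k < p \<and> p < q \<or> q < p \<and> p < k \<Longrightarrow> Tk k = {(k, p, q), (q, p, k)}"
          using pqk by (auto simp: Tk_def six_def cycle_triples_def)
        moreover have "(p < q \<and> q < k \<or> k < q \<and> q < p) \<or> (q < k \<and> k < p \<or> p < k \<and> k < q) \<or>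
            (k < p \<and> p < q \<or> q < p \<and> p < k)"
          using pqk by linarith
        ultimately show ?thesis using that by blast
      qed
      then show ?thesis by cases (erule two; use pqk in \<open>simp add: even odd\<close>)+
    qed
    then show ?thesis
      using DE unfolding B.bracket_def D_def[symmetric] E_def[symmetric] by (simp add: B.smult_r_distr a_minus_def)
  qed
  have "form_elt \<kappa> (unit_vec n p) (unit_vec n q) = (\<Oplus>t\<in>cycle_triples n. W t)"
    unfolding form_elt_triples W_def ..
  also have "\<dots> = (\<Oplus>t\<in>(\<Union>k\<in>?S. Tk k). W t)"
  proof (rule B.add.finprod_mono_neutral_cong_right)
    show "(\<Union>k\<in>?S. Tk k) \<subseteq> cycle_triples n" by (auto simp: Tk_def)
    show "W t = \<zero>" if t: "t \<in> cycle_triples n - (\<Union>k\<in>?S. Tk k)" for t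
    proof -
      obtain i j l where t': "t = (i, j, l)" by (cases t)
      have ijl: "i < n" "j < n" "l < n" "i \<noteq> j" "j \<noteq> l" "i \<noteq> l" using t by (auto simp: t' cycle_triples_def)
      have "p \<notin> {i, j, l} \<or> q \<notin> {i, j, l}"
      proof (rule ccontr)
        assume "\<not> ?thesis"
        then have "p = i \<and> q = j \<or> p = j \<and> q = i \<or> p = i \<and> q = l \<or> p = l \<and> q = i \<or> p = j \<and> q = l \<or> p = l \<and> q = j"
          using pq by auto
        then have "l \<in> ?S \<and> (i, j, l) \<in> six l \<or> j \<in> ?S \<and> (i, j, l) \<in> six j \<or> i \<in> ?S \<and> (i, j, l) \<in> six i"
          using ijl by (elim disjE) (simp_all add: six_def)
        then have "\<exists>k\<in>?S. (i, j, l) \<in> six k" by blast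
        then show False using t by (auto simp: t' Tk_def)
      qed
      then have "cycle_form n \<kappa> i j l (unit_vec n p) (unit_vec n q) = 0"
        using ijl by (auto simp: cycle_form_eq unit_vec_def)
      then show ?thesis using ijl by (simp add: W_def t')
    qed
  qed (use W_closed in auto)
  also have "\<dots> = (\<Oplus>k\<in>?S. \<Oplus>t\<in>Tk k. W t)"
    by (rule B.add.finprod_UN_disjoint)
      (use W_closed pq in \<open>auto simp: Tk_def pairwise_def disjnt_def six_def\<close>)
  also have "\<dots> = (\<Oplus>k\<in>?S. \<kappa>\<^sup>2 \<odot> B.bracket (tau p q) (tau q k))"
    by (rule B.add.finprod_cong') (use W_Tk pq in auto)
  also have "\<dots> = \<kappa>\<^sup>2 \<odot> (\<Oplus>k\<in>?S. B.bracket (tau p q) (tau q k))"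
    by (rule B.finsum_smult[symmetric]) (use pq in auto)
  finally show ?thesis .
qed

lemma form_elt_expand:
  assumes "u \<in> carrier_vec n" "v \<in> carrier_vec n"
  shows "form_elt \<kappa> u v = (\<Oplus>i\<in>{..<n}. \<Oplus>j\<in>{..<n}. (u $ i * v $ j) \<odot> form_elt \<kappa> (unit_vec n i) (unit_vec n j))"
proof -
  let ?f = "\<lambda>g i j. ((u $ i * v $ j) * do_form m n \<kappa> g (unit_vec n i) (unit_vec n j)) \<odot> e g"
  have "form_elt \<kappa> u v = (\<Oplus>g\<in>carrier G. \<Oplus>i\<in>{..<n}. \<Oplus>j\<in>{..<n}. ?f g i j)"
    unfolding form_elt_def do_form_expand[OF assms]
    by (rule B.add.finprod_cong') (auto simp: B.finsum_smult_left intro!: B.finsum_closed B.add.finprod_cong')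
  also have "\<dots> = (\<Oplus>i\<in>{..<n}. \<Oplus>g\<in>carrier G. \<Oplus>j\<in>{..<n}. ?f g i j)"
    by (rule B.finsum_swap) (auto simp: Gm1_finite intro!: B.finsum_closed)
  also have "\<dots> = (\<Oplus>i\<in>{..<n}. \<Oplus>j\<in>{..<n}. \<Oplus>g\<in>carrier G. ?f g i j)"
    by (rule B.add.finprod_cong', simp) (auto simp: Gm1_finite intro!: B.finsum_closed B.finsum_swap)
  also have "\<dots> = (\<Oplus>i\<in>{..<n}. \<Oplus>j\<in>{..<n}. (u $ i * v $ j) \<odot> form_elt \<kappa> (unit_vec n i) (unit_vec n j))"
    unfolding form_elt_def
    by (auto simp: B.finsum_smult B.smult_assoc Pi_iff intro!: B.finsum_closed B.add.finprod_cong')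
  finally show ?thesis .
qed

lemma form_elt_self: "p < n \<Longrightarrow> form_elt \<kappa> (unit_vec n p) (unit_vec n p) = \<zero>"
proof -
  have "do_form m n \<kappa> g (unit_vec n p) (unit_vec n p) = 0" for g
  proof -
    have "do_form m n \<kappa> g (unit_vec n p) (unit_vec n p) = - do_form m n \<kappa> g (unit_vec n p) (unit_vec n p)"
      using do_form_skew_bilinear[of \<kappa> g] unit_vec_carrier[of n p] unfolding skew_bilinear_def by blast
    then show ?thesis by simp
  qed
  then show ?thesis unfolding form_elt_def by (intro B.add.finprod_one_eqI) simp
qed

lemma e_X:
  assumes x: "x \<in> carrier G" and p: "p < n"
  shows "e x \<otimes> X p = (\<Oplus>j\<in>{..<n} - {fst x p}. sgn_ij p (inv_into UNIV (fst x) j) \<odot> tau (fst x p) j) \<otimes> e x"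
proof -
  note perm = Gm1_fst_permutes[OF x] 
  note [simp] = permutes_inverses[OF perm] Gm1_fst_inj[OF x] Gm1_fst_less[OF x] permutes_less[OF permutes_inv[OF perm]]
  have bij: "bij_betw (fst x) ({..<n} - {p}) ({..<n} - {fst x p})"
    by (rule bij_betw_byWitness[of _ "inv_into UNIV (fst x)"]) (auto simp: permutes_inv_eq[OF perm])
  have "e x \<otimes> X p = (\<Oplus>j\<in>{..<n} - {p}. e x \<otimes> (sgn_ij p j \<odot> tau p j))"
    unfolding X_def by (rule B.finsum_mult_right) (use x p in auto)
  also have "\<dots> = (\<Oplus>j\<in>{..<n} - {p}. (sgn_ij p (inv_into UNIV (fst x) (fst x j)) \<odot> tau (fst x p) (fst x j)) \<otimes> e x)"
    by (rule B.add.finprod_cong') (use x p in \<open>auto simp: B.smult_mult_right B.smult_mult_left e_tau\<close>)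
  also have "\<dots> = (\<Oplus>j\<in>{..<n} - {fst x p}. (sgn_ij p (inv_into UNIV (fst x) j) \<odot> tau (fst x p) j) \<otimes> e x)"
    by (rule B.finsum_bij[OF bij, symmetric]) (use x p in auto)
  also have "\<dots> = (\<Oplus>j\<in>{..<n} - {fst x p}. sgn_ij p (inv_into UNIV (fst x) j) \<odot> tau (fst x p) j) \<otimes> e x"
    by (rule B.finsum_mult_left[symmetric]) (use x p in auto)
  finally show ?thesis .
qed

lemma e_torus_gen_X: "p < n \<Longrightarrow> e (torus_gen m n r) \<otimes> X p = X p \<otimes> e (torus_gen m n r)"
  using e_X[OF torus_gen_closed, of p r] by (simp add: torus_gen_def X_def)

text \<open>
  The transposition \<open>s\<^sub>i\<close> preserves the order of all pairs of indices except \<open>(i, i + 1)\<close>, so the signs match apart from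
  that of \<open>\<tau>\<^bsub>i,i+1\<^esub>\<close>, which differs by 2.
\<close>

lemma e_refl_X:
  assumes i: "i + 1 < n" and p: "p < n"
  shows "p \<noteq> i \<Longrightarrow> p \<noteq> i + 1 \<Longrightarrow> e (refl_elt m n i (i + 1)) \<otimes> X p = X p \<otimes> e (refl_elt m n i (i + 1))"
    and "e (refl_elt m n i (i + 1)) \<otimes> X i = (X (i + 1) \<oplus> 2 \<odot> tau i (i + 1)) \<otimes> e (refl_elt m n i (i + 1))"
proof -
  let ?s = "refl_elt m n i (i + 1)"
  have s: "?s \<in> carrier G" using i by (simp add: refl_elt_closed)
  have fs: "fst ?s = swap i (i + 1)" by (simp add: perm_elt_eq)
  {
    assume "p \<noteq> i" "p \<noteq> i + 1"
    then have "(\<Oplus>j\<in>{..<n} - {fst ?s p}. sgn_ij p (inv_into UNIV (fst ?s) j) \<odot> tau (fst ?s p) j) = X p"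
      unfolding X_def fs using p by (intro B.add.finprod_cong') (auto simp: sgn_ij_def Transposition.transpose_def)
    then show "e ?s \<otimes> X p = X p \<otimes> e ?s" using e_X[OF s p] by simp
  }
  have "(\<Oplus>j\<in>{..<n} - {fst ?s i}. sgn_ij i (inv_into UNIV (fst ?s) j) \<odot> tau (fst ?s i) j)
      = (\<Oplus>j\<in>{..<n} - {i + 1}. sgn_ij (i + 1) j \<odot> tau (i + 1) j \<oplus> (if j = i then 2 else 0) \<odot> tau (i + 1) j)"
  proof (rule B.add.finprod_cong')
    fix j assume j: "j \<in> {..<n} - {i + 1}"
    then have "sgn_ij i (inv_into UNIV (fst ?s) j) = sgn_ij (i + 1) j + (if j = i then 2 else 0)"
      unfolding fs by (auto simp: sgn_ij_def Transposition.transpose_def)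
    then show "sgn_ij i (inv_into UNIV (fst ?s) j) \<odot> tau (fst ?s i) j =
      sgn_ij (i + 1) j \<odot> tau (i + 1) j \<oplus> (if j = i then 2 else 0) \<odot> tau (i + 1) j"
      using j i by (simp only: fs transpose_apply_first) (auto intro!: B.smult_l_distr)
  qed (use i fs in auto)
  also have "\<dots> = X (i + 1) \<oplus> (\<Oplus>j\<in>{..<n} - {i + 1}. (if j = i then 2 else 0) \<odot> tau (i + 1) j)"
    unfolding X_def using i by (intro B.finsum_addf) auto
  also have "(\<Oplus>j\<in>{..<n} - {i + 1}. (if j = i then 2 else 0) \<odot> tau (i + 1) j) = 2 \<odot> tau i (i + 1)"
    using i tau_flip[of i "i + 1"] by (subst B.finsum_single[of _ i]) auto
  finally show "e ?s \<otimes> X i = (X (i + 1) \<oplus> 2 \<odot> tau i (i + 1)) \<otimes> e ?s"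
    using e_X[OF s, of i] i by simp
qed

lemma e_refl_tau:
  assumes i: "i + 1 < n"
  shows "e (refl_elt m n i (i + 1)) \<otimes> tau i (i + 1) = (\<Oplus>l\<in>{..<m}. e (torus_diff m n i (i + 1) l))"
proof -
  let ?s = "refl_elt m n i (i + 1)"
  have s: "?s \<in> carrier G" using i by (auto intro: refl_elt_closed)
  have ss: "?s \<otimes>\<^bsub>G\<^esub> ?s = \<one>\<^bsub>G\<^esub>" using i by (simp add: refl_elt_square)
  have "e ?s \<otimes> tau i (i + 1) = (\<Oplus>l\<in>{..<m}. e ?s \<otimes> e (tau_elt i (i + 1) l))"
    unfolding tau_def by (rule B.finsum_mult_right) (use s i tau_elt_closed in auto)
  also have "\<dots> = (\<Oplus>l\<in>{..<m}. e (torus_diff m n i (i + 1) l))"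
  proof (rule B.add.finprod_cong')
    fix l
    have d: "torus_diff m n i (i + 1) l \<in> carrier G" by (simp add: torus_diff_closed)
    have "e ?s \<otimes> e (tau_elt i (i + 1) l) = e (?s \<otimes>\<^bsub>G\<^esub> (?s \<otimes>\<^bsub>G\<^esub> torus_diff m n i (i + 1) l))"
      using s d by (simp add: tau_elt_def e_mult)
    also have "\<dots> = e (torus_diff m n i (i + 1) l)"
      using s d ss by (simp add: G.m_assoc[symmetric])
    finally show "e ?s \<otimes> e (tau_elt i (i + 1) l) = e (torus_diff m n i (i + 1) l)" .
  qed (auto simp: torus_diff_closed)
  finally show ?thesis .
qed

lemma e_refl_square: "i + 1 < n \<Longrightarrow> e (refl_elt m n i (i + 1)) \<otimes> e (refl_elt m n i (i + 1)) = \<one>"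
proof -
  assume "i + 1 < n"
  then have s: "refl_elt m n i (i + 1) \<in> carrier G" by (auto intro: refl_elt_closed)
  have "refl_elt m n i (i + 1) \<otimes>\<^bsub>G\<^esub> refl_elt m n i (i + 1) = \<one>\<^bsub>G\<^esub>"
    using \<open>i + 1 < n\<close> by (simp add: refl_elt_square)
  then show ?thesis using e_mult[OF s s] e_one by simp
qed

lemma X_e_refl:
  assumes i: "i + 1 < n"
  defines "E \<equiv> e (refl_elt m n i (i + 1))"
  shows "X i \<otimes> E = E \<otimes> X (i + 1) \<oplus> 2 \<odot> (\<Oplus>l\<in>{..<m}. e (torus_diff m n i (i + 1) l))"
proof -
  have cl: "E \<in> carrier B" "X i \<in> carrier B" "X (i + 1) \<in> carrier B" "tau i (i + 1) \<in> carrier B"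
    using i by (auto simp: E_def intro!: refl_elt_closed)
  have EE: "E \<otimes> E = \<one>" unfolding E_def by (rule e_refl_square[OF i])
  have EX: "E \<otimes> X i = (X (i + 1) \<oplus> 2 \<odot> tau i (i + 1)) \<otimes> E" unfolding E_def using e_refl_X(2)[OF i] i by simp
  have "X i \<otimes> E = (E \<otimes> E) \<otimes> X i \<otimes> E" using EE cl by simp
  also have "\<dots> = E \<otimes> (E \<otimes> X i) \<otimes> E" using cl by (simp add: B.m_assoc)
  also have "\<dots> = E \<otimes> (X (i + 1) \<oplus> 2 \<odot> tau i (i + 1)) \<otimes> (E \<otimes> E)"
    unfolding EX using cl by (simp add: B.m_assoc)
  also have "\<dots> = E \<otimes> X (i + 1) \<oplus> 2 \<odot> (E \<otimes> tau i (i + 1))"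
    unfolding EE using cl by (simp add: B.r_distr B.smult_mult_right)
  finally show ?thesis unfolding E_def e_refl_tau[OF i] .
qed

lemma torus_diff_sum_closed [simp, intro]:
  "(\<Oplus>l\<in>{..<m}. e (torus_diff m n i (i + 1) l)) \<in> carrier B"
  by (rule B.finsum_closed) (auto intro!: torus_diff_closed)

end

lemma gm1_rep_hom:
  assumes B: "gm1_rep m n B e" and C: "gm1_rep m n C e'" and \<phi>: "\<phi> \<in> alg_hom B C"
    and e: "\<And>g. g \<in> carrier (Gm1 m n) \<Longrightarrow> \<phi> (e g) = e' g"
  shows "i < n \<Longrightarrow> j < n \<Longrightarrow> i \<noteq> j \<Longrightarrow> \<phi> (gm1_rep.tau m n B e i j) = gm1_rep.tau m n C e' i j"
    and "p < n \<Longrightarrow> \<phi> (gm1_rep.X m n B e p) = gm1_rep.X m n C e' p"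
proof -
  interpret B: gm1_rep m n B e by fact
  interpret C: gm1_rep m n C e' by fact
  note sum = alg_hom_finsum[OF B.B.complex_algebra_axioms C.B.complex_algebra_axioms \<phi>]
  show tau: "\<phi> (B.tau i j) = C.tau i j" if "i < n" "j < n" "i \<noteq> j" for i j
    unfolding B.tau_def C.tau_def
    by (subst sum) (use that B.tau_elt_closed in \<open>auto simp: e intro!: C.B.add.finprod_cong'\<close>)
  show "\<phi> (B.X p) = C.X p" if "p < n"
    unfolding B.X_def C.X_def
    by (subst sum, use that in force, rule C.B.add.finprod_cong')
      (use that in \<open>simp_all add: tau alg_hom_smult[OF \<phi>] Pi_iff\<close>)
qed

section \<open>Families permuted by the group\<close>

text \<open>
  Elements \<open>Y\<^sub>i\<close> that \<open>G\<close> permutes like the basis vectors of \<open>V\<close>: the data of a homomorphism from \<open>\<complex>[G] \<rtimes> T(V)\<close>.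
\<close>

locale gm1_equivariant = gm1_rep m n B e
  for m n and B :: "(complex, 'b) module" (structure) and e +
  fixes Y :: "nat \<Rightarrow> 'b"
  assumes Y_closed [simp, intro]: "i < n \<Longrightarrow> Y i \<in> carrier B"
    and e_Y: "x \<in> carrier (Gm1 m n) \<Longrightarrow> i < n \<Longrightarrow> e x \<otimes> Y i = Y (fst x i) \<otimes> e x"
begin

lemma tau_Y:
  assumes "a < n" "b < n" "a \<noteq> b" "c < n"
  shows "tau a b \<otimes> Y c = Y (swap a b c) \<otimes> tau a b"
proof -
  have sw: "swap a b c < n" using assms by (auto simp: Transposition.transpose_def)
  have te: "e (tau_elt a b l) \<in> carrier B" for l using assms tau_elt_closed by auto
  have "tau a b \<otimes> Y c = (\<Oplus>l\<in>{..<m}. e (tau_elt a b l) \<otimes> Y c)"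
    unfolding tau_def[of a b] by (rule B.finsum_mult_left) (use assms te in auto)
  also have "\<dots> = (\<Oplus>l\<in>{..<m}. Y (swap a b c) \<otimes> e (tau_elt a b l))"
    by (rule B.add.finprod_cong') (use assms te sw tau_elt_closed in \<open>auto simp: e_Y fst_tau_elt\<close>)
  also have "\<dots> = Y (swap a b c) \<otimes> tau a b"
    unfolding tau_def[of a b] by (rule B.finsum_mult_right[symmetric]) (use te sw in auto)
  finally show ?thesis .
qed

lemma bracket_tau_Y:
  assumes "p < n" "j < n" "p \<noteq> j" "q < n" "q \<noteq> p" "q \<noteq> j"
  shows "B.bracket (tau p j) (Y q) = \<zero>"
proof -
  have "tau p j \<otimes> Y q = Y q \<otimes> tau p j" using assms tau_Y[of p j q] by (simp add: Transposition.transpose_def)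
  then show ?thesis unfolding B.bracket_def using assms by (simp add: B.r_neg a_minus_def)
qed

lemma bracket_X_Y:
  assumes pq: "p < n" "q < n" "p \<noteq> q"
  shows "B.bracket (X p) (Y q) = sgn_ij p q \<odot> B.bracket (tau p q) (Y q)"
proof -
  have "B.bracket (X p) (Y q) = (\<Oplus>j\<in>{..<n} - {p}. B.bracket (sgn_ij p j \<odot> tau p j) (Y q))"
    unfolding X_def by (rule B.bracket_finsum_left) (use pq in auto)
  also have "\<dots> = B.bracket (sgn_ij p q \<odot> tau p q) (Y q)"
    by (rule B.finsum_single) (use pq bracket_tau_Y in \<open>auto simp: B.bracket_smult\<close>)
  finally show ?thesis using pq by (simp add: B.bracket_smult)
qed

text \<open>
  Since \<open>\<tau>\<^sub>p\<^sub>j\<close> exchanges \<open>Y\<^sub>p\<close> and \<open>Y\<^sub>j\<close>, only \<open>\<tau>\<^sub>p\<^sub>q\<close> contributes to either commutator, and it occurs in \<open>X\<^sub>p\<close> and \<open>X\<^sub>q\<close>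
  with opposite signs.
\<close>

lemma bracket_X_Y_sum:
  assumes pq: "p < n" "q < n" "p \<noteq> q"
  shows "B.bracket (X p) (Y q) \<oplus> B.bracket (Y p) (X q) = \<zero>"
proof -
  have 1: "tau p q \<otimes> Y q = Y p \<otimes> tau p q" and 2: "tau p q \<otimes> Y p = Y q \<otimes> tau p q"
    using tau_Y[of p q] pq by auto
  have "B.bracket (X q) (Y p) = sgn_ij q p \<odot> B.bracket (tau p q) (Y p)"
    using bracket_X_Y[of q p] pq tau_flip[of p q] by simp
  also have "B.bracket (tau p q) (Y p) = \<ominus> B.bracket (tau p q) (Y q)"
    unfolding B.bracket_def 1 2 using pq by (simp add: a_minus_def B.minus_add B.a_comm)
  also have "sgn_ij q p \<odot> (\<ominus> B.bracket (tau p q) (Y q)) = B.bracket (X p) (Y q)"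
    using pq by (auto simp: bracket_X_Y sgn_ij_def)
  finally have "B.bracket (Y p) (X q) = \<ominus> B.bracket (X p) (Y q)"
    using B.bracket_swap[of "X q" "Y p"] pq by simp
  then show ?thesis using pq by (simp add: B.r_neg)
qed

definition shifted :: "complex \<Rightarrow> nat \<Rightarrow> 'b" where
  "shifted \<kappa> p = Y p \<ominus> \<kappa> \<odot> X p"

lemma shifted_closed [simp, intro]: "p < n \<Longrightarrow> shifted \<kappa> p \<in> carrier B"
  by (simp add: shifted_def)

text \<open>
  The mixed terms cancel by \<open>bracket_X_Y_sum\<close>, and \<open>\<kappa>\<^sup>2 [X\<^sub>p, X\<^sub>q]\<close> is minus the value of the forms by \<open>bracket_X\<close> and
  \<open>form_elt_basis\<close>.
\<close>

lemma bracket_shifted: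
  assumes pq: "p < n" "q < n"
  shows "B.bracket (shifted \<kappa> p) (shifted \<kappa> q) = B.bracket (Y p) (Y q) \<ominus> form_elt \<kappa> (unit_vec n p) (unit_vec n q)"
proof (cases "p = q")
  case True
  then show ?thesis using pq by (simp add: form_elt_self a_minus_def)
next
  case False
  note pq = pq False
  define K where "K = \<kappa> \<odot> X p" 
  define L where "L = \<kappa> \<odot> X q"
  note [simp] = pq
  have KL: "K \<in> carrier B" "L \<in> carrier B" by (auto simp: K_def L_def)
  have "B.bracket K (Y q) \<oplus> B.bracket (Y p) L = \<kappa> \<odot> (B.bracket (X p) (Y q) \<oplus> B.bracket (Y p) (X q))"
    by (simp add: K_def L_def B.bracket_smult B.smult_r_distr)
  then have cross: "B.bracket K (Y q) \<oplus> B.bracket (Y p) L = \<zero>" by (simp add: bracket_X_Y_sum)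
  have KL': "B.bracket K L = \<ominus> form_elt \<kappa> (unit_vec n p) (unit_vec n q)"
  proof -
    let ?C = "\<lambda>k. B.bracket (tau p q) (tau q k)"
    have "B.bracket K L = \<kappa>\<^sup>2 \<odot> (\<Oplus>k\<in>{..<n} - {p, q}. \<ominus> ?C k)"
      by (simp add: K_def L_def B.bracket_smult bracket_X power2_eq_square B.smult_assoc B.finsum_closed Pi_iff)
    also have "(\<Oplus>k\<in>{..<n} - {p, q}. \<ominus> ?C k) = \<ominus> (\<Oplus>k\<in>{..<n} - {p, q}. ?C k)"
      using B.finsum_smult[of ?C "{..<n} - {p, q}" "- 1"] pq by (simp add: Pi_iff B.finsum_closed cong: B.finsum_cong)
    finally show ?thesis by (simp add: form_elt_basis B.finsum_closed Pi_iff)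
  qed
  have "B.bracket (shifted \<kappa> p) (shifted \<kappa> q) =
    (B.bracket (Y p) (Y q) \<oplus> B.bracket K L) \<ominus> (B.bracket K (Y q) \<oplus> B.bracket (Y p) L)"
    unfolding shifted_def K_def[symmetric] L_def[symmetric] B.bracket_def
    using KL Y_closed[OF pq(1)] Y_closed[OF pq(2)] by algebra
  then show ?thesis unfolding cross KL' using pq by (simp add: a_minus_def)
qed

lemma e_bracket_shifted:
  assumes x: "x \<in> carrier G" and pq: "p < n" "r < n"
  shows "e x \<otimes> B.bracket (shifted \<kappa> p) (shifted \<kappa> r) =
    B.bracket (shifted \<kappa> (fst x p)) (shifted \<kappa> (fst x r)) \<otimes> e x"
proof -
  have move: "e x \<otimes> B.bracket a c = B.bracket a' c' \<otimes> e x"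
    if "e x \<otimes> a = a' \<otimes> e x" "e x \<otimes> c = c' \<otimes> e x"
      "a \<in> carrier B" "c \<in> carrier B" "a' \<in> carrier B" "c' \<in> carrier B" for a c a' c'
  proof -
    have ex: "e x \<in> carrier B" using x by simp
    have "e x \<otimes> (a \<otimes> c) = a' \<otimes> c' \<otimes> e x" "e x \<otimes> (c \<otimes> a) = c' \<otimes> a' \<otimes> e x"
      using that ex by (metis B.m_assoc)+
    then show ?thesis
      unfolding B.bracket_def using that ex
      by (simp add: a_minus_def B.r_distr B.l_distr B.r_minus B.l_minus)
  qed
  have fx: "fst x p < n" "fst x r < n" "fst x p = fst x r \<longleftrightarrow> p = r"
    using pq Gm1_fst_less[OF x] Gm1_fst_inj[OF x] by auto
  show ?thesis
  proof (cases "p = r")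
    case True
    then show ?thesis using pq fx x by simp
  next
    case False
    let ?S = "{..<n} - {p, r}" and ?S' = "{..<n} - {fst x p, fst x r}"
    have bij: "bij_betw (fst x) ?S ?S'"
    proof -
      have "bij_betw (fst x) {..<n} {..<n}" by (rule permutes_imp_bij[OF Gm1_fst_permutes[OF x]])
      moreover have "bij_betw (fst x) {p, r} {fst x p, fst x r}"
        using Gm1_fst_inj[OF x] by (auto simp: bij_betw_def inj_on_def)
      ultimately show ?thesis using pq fx by (intro bij_betw_DiffI) auto
    qed
    have "e x \<otimes> (\<Oplus>k\<in>?S. B.bracket (tau p r) (tau r k)) = (\<Oplus>k\<in>?S. e x \<otimes> B.bracket (tau p r) (tau r k))"
      by (rule B.finsum_mult_right) (use x pq False in auto)
    also have "\<dots> = (\<Oplus>k\<in>?S. B.bracket (tau (fst x p) (fst x r)) (tau (fst x r) (fst x k)) \<otimes> e x)"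
      by (rule B.add.finprod_cong')
        (use x pq False fx in \<open>auto simp: e_tau Gm1_fst_inj[OF x] Gm1_fst_less[OF x] intro!: move\<close>)
    also have "\<dots> = (\<Oplus>k\<in>?S'. B.bracket (tau (fst x p) (fst x r)) (tau (fst x r) k) \<otimes> e x)"
      by (rule B.finsum_bij[OF bij, symmetric]) (use x pq False fx in auto)
    also have "\<dots> = (\<Oplus>k\<in>?S'. B.bracket (tau (fst x p) (fst x r)) (tau (fst x r) k)) \<otimes> e x"
      by (rule B.finsum_mult_left[symmetric]) (use x pq False fx in auto)
    finally have "e x \<otimes> form_elt \<kappa> (unit_vec n p) (unit_vec n r) = form_elt \<kappa> (unit_vec n (fst x p)) (unit_vec n (fst x r)) \<otimes> e x"
      using False pq fx x by (simp add: form_elt_basis B.smult_mult_left B.smult_mult_right B.finsum_closed Pi_iff)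
    moreover have "e x \<otimes> B.bracket (Y p) (Y r) = B.bracket (Y (fst x p)) (Y (fst x r)) \<otimes> e x"
      using x pq fx e_Y by (intro move) auto
    ultimately show ?thesis
      using pq fx x by (simp add: bracket_shifted a_minus_def B.r_distr B.l_distr B.r_minus B.l_minus)
  qed
qed

definition Yvec :: "complex vec \<Rightarrow> 'b" where
  "Yvec u = (\<Oplus>i\<in>{..<n}. u $ i \<odot> Y i)"

lemma Yvec_closed [simp, intro]: "Yvec u \<in> carrier B"
  by (auto simp: Yvec_def intro!: B.finsum_closed)

lemma bracket_Yvec:
  assumes "\<And>p q. p < n \<Longrightarrow> q < n \<Longrightarrow> B.bracket (shifted \<kappa> p) (shifted \<kappa> q) = \<zero>"
    and uv: "u \<in> carrier_vec n" "v \<in> carrier_vec n"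
  shows "B.bracket (Yvec u) (Yvec v) = form_elt \<kappa> u v"
proof -
  have Y: "B.bracket (Y p) (Y q) = form_elt \<kappa> (unit_vec n p) (unit_vec n q)" if "p < n" "q < n" for p q
    by (rule B.eq_iff_minus_zero[THEN iffD2])
      (use bracket_shifted[OF that, of \<kappa>] assms(1)[OF that] that in auto)
  have "B.bracket (Yvec u) (Yvec v) = (\<Oplus>i\<in>{..<n}. B.bracket (u $ i \<odot> Y i) (Yvec v))"
    unfolding Yvec_def[of u] by (rule B.bracket_finsum_left) auto
  also have "\<dots> = (\<Oplus>i\<in>{..<n}. \<Oplus>j\<in>{..<n}. B.bracket (u $ i \<odot> Y i) (v $ j \<odot> Y j))"
    unfolding Yvec_def by (rule B.add.finprod_cong') (auto simp: B.bracket_finsum_right intro!: B.finsum_closed)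
  also have "\<dots> = (\<Oplus>i\<in>{..<n}. \<Oplus>j\<in>{..<n}. (u $ i * v $ j) \<odot> form_elt \<kappa> (unit_vec n i) (unit_vec n j))"
    by (auto simp: B.bracket_smult Y mult.commute simp flip: B.smult_assoc intro!: B.add.finprod_cong' B.finsum_closed)
  also have "\<dots> = form_elt \<kappa> u v" using form_elt_expand[OF uv] ..
  finally show ?thesis .
qed

text \<open>
  The generators \<open>z\<^sub>i\<close> of the Dunkl-Opdam subalgebra.  The factor \<open>1/2\<close> turns the jump \<open>2 \<tau>\<^bsub>i,i+1\<^esub>\<close> of \<open>X\<close> into the
  coefficient 1 of the defining relation; it is also why the forms have the factor \<open>\<kappa>\<^sup>2\<close> and not \<open>\<kappa>\<^sup>2/4\<close>.
\<close>

definition do_z :: "complex \<Rightarrow> nat \<Rightarrow> 'b" where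
  "do_z \<kappa> i = (1 / 2) \<odot> shifted \<kappa> i"

lemma do_z_closed [simp, intro]: "p < n \<Longrightarrow> do_z \<kappa> p \<in> carrier B"
  by (simp add: do_z_def)

lemma do_z_double: "i < n \<Longrightarrow> 2 \<odot> do_z \<kappa> i \<oplus> \<kappa> \<odot> X i = Y i"
  unfolding do_z_def shifted_def by (simp flip: B.smult_assoc add: a_minus_def B.a_assoc B.l_neg)

lemma do_z_commute_of_X:
  assumes "x \<in> carrier G" "i < n" "fst x i = i" "e x \<otimes> X i = X i \<otimes> e x"
  shows "do_z \<kappa> i \<otimes> e x = e x \<otimes> do_z \<kappa> i"
proof -
  have "e x \<otimes> shifted \<kappa> i = e x \<otimes> Y i \<ominus> \<kappa> \<odot> (e x \<otimes> X i)"
    unfolding shifted_def using assms(1,2) by (simp add: B.r_distr a_minus_def B.smult_mult_right B.r_minus)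
  also have "\<dots> = shifted \<kappa> i \<otimes> e x"
    unfolding shifted_def using assms by (simp add: e_Y B.l_distr a_minus_def B.smult_mult_left B.l_minus)
  finally show ?thesis using assms(1,2) by (simp add: do_z_def B.smult_mult_left B.smult_mult_right)
qed

lemma do_z_torus_gen: "i < n \<Longrightarrow> do_z \<kappa> i \<otimes> e (torus_gen m n r) = e (torus_gen m n r) \<otimes> do_z \<kappa> i"
  by (rule do_z_commute_of_X) (simp_all add: torus_gen_closed e_torus_gen_X)

lemma do_z_refl: "\<lbrakk>i + 1 < n; j < n; j \<noteq> i; j \<noteq> i + 1\<rbrakk> \<Longrightarrow>
  do_z \<kappa> j \<otimes> e (refl_elt m n i (i + 1)) = e (refl_elt m n i (i + 1)) \<otimes> do_z \<kappa> j"
  using e_refl_X(1)[of i j]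
  by (intro do_z_commute_of_X) (simp_all add: refl_elt_closed)

lemma do_z_hecke:
  assumes i: "i + 1 < n"
  shows "do_z \<kappa> i \<otimes> e (refl_elt m n i (i + 1)) = e (refl_elt m n i (i + 1)) \<otimes> do_z \<kappa> (i + 1)
    \<ominus> \<kappa> \<odot> (\<Oplus>l\<in>{..<m}. e (torus_diff m n i (i + 1) l))"
proof -
  let ?s = "refl_elt m n i (i + 1)"
  have s: "?s \<in> carrier G" using i by (simp add: refl_elt_closed)
  define E where "E = e ?s"
  define C where "C = (\<Oplus>l\<in>{..<m}. e (torus_diff m n i (i + 1) l))"
  have cl: "E \<in> carrier B" "X i \<in> carrier B" "X (i + 1) \<in> carrier B"
    "Y i \<in> carrier B" "Y (i + 1) \<in> carrier B" "C \<in> carrier B"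
    using s i by (auto simp: E_def C_def simp del: One_nat_def add_Suc_right)
  have XE: "X i \<otimes> E = E \<otimes> X (i + 1) \<oplus> 2 \<odot> C" unfolding E_def C_def by (rule X_e_refl[OF i])
  have EY: "E \<otimes> Y (i + 1) = Y i \<otimes> E" unfolding E_def using e_Y[OF s, of "i + 1"] i by simp
  have "do_z \<kappa> i \<otimes> E = (1 / 2) \<odot> (Y i \<otimes> E \<ominus> \<kappa> \<odot> (X i \<otimes> E))"
    using cl by (simp add: do_z_def shifted_def B.smult_mult_left B.l_distr a_minus_def B.l_minus)
  also have "\<dots> = (1 / 2) \<odot> (E \<otimes> Y (i + 1) \<ominus> \<kappa> \<odot> (E \<otimes> X (i + 1)) \<ominus> (2 * \<kappa>) \<odot> C)"
    unfolding XE EY using cl by (simp add: a_minus_def B.smult_r_distr B.minus_add B.a_assoc mult.commute[of \<kappa>] flip: B.smult_assoc)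
  also have "\<dots> = E \<otimes> do_z \<kappa> (i + 1) \<ominus> \<kappa> \<odot> C"
    using cl by (simp add: do_z_def shifted_def B.smult_mult_right B.r_distr a_minus_def B.r_minus B.smult_r_distr flip: B.smult_assoc)
  finally show ?thesis unfolding C_def E_def .
qed

end

text \<open>Conversely, elements satisfying the Dunkl-Opdam relations give an equivariant family.\<close>

text \<open>
  The elements of \<open>G\<close> that permute the family correctly are closed under products, so it suffices to look at the
  generators \<open>g\<^sub>r\<close> and \<open>s\<^sub>i\<close>.
\<close>

lemma (in gm1_rep) gm1_equivariant_of_do:
  fixes z :: "nat \<Rightarrow> 'b"
  assumes z_closed [simp]: "\<And>i. i < n \<Longrightarrow> z i \<in> carrier B"
    and z_torus: "\<And>i r. i < n \<Longrightarrow> r < n \<Longrightarrow> z i \<otimes> e (torus_gen m n r) = e (torus_gen m n r) \<otimes> z i"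
    and z_refl: "\<And>i j. i + 1 < n \<Longrightarrow> j < n \<Longrightarrow> j \<noteq> i \<Longrightarrow> j \<noteq> i + 1 \<Longrightarrow>
      z j \<otimes> e (refl_elt m n i (i + 1)) = e (refl_elt m n i (i + 1)) \<otimes> z j"
    and z_hecke: "\<And>i. i + 1 < n \<Longrightarrow> z i \<otimes> e (refl_elt m n i (i + 1)) =
      e (refl_elt m n i (i + 1)) \<otimes> z (i + 1) \<ominus> \<kappa> \<odot> (\<Oplus>l\<in>{..<m}. e (torus_diff m n i (i + 1) l))"
  shows "gm1_equivariant m n B e (\<lambda>i. 2 \<odot> z i \<oplus> \<kappa> \<odot> X i)"
proof
  let ?Y = "\<lambda>i. 2 \<odot> z i \<oplus> \<kappa> \<odot> X i"
  show "?Y i \<in> carrier B" if "i < n" for i using that by simp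
  have comm: "e x \<otimes> ?Y i = ?Y i \<otimes> e x" if "x \<in> carrier G" "i < n" "e x \<otimes> z i = z i \<otimes> e x" "e x \<otimes> X i = X i \<otimes> e x" for x i
    using that by (simp add: B.r_distr B.l_distr B.smult_mult_left B.smult_mult_right)
  fix x i assume x: "x \<in> carrier G" and i: "i < n"
  define P where "P x \<longleftrightarrow> (\<forall>i<n. e x \<otimes> ?Y i = ?Y (fst x i) \<otimes> e x)" for x
  have "P x"
  proof (rule Gm1_generate[OF _ _ _ _ x, of P], unfold P_def, goal_cases)
    case 1
    then show ?case by (simp add: e_one Gm1_fst_one)
  next
    case (2 x y)
    show ?case
    proof (intro allI impI)
      fix i assume i: "i < n"
      have yi: "fst y i < n" "fst x (fst y i) < n" using i 2 Gm1_fst_less by auto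
      have "e (x \<otimes>\<^bsub>G\<^esub> y) \<otimes> ?Y i = e x \<otimes> (e y \<otimes> ?Y i)" using 2 i by (simp add: e_mult B.m_assoc)
      also have "e y \<otimes> ?Y i = ?Y (fst y i) \<otimes> e y" using 2(4) i by blast
      also have "e x \<otimes> (?Y (fst y i) \<otimes> e y) = (e x \<otimes> ?Y (fst y i)) \<otimes> e y" using 2(1,2) yi by (simp add: B.m_assoc)
      also have "\<dots> = ?Y (fst x (fst y i)) \<otimes> e (x \<otimes>\<^bsub>G\<^esub> y)" using 2 i yi by (simp add: e_mult B.m_assoc)
      finally show "e (x \<otimes>\<^bsub>G\<^esub> y) \<otimes> ?Y i = ?Y (fst (x \<otimes>\<^bsub>G\<^esub> y) i) \<otimes> e (x \<otimes>\<^bsub>G\<^esub> y)"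
        by (simp add: Gm1_fst_mult)
    qed
  next
    case (3 r)
    show ?case
    proof (intro allI impI)
      fix j assume j: "j < n"
      have "fst (torus_gen m n r) j = j" by (simp add: torus_gen_def)
      then show "e (torus_gen m n r) \<otimes> ?Y j = ?Y (fst (torus_gen m n r) j) \<otimes> e (torus_gen m n r)"
        using comm[OF torus_gen_closed j] z_torus[OF j 3] e_torus_gen_X[OF j] by simp
    qed
  next
    case (4 i)
    let ?s = "refl_elt m n i (i + 1)"
    have s: "?s \<in> carrier G" using 4 by (auto intro: refl_elt_closed)
    have fs: "fst ?s = swap i (i + 1)" by (simp add: perm_elt_eq)
    define E where "E = e ?s"
    define C where "C = (\<Oplus>l\<in>{..<m}. e (torus_diff m n i (i + 1) l))"
    have cl: "E \<in> carrier B" "X i \<in> carrier B" "X (i + 1) \<in> carrier B"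
      "z i \<in> carrier B" "z (i + 1) \<in> carrier B" "C \<in> carrier B"
      using s 4 by (auto simp: E_def C_def simp del: One_nat_def add_Suc_right)
    have EE: "E \<otimes> E = \<one>" unfolding E_def by (rule e_refl_square[OF 4])
    have XE: "X i \<otimes> E = E \<otimes> X (i + 1) \<oplus> 2 \<odot> C" unfolding E_def C_def by (rule X_e_refl[OF 4])
    have zE: "z i \<otimes> E = E \<otimes> z (i + 1) \<ominus> \<kappa> \<odot> C" unfolding E_def C_def by (rule z_hecke[OF 4])
    have "?Y i \<otimes> E = 2 \<odot> (z i \<otimes> E) \<oplus> \<kappa> \<odot> (X i \<otimes> E)"
      using cl by (simp add: B.l_distr B.smult_mult_left)
    also have "\<dots> = 2 \<odot> (E \<otimes> z (i + 1)) \<oplus> \<kappa> \<odot> (E \<otimes> X (i + 1)) \<oplus> ((2 * \<kappa>) \<odot> C \<ominus> (2 * \<kappa>) \<odot> C)"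
      unfolding XE zE using cl
      by (simp add: a_minus_def B.smult_r_distr B.a_ac mult.commute[of \<kappa>] flip: B.smult_assoc)
    also have "\<dots> = E \<otimes> ?Y (i + 1)"
      using cl by (simp add: B.r_distr B.smult_mult_right B.r_neg a_minus_def)
    finally have up: "?Y i \<otimes> E = E \<otimes> ?Y (i + 1)" .
    \<comment> \<open>The other index follows by conjugating with the involution \<open>s\<^sub>i\<close>.\<close>
    have "E \<otimes> ?Y i = E \<otimes> (?Y i \<otimes> E) \<otimes> E" using cl EE by (simp add: B.m_assoc)
    also have "\<dots> = (E \<otimes> E) \<otimes> ?Y (i + 1) \<otimes> E" unfolding up using cl by (simp add: B.m_assoc)
    also have "\<dots> = ?Y (i + 1) \<otimes> E" using cl EE by simp
    finally have down: "E \<otimes> ?Y i = ?Y (i + 1) \<otimes> E" .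
    show ?case
    proof (intro allI impI)
      fix j assume j: "j < n"
      consider "j = i" | "j = i + 1" | "j \<noteq> i" "j \<noteq> i + 1" by blast
      then show "e ?s \<otimes> ?Y j = ?Y (fst ?s j) \<otimes> e ?s"
      proof cases
        case 1
        then show ?thesis using down by (simp add: E_def fs)
      next
        case 2
        then show ?thesis using up by (simp add: E_def fs)
      next
        case 3
        then have "fst ?s j = j" by (simp add: fs Transposition.transpose_def)
        then show ?thesis
          using comm[OF s j] z_refl[OF 4 j 3] e_refl_X(1)[OF 4 j 3] by simp
      qed
    qed
  qed
  then show "e x \<otimes> ?Y i = ?Y (fst x i) \<otimes> e x" using i by (simp add: P_def)
qed

section \<open>The algebra of the commutator relations\<close>

lemma tensor_algebra_simps: "tensor_algebra n = free_algebra {..<n}"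
  by (simp add: tensor_algebra_def)

lemma tensor_algebra_complex_algebra: "complex_algebra (tensor_algebra n)"
  by (simp add: tensor_algebra_simps free_algebra_complex_algebra)

lemma tensor_vec_unit: "i < n \<Longrightarrow> tensor_vec (unit_vec n i) = letter i"
  by (auto simp: tensor_vec_def letter_def fun_eq_iff split: list.splits)

lemma tensor_vec_eq:
  assumes "u \<in> carrier_vec n"
  shows "tensor_vec u = (\<Oplus>\<^bsub>tensor_algebra n\<^esub>i\<in>{..<n}. u $ i \<odot>\<^bsub>tensor_algebra n\<^esub> letter i)"
proof -
  interpret T: complex_algebra "tensor_algebra n" by (rule tensor_algebra_complex_algebra)
  have l: "letter i \<in> carrier (tensor_algebra n)" if "i < n" for i
    using that by (simp add: tensor_algebra_simps)
  have "(\<Oplus>\<^bsub>tensor_algebra n\<^esub>i\<in>{..<n}. u $ i \<odot>\<^bsub>tensor_algebra n\<^esub> letter i) =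
      (\<lambda>w. \<Sum>i<n. (u $ i \<odot>\<^bsub>tensor_algebra n\<^esub> letter i) w)"
    unfolding tensor_algebra_simps
    by (rule free_algebra_finsum) (use T.smult_closed l in \<open>auto simp: tensor_algebra_simps\<close>)
  also have "\<dots> = tensor_vec u"
  proof
    fix w
    show "(\<Sum>i<n. (u $ i \<odot>\<^bsub>tensor_algebra n\<^esub> letter i) w) = tensor_vec u w"
    proof (cases "\<exists>j. w = [j]")
      case True
      then obtain j where "w = [j]" by blast
      then show ?thesis using assms
        by (auto simp: tensor_algebra_simps free_algebra_simps letter_def tensor_vec_def if_distrib[of "\<lambda>x. _ * x"] cong: if_cong)
    next
      case False
      then show ?thesis
        by (auto simp: tensor_algebra_simps free_algebra_simps letter_def tensor_vec_def split: list.splits intro!: sum.neutral)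
    qed
  qed
  finally show ?thesis ..
qed

lemma tensor_vec_closed: "u \<in> carrier_vec n \<Longrightarrow> tensor_vec u \<in> carrier (tensor_algebra n)"
proof -
  interpret T: complex_algebra "tensor_algebra n" by (rule tensor_algebra_complex_algebra)
  have l: "letter i \<in> carrier (tensor_algebra n)" if "i < n" for i
    using that by (simp add: tensor_algebra_simps)
  show "u \<in> carrier_vec n \<Longrightarrow> ?thesis"
    by (subst tensor_vec_eq) (auto intro!: T.finsum_closed T.smult_closed l)
qed

context gm1
begin

abbreviation "T \<equiv> tensor_algebra n"
abbreviation "tact x \<equiv> tensor_act n (perm_rep n x)"

text \<open>
  In the defining sum over words \<open>u\<close> the product of matrix entries vanishes unless \<open>u\<close> is the preimage of \<open>w\<close>.
\<close>

lemma tact_apply: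
  assumes x: "x \<in> carrier G"
  shows "tact x f = (\<lambda>w. if w \<in> lists {..<n} then f (map (inv_into UNIV (fst x)) w) else 0)"
proof
  fix w
  note perm = Gm1_fst_permutes[OF x]
  show "tact x f w = (if w \<in> lists {..<n} then f (map (inv_into UNIV (fst x)) w) else 0)"
  proof (cases "w \<in> lists {..<n}")
    case True
    let ?U = "{u. length u = length w \<and> set u \<subseteq> {..<n}}"
    let ?u = "map (inv_into UNIV (fst x)) w"
    have fin: "finite ?U"
      using finite_lists_length_eq[of "{..<n}" "length w"] by (simp add: conj_commute)
    have "inv_into UNIV (fst x) i < n" if "i < n" for i
      using permutes_less[OF permutes_inv[OF perm]] that by simp
    then have u: "?u \<in> ?U" using True by auto
    have prod: "(\<Prod>k<length w. perm_rep n x $$ (w ! k, u ! k)) = (if u = ?u then 1 else 0)" if "u \<in> ?U" for u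
    proof -
      have "u ! k < n" "w ! k < n" if "k < length w" for k
        using \<open>u \<in> ?U\<close> that True by (auto simp: subset_iff)
      then have "(\<Prod>k<length w. perm_rep n x $$ (w ! k, u ! k)) = (\<Prod>k<length w. if w ! k = fst x (u ! k) then 1 else 0)"
        by (intro prod.cong) (auto simp: perm_rep_def)
      also have "\<dots> = (if \<forall>k<length w. w ! k = fst x (u ! k) then 1 else 0)"
        by (auto intro: prod.neutral)
      also have "(\<forall>k<length w. w ! k = fst x (u ! k)) \<longleftrightarrow> u = ?u"
        using \<open>u \<in> ?U\<close> by (auto simp: list_eq_iff_nth_eq permutes_inverses[OF perm])
      finally show ?thesis .
    qed
    have "tact x f w = (\<Sum>u\<in>?U. (\<Prod>k<length w. perm_rep n x $$ (w ! k, u ! k)) * f u)"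
      using True by (auto simp: tensor_act_def)
    also have "\<dots> = (\<Sum>u\<in>?U. if u = ?u then f u else 0)"
      by (rule sum.cong) (simp_all add: prod)
    also have "\<dots> = f ?u" using u fin by simp
    finally show ?thesis using True by simp
  next
    case False
    then show ?thesis by (auto simp: tensor_act_def)
  qed
qed

lemma map_fst_lists: "x \<in> carrier G \<Longrightarrow> u \<in> lists {..<n} \<Longrightarrow> map (fst x) u \<in> lists {..<n}"
  by (simp add: in_lists_conv_set Gm1_fst_less)

lemma tact_monomial:
  assumes x: "x \<in> carrier G" and u: "u \<in> lists {..<n}"
  shows "tact x (monomial c u) = monomial c (map (fst x) u)"
proof
  fix w
  note perm = Gm1_fst_permutes[OF x]
  have "map (inv_into UNIV (fst x)) w = u \<longleftrightarrow> w = map (fst x) u"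
    using permutes_inverses[OF perm] by (auto simp: map_idI)
  then show "tact x (monomial c u) w = monomial c (map (fst x) u) w"
    using map_fst_lists[OF assms]
    by (cases "w = map (fst x) u") (auto simp: tact_apply[OF x] monomial_def simp del: map_map)
qed

text \<open>
  The action agrees with the free extension of the renaming of the letters.
\<close>

lemma tact_hom:
  assumes x: "x \<in> carrier G" shows "tact x \<in> alg_hom T T"
proof -
  interpret T: complex_algebra T by (rule tensor_algebra_complex_algebra)
  let ?h = "\<lambda>i. letter (fst x i) :: nat list \<Rightarrow> complex"
  have h: "?h \<in> {..<n} \<rightarrow> carrier T"
    using Gm1_fst_less[OF x] by (auto simp: tensor_algebra_simps)
  have hom: "free_ext T ?h \<in> alg_hom T T"
    using T.free_ext_hom[OF h] by (simp add: tensor_algebra_simps)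
  have wp: "word_prod T ?h u = monomial 1 (map (fst x) u)" for u
    by (induct u) (simp_all add: tensor_algebra_simps free_algebra_simps(3) letter_eq_monomial conv_monomial)
  have eq: "tact x f = free_ext T ?h f" if "f \<in> carrier T" for f
    using that unfolding tensor_algebra_simps
  proof (induct f rule: free_algebra_induct)
    case (monomial c u)
    have "c \<odot>\<^bsub>T\<^esub> monomial 1 (map (fst x) u) = monomial c (map (fst x) u)"
      by (auto simp: tensor_algebra_simps free_algebra_simps monomial_def)
    then show ?case using monomial
      by (simp add: tact_monomial[OF x] T.free_ext_monomial[OF h, unfolded wp] flip: tensor_algebra_simps)
  next
    case (add f g)
    then have "free_ext T ?h (\<lambda>w. f w + g w) = free_ext T ?h f \<oplus>\<^bsub>T\<^esub> free_ext T ?h g"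
      by (intro T.free_ext_add[OF h])
    moreover have "tact x (\<lambda>w. f w + g w) = (\<lambda>w. tact x f w + tact x g w)"
      by (auto simp: tact_apply[OF x])
    ultimately show ?case
      using add(3,4) by (simp add: tensor_algebra_simps free_algebra_simps(5))
  qed
  show ?thesis
    by (rule alg_homI) (simp_all add: eq alg_homD[OF hom])
qed

lemma tact_semidirect: "semidirect T G tact"
proof (intro semidirect.intro semidirect_axioms.intro tensor_algebra_complex_algebra Gm1_group Gm1_finite tact_hom)
  fix t assume "t \<in> carrier T"
  then show "tact \<one>\<^bsub>G\<^esub> t = t"
    by (auto simp: tact_apply Gm1_fst_one fun_eq_iff tensor_algebra_simps free_algebra_simps)
next
  fix g h t assume gh: "g \<in> carrier G" "h \<in> carrier G" and "t \<in> carrier T"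
  have inv: "inv_into UNIV (fst g \<circ> fst h) = inv_into UNIV (fst h) \<circ> inv_into UNIV (fst g)"
    by (rule o_inv_distrib) (rule permutes_bij[OF Gm1_fst_permutes[OF gh(1)]] permutes_bij[OF Gm1_fst_permutes[OF gh(2)]])+
  show "tact (g \<otimes>\<^bsub>G\<^esub> h) t = tact g (tact h t)"
    using permutes_less[OF permutes_inv[OF Gm1_fst_permutes[OF gh(1)]]]
    by (auto simp: tact_apply gh Gm1_fst_mult inv fun_eq_iff)
qed

sublocale sd: semidirect T G tact by (rule tact_semidirect)

abbreviation "TG \<equiv> tensor_semidirect G n (perm_rep n)"

lemma TG_eq: "TG = semidirect_algebra G T tact"
  by (simp add: tensor_semidirect_def)

sublocale TG: complex_algebra TG
  unfolding TG_eq by (rule sd.S_complex_algebra)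

abbreviation "gelt \<equiv> group_elt G T"
abbreviation "vec_elt u \<equiv> alg_elt G T (tensor_vec u)"
abbreviation "var i \<equiv> alg_elt G T (letter i)"

lemma letter_T [simp, intro]: "i < n \<Longrightarrow> letter i \<in> carrier T"
  by (simp add: tensor_algebra_simps)

lemma TG_closed [simp, intro]:
  "gelt g \<in> carrier TG" "u \<in> carrier_vec n \<Longrightarrow> vec_elt u \<in> carrier TG"
  "i < n \<Longrightarrow> var i \<in> carrier TG"
  using sd.group_elt_closed sd.alg_elt_closed tensor_vec_closed by (auto simp: TG_eq)

lemma alg_elt_TG_hom: "alg_elt G T \<in> alg_hom T TG"
  unfolding TG_eq by (rule sd.alg_elt_hom)

lemma vec_elt_eq:
  assumes "u \<in> carrier_vec n"
  shows "vec_elt u = (\<Oplus>\<^bsub>TG\<^esub>i\<in>{..<n}. u $ i \<odot>\<^bsub>TG\<^esub> var i)"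
proof -
  have "vec_elt u = (\<Oplus>\<^bsub>TG\<^esub>i\<in>{..<n}. alg_elt G T (u $ i \<odot>\<^bsub>T\<^esub> letter i))"
    unfolding tensor_vec_eq[OF assms]
    by (rule alg_hom_finsum[OF sd.T.complex_algebra_axioms TG.complex_algebra_axioms alg_elt_TG_hom]) auto
  also have "\<dots> = (\<Oplus>\<^bsub>TG\<^esub>i\<in>{..<n}. u $ i \<odot>\<^bsub>TG\<^esub> var i)"
    by (rule TG.add.finprod_cong') (auto simp: alg_hom_smult[OF alg_elt_TG_hom])
  finally show ?thesis .
qed

lemma gelt_mult: "g \<in> carrier G \<Longrightarrow> h \<in> carrier G \<Longrightarrow> gelt (g \<otimes>\<^bsub>G\<^esub> h) = gelt g \<otimes>\<^bsub>TG\<^esub> gelt h"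
  unfolding TG_eq by (rule sd.group_elt_mult)

lemma gelt_one: "gelt \<one>\<^bsub>G\<^esub> = \<one>\<^bsub>TG\<^esub>"
  unfolding TG_eq by (rule sd.group_elt_one)

lemma gelt_var:
  assumes "g \<in> carrier G" "i < n"
  shows "gelt g \<otimes>\<^bsub>TG\<^esub> var i = var (fst g i) \<otimes>\<^bsub>TG\<^esub> gelt g"
  using sd.group_elt_alg_elt[of g "letter i"] tact_monomial[of g "[i]" 1] assms
  by (simp add: TG_eq letter_eq_monomial[symmetric])

lemma TG_hom_unique:
  assumes B: "complex_algebra B" and \<phi>: "\<phi> \<in> alg_hom TG B" and \<psi>: "\<psi> \<in> alg_hom TG B"
    and v: "\<And>i. i < n \<Longrightarrow> \<phi> (var i) = \<psi> (var i)"
    and g: "\<And>g. g \<in> carrier G \<Longrightarrow> \<phi> (gelt g) = \<psi> (gelt g)"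
    and f: "f \<in> carrier TG"
  shows "\<phi> f = \<psi> f"
proof (rule sd.S_hom_unique[OF \<phi>[unfolded TG_eq] \<psi>[unfolded TG_eq] _ g f[unfolded TG_eq]])
  fix t assume "t \<in> carrier T"
  then have "t \<in> carrier (free_algebra {..<n})" by (simp add: tensor_algebra_simps)
  then show "\<phi> (alg_elt G T t) = \<psi> (alg_elt G T t)"
    using free_algebra_hom_unique[OF B alg_hom_comp[OF alg_elt_TG_hom \<phi>, unfolded tensor_algebra_simps]
        alg_hom_comp[OF alg_elt_TG_hom \<psi>, unfolded tensor_algebra_simps], of t] v
    by (simp add: tensor_algebra_simps)
qed

end

locale gm1_kappa = gm1 m n for m n :: nat + fixes \<kappa> :: complex
begin

abbreviation "b \<equiv> do_form m n \<kappa>"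
abbreviation "I \<equiv> commutator_ideal G n (perm_rep n) b"
abbreviation "H \<equiv> commutator_algebra G n (perm_rep n) b"
abbreviation "q \<equiv> quot_class G n (perm_rep n) b"

definition comm_rel :: "complex vec \<Rightarrow> complex vec \<Rightarrow> gm1 \<Rightarrow> nat list \<Rightarrow> complex" where
  "comm_rel u v = (vec_elt u \<otimes>\<^bsub>TG\<^esub> vec_elt v \<ominus>\<^bsub>TG\<^esub> vec_elt v \<otimes>\<^bsub>TG\<^esub> vec_elt u) \<ominus>\<^bsub>TG\<^esub>
           (\<Oplus>\<^bsub>TG\<^esub>g\<in>carrier G. b g u v \<odot>\<^bsub>TG\<^esub> gelt g)"

lemma I_eq: "I = Idl\<^bsub>TG\<^esub> {comm_rel u v | u v. u \<in> carrier_vec n \<and> v \<in> carrier_vec n}"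
  by (simp add: commutator_ideal_def comm_rel_def Let_def)

lemma comm_rel_closed [simp, intro]: "u \<in> carrier_vec n \<Longrightarrow> v \<in> carrier_vec n \<Longrightarrow> comm_rel u v \<in> carrier TG"
  unfolding comm_rel_def by (auto intro!: TG.finsum_closed)

lemma comm_rels_subset: "{comm_rel u v | u v. u \<in> carrier_vec n \<and> v \<in> carrier_vec n} \<subseteq> carrier TG"
  by auto

lemma I_ideal: "ideal I TG"
  unfolding I_eq by (rule TG.genideal_ideal[OF comm_rels_subset])

lemma H_eq: "H = quot_algebra TG I"
  by (simp add: commutator_algebra_def)

lemma q_eq: "q a = I +>\<^bsub>TG\<^esub> a"
  by (simp add: quot_class_def)

sublocale H: complex_algebra H
  unfolding H_eq by (rule TG.quot_algebra_complex_algebra[OF I_ideal])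

lemma q_hom: "q \<in> alg_hom TG H"
  using TG.quot_proj_hom[OF I_ideal] by (simp add: H_eq q_eq[abs_def])

lemmas q_minus = alg_hom_minus[OF TG.complex_algebra_axioms H.complex_algebra_axioms q_hom]
  and q_finsum = alg_hom_finsum[OF TG.complex_algebra_axioms H.complex_algebra_axioms q_hom]
  and q_zero = alg_hom_zero[OF TG.complex_algebra_axioms H.complex_algebra_axioms q_hom]

lemma q_surj: "q ` carrier TG = carrier H"
  by (simp add: H_eq TG.quot_algebra_simps[OF I_ideal] q_eq[abs_def])

lemma q_eq_iff: "x \<in> carrier TG \<Longrightarrow> y \<in> carrier TG \<Longrightarrow> q x = q y \<longleftrightarrow> x \<ominus>\<^bsub>TG\<^esub> y \<in> I"
  unfolding q_eq by (rule TG.quot_algebra_eq_iff[OF I_ideal])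

lemma q_closed [simp, intro]: "x \<in> carrier TG \<Longrightarrow> q x \<in> carrier H"
  by (rule alg_hom_closed[OF q_hom])

lemma q_zero_iff: "x \<in> carrier TG \<Longrightarrow> q x = \<zero>\<^bsub>H\<^esub> \<longleftrightarrow> x \<in> I"
  using q_eq_iff[of x "\<zero>\<^bsub>TG\<^esub>"] q_zero
  by (simp add: a_minus_def)

sublocale H: gm1_equivariant m n H "\<lambda>g. q (gelt g)" "\<lambda>i. q (var i)"
proof
  fix x i assume x: "x \<in> carrier G" and i: "i < n"
  then have "fst x i < n" using Gm1_fst_less by simp
  then show "q (gelt x) \<otimes>\<^bsub>H\<^esub> q (var i) = q (var (fst x i)) \<otimes>\<^bsub>H\<^esub> q (gelt x)"
    using gelt_var[OF x i] i by (simp flip: alg_hom_mult[OF q_hom])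
qed (auto simp: gelt_one gelt_mult alg_hom_one[OF q_hom] alg_hom_mult[OF q_hom])

lemma H_form_elt: "H.form_elt \<kappa> u v = q (\<Oplus>\<^bsub>TG\<^esub>g\<in>carrier G. b g u v \<odot>\<^bsub>TG\<^esub> gelt g)"
  unfolding H.form_elt_def
  by (subst q_finsum)
    (auto simp: alg_hom_smult[OF q_hom] intro!: H.add.finprod_cong')

lemma H_bracket_shifted:
  assumes pq: "p < n" "r < n"
  shows "H.bracket (H.shifted \<kappa> p) (H.shifted \<kappa> r) = \<zero>\<^bsub>H\<^esub>"
proof -
  let ?u = "unit_vec n p :: complex vec" and ?v = "unit_vec n r :: complex vec"
  have "comm_rel ?u ?v \<in> I"
    unfolding I_eq using unit_vec_carrier
    by (intro TG.genideal_self[OF comm_rels_subset, THEN subsetD]) blast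
  then have "q (comm_rel ?u ?v) = \<zero>\<^bsub>H\<^esub>" by (subst q_zero_iff) auto
  then have "\<zero>\<^bsub>H\<^esub> = q (comm_rel ?u ?v)" ..
  also have "\<dots> = H.bracket (q (vec_elt ?u)) (q (vec_elt ?v)) \<ominus>\<^bsub>H\<^esub> H.form_elt \<kappa> ?u ?v"
    unfolding comm_rel_def H.bracket_def H_form_elt
    by (simp add: q_minus alg_hom_mult[OF q_hom] TG.finsum_closed Pi_iff)
  also have "\<dots> = H.bracket (H.shifted \<kappa> p) (H.shifted \<kappa> r)"
    using pq by (simp add: H.bracket_shifted tensor_vec_unit)
  finally show ?thesis ..
qed

text \<open>
  The universal property of the algebra of commutator relations, with the relations in the form of
  \<open>bracket_shifted\<close>: the shifted elements have to commute.
\<close>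

lemma TG_lift:
  assumes B: "gm1_equivariant m n B e Y"
    and comm: "\<And>p r. p < n \<Longrightarrow> r < n \<Longrightarrow>
      complex_algebra.bracket B (gm1_equivariant.shifted m n B e Y \<kappa> p) (gm1_equivariant.shifted m n B e Y \<kappa> r) = \<zero>\<^bsub>B\<^esub>"
  defines "\<Theta> \<equiv> sd.sd_ext B (free_ext B Y) e"
  shows "\<Theta> \<in> alg_hom TG B" "\<And>i. i < n \<Longrightarrow> \<Theta> (var i) = Y i" "\<And>g. g \<in> carrier G \<Longrightarrow> \<Theta> (gelt g) = e g"
    "\<And>a. a \<in> I \<Longrightarrow> \<Theta> a = \<zero>\<^bsub>B\<^esub>"
proof -
  interpret B: gm1_equivariant m n B e Y by fact
  have Y: "Y \<in> {..<n} \<rightarrow> carrier B" by auto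
  have hom: "free_ext B Y \<in> alg_hom T B"
    using B.B.free_ext_hom[OF Y] by (simp add: tensor_algebra_simps)
  note wp = B.B.word_prod_closed[OF Y]
  have cross: "e g \<otimes>\<^bsub>B\<^esub> free_ext B Y t = free_ext B Y (tact g t) \<otimes>\<^bsub>B\<^esub> e g"
    if g: "g \<in> carrier G" and t: "t \<in> carrier T" for g t
    using t unfolding tensor_algebra_simps
  proof (induct t rule: free_algebra_induct)
    case (monomial c u)
    have gu: "map (fst g) u \<in> lists {..<n}" using map_fst_lists[OF g monomial] .
    have "e g \<otimes>\<^bsub>B\<^esub> word_prod B Y u = word_prod B Y (map (fst g) u) \<otimes>\<^bsub>B\<^esub> e g"
      using monomial
    proof (induct u)
      case (Cons i u)
      then have i: "i < n" "u \<in> lists {..<n}" "fst g i < n" using Gm1_fst_less[OF g] by auto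
      have gu: "map (fst g) u \<in> lists {..<n}" using map_fst_lists[OF g i(2)] .
      have "e g \<otimes>\<^bsub>B\<^esub> word_prod B Y (i # u) = (e g \<otimes>\<^bsub>B\<^esub> Y i) \<otimes>\<^bsub>B\<^esub> word_prod B Y u"
        using i g wp by (simp add: B.B.m_assoc)
      also have "\<dots> = Y (fst g i) \<otimes>\<^bsub>B\<^esub> (e g \<otimes>\<^bsub>B\<^esub> word_prod B Y u)"
        using i g wp by (simp add: B.B.m_assoc B.e_Y)
      also have "\<dots> = word_prod B Y (map (fst g) (i # u)) \<otimes>\<^bsub>B\<^esub> e g"
        using i g wp[OF gu] Cons by (simp add: B.B.m_assoc)
      finally show ?case .
    qed (use g in simp)
    then show ?case
      using monomial gu g wp[OF gu] wp[OF monomial] by (simp add: tact_monomial B.B.free_ext_monomial[OF Y] B.B.smult_mult_left B.B.smult_mult_right)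
  next
    case (add f h)
    then have fh: "tact g f \<in> carrier T" "tact g h \<in> carrier T" "f \<in> carrier T" "h \<in> carrier T"
      using alg_hom_closed[OF tact_hom[OF g]] by (auto simp: tensor_algebra_simps)
    have "free_ext B Y (tact g (f \<oplus>\<^bsub>T\<^esub> h)) = free_ext B Y (tact g f) \<oplus>\<^bsub>B\<^esub> free_ext B Y (tact g h)"
      using fh alg_hom_add[OF tact_hom[OF g]] alg_hom_add[OF hom] by simp
    moreover have "free_ext B Y (f \<oplus>\<^bsub>T\<^esub> h) = free_ext B Y f \<oplus>\<^bsub>B\<^esub> free_ext B Y h"
      using fh alg_hom_add[OF hom] by simp
    moreover have "f \<oplus>\<^bsub>T\<^esub> h = (\<lambda>w. f w + h w)" by (simp add: tensor_algebra_simps free_algebra_simps)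
    ultimately show ?case
      using add fh g alg_hom_closed[OF hom] by (simp add: B.B.r_distr B.B.l_distr)
  qed
  note ext = hom B.e_closed B.e_one B.e_mult cross
  show \<Theta>: "\<Theta> \<in> alg_hom TG B"
    unfolding \<Theta>_def TG_eq by (rule sd.sd_ext_hom[OF B.B.complex_algebra_axioms]) (use ext in auto)
  have mon: "\<Theta> (mon_elt G T g t) = free_ext B Y t \<otimes>\<^bsub>B\<^esub> e g" if "g \<in> carrier G" "t \<in> carrier T" for g t
    unfolding \<Theta>_def by (rule sd.sd_ext_mon[OF B.B.complex_algebra_axioms]) (use ext that in auto)
  show \<Theta>v: "\<Theta> (var i) = Y i" if "i < n" for i
    unfolding alg_elt_eq_mon using that B.B.free_ext_letter[OF Y, of i] by (subst mon) (auto simp: B.e_one)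
  show \<Theta>g: "\<Theta> (gelt g) = e g" if "g \<in> carrier G" for g
    unfolding group_elt_eq_mon using that alg_hom_one[OF hom] by (subst mon) auto
  have vec: "\<Theta> (vec_elt u) = B.Yvec u" if "u \<in> carrier_vec n" for u
    unfolding vec_elt_eq[OF that] B.Yvec_def
    by (subst alg_hom_finsum[OF TG.complex_algebra_axioms B.B.complex_algebra_axioms \<Theta>])
      (auto simp: alg_hom_smult[OF \<Theta>] \<Theta>v intro!: B.B.add.finprod_cong')
  have form: "\<Theta> (\<Oplus>\<^bsub>TG\<^esub>g\<in>carrier G. b g u v \<odot>\<^bsub>TG\<^esub> gelt g) = B.form_elt \<kappa> u v" for u v
    unfolding B.form_elt_def
    by (subst alg_hom_finsum[OF TG.complex_algebra_axioms B.B.complex_algebra_axioms \<Theta>])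
      (auto simp: alg_hom_smult[OF \<Theta>] \<Theta>g intro!: B.B.add.finprod_cong')
  have rel: "\<Theta> (comm_rel u v) = \<zero>\<^bsub>B\<^esub>" if uv: "u \<in> carrier_vec n" "v \<in> carrier_vec n" for u v
  proof -
    note hom' = alg_hom_minus[OF TG.complex_algebra_axioms B.B.complex_algebra_axioms \<Theta>]
    have "\<Theta> (comm_rel u v) = B.B.bracket (B.Yvec u) (B.Yvec v) \<ominus>\<^bsub>B\<^esub> B.form_elt \<kappa> u v"
      unfolding comm_rel_def B.B.bracket_def form[symmetric]
      using uv by (simp add: hom' alg_hom_mult[OF \<Theta>] TG.finsum_closed Pi_iff vec)
    also have "B.B.bracket (B.Yvec u) (B.Yvec v) = B.form_elt \<kappa> u v"
      by (rule B.bracket_Yvec) (use comm uv in auto)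
    finally show ?thesis by (simp add: a_minus_def B.B.r_neg)
  qed
  show "\<Theta> a = \<zero>\<^bsub>B\<^esub>" if "a \<in> I" for a
    using alg_hom_kills_genideal[OF TG.complex_algebra_axioms B.B.complex_algebra_axioms \<Theta> comm_rels_subset, of a]
      rel that unfolding I_eq by auto
qed

end

section \<open>The isomorphism with the Dunkl-Opdam subalgebra\<close>

context gm1_kappa
begin

abbreviation "L \<equiv> Grp ` carrier G \<union> Z ` {..<n}"
abbreviation "F \<equiv> do_free m n"
abbreviation "J \<equiv> Idl\<^bsub>F\<^esub> (do_relations m n \<kappa>)"
abbreviation "D \<equiv> H_DO m n \<kappa>"
abbreviation "lg g \<equiv> letter (Grp g) :: do_gen list \<Rightarrow> complex"
abbreviation "lz i \<equiv> letter (Z i) :: do_gen list \<Rightarrow> complex"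

lemma F_eq: "F = free_algebra L"
  by (simp add: do_free_def)

sublocale F: complex_algebra F
  unfolding F_eq by (rule free_algebra_complex_algebra)

lemma letters_closed [simp, intro]:
  "g \<in> carrier G \<Longrightarrow> lg g \<in> carrier F" "i < n \<Longrightarrow> lz i \<in> carrier F"
  by (auto simp: F_eq intro!: letter_closed)

lemma do_relations_eq: "do_relations m n \<kappa> =
  {lg x \<otimes>\<^bsub>F\<^esub> lg y \<ominus>\<^bsub>F\<^esub> lg (x \<otimes>\<^bsub>G\<^esub> y) | x y. x \<in> carrier G \<and> y \<in> carrier G}
  \<union> {lg \<one>\<^bsub>G\<^esub> \<ominus>\<^bsub>F\<^esub> \<one>\<^bsub>F\<^esub>}
  \<union> {F.bracket (lz i) (lz j) | i j. i < n \<and> j < n}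
  \<union> {F.bracket (lz i) (lg (torus_gen m n r)) | i r. i < n \<and> r < n}
  \<union> {F.bracket (lz j) (lg (refl_elt m n i (i + 1))) | i j. i + 1 < n \<and> j < n \<and> j \<noteq> i \<and> j \<noteq> i + 1}
  \<union> {lz i \<otimes>\<^bsub>F\<^esub> lg (refl_elt m n i (i + 1)) \<ominus>\<^bsub>F\<^esub> (lg (refl_elt m n i (i + 1)) \<otimes>\<^bsub>F\<^esub> lz (i + 1) \<ominus>\<^bsub>F\<^esub>
        \<kappa> \<odot>\<^bsub>F\<^esub> (\<Oplus>\<^bsub>F\<^esub>l\<in>{..<m}. lg (torus_diff m n i (i + 1) l))) | i. i + 1 < n}"
  unfolding do_relations_def Let_def F.bracket_def ..

lemma hecke_sum_closed: "(\<Oplus>\<^bsub>F\<^esub>l\<in>{..<m}. lg (torus_diff m n i (i + 1) l)) \<in> carrier F"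
  by (rule F.finsum_closed) (auto intro!: torus_diff_closed)

lemma do_relations_subset: "do_relations m n \<kappa> \<subseteq> carrier F"
  unfolding do_relations_eq
  using hecke_sum_closed
  by (auto intro!: F.minus_closed F.m_closed F.bracket_closed F.smult_closed letters_closed Gm1_mult_closed
      torus_gen_closed refl_elt_closed)

lemma do_rel_cases:
  assumes "a \<in> do_relations m n \<kappa>"
  obtains
    (mult) x y where "x \<in> carrier G" "y \<in> carrier G" "a = lg x \<otimes>\<^bsub>F\<^esub> lg y \<ominus>\<^bsub>F\<^esub> lg (x \<otimes>\<^bsub>G\<^esub> y)"
  | (one) "a = lg \<one>\<^bsub>G\<^esub> \<ominus>\<^bsub>F\<^esub> \<one>\<^bsub>F\<^esub>"
  | (zz) i j where "i < n" "j < n" "a = F.bracket (lz i) (lz j)"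
  | (torus) i r where "i < n" "r < n" "a = F.bracket (lz i) (lg (torus_gen m n r))"
  | (refl) i j where "i + 1 < n" "j < n" "j \<noteq> i" "j \<noteq> i + 1" "a = F.bracket (lz j) (lg (refl_elt m n i (i + 1)))"
  | (hecke) i where "i + 1 < n" "a = lz i \<otimes>\<^bsub>F\<^esub> lg (refl_elt m n i (i + 1)) \<ominus>\<^bsub>F\<^esub>
      (lg (refl_elt m n i (i + 1)) \<otimes>\<^bsub>F\<^esub> lz (i + 1) \<ominus>\<^bsub>F\<^esub>
        \<kappa> \<odot>\<^bsub>F\<^esub> (\<Oplus>\<^bsub>F\<^esub>l\<in>{..<m}. lg (torus_diff m n i (i + 1) l)))"
  using assms unfolding do_relations_eq by blast

lemma J_ideal: "ideal J F"
  by (rule F.genideal_ideal[OF do_relations_subset])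

lemma D_eq: "D = quot_algebra F J"
  by (simp add: H_DO_def)

sublocale D: complex_algebra D
  unfolding D_eq by (rule F.quot_algebra_complex_algebra[OF J_ideal])

definition proj :: "(do_gen list \<Rightarrow> complex) \<Rightarrow> (do_gen list \<Rightarrow> complex) set" where
  "proj a = J +>\<^bsub>F\<^esub> a"

lemma proj_hom: "proj \<in> alg_hom F D"
  using F.quot_proj_hom[OF J_ideal] by (simp add: D_eq proj_def[abs_def])

lemma proj_surj: "proj ` carrier F = carrier D"
  by (simp add: D_eq F.quot_algebra_simps[OF J_ideal] proj_def[abs_def])

lemma proj_closed [simp, intro]: "a \<in> carrier F \<Longrightarrow> proj a \<in> carrier D"
  by (rule alg_hom_closed[OF proj_hom])

lemma proj_rel: "a \<in> do_relations m n \<kappa> \<Longrightarrow> proj a = \<zero>\<^bsub>D\<^esub>"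
proof -
  assume "a \<in> do_relations m n \<kappa>"
  then have "a \<in> J" "a \<in> carrier F"
    using F.genideal_self[OF do_relations_subset] do_relations_subset by auto
  then have "proj a = proj \<zero>\<^bsub>F\<^esub>"
    unfolding proj_def by (subst F.quot_algebra_eq_iff[OF J_ideal]) (auto simp: a_minus_def)
  then show ?thesis
    by (simp add: alg_hom_zero[OF F.complex_algebra_axioms D.complex_algebra_axioms proj_hom])
qed

lemma proj_eq:
  assumes "a \<ominus>\<^bsub>F\<^esub> c \<in> do_relations m n \<kappa>" "a \<in> carrier F" "c \<in> carrier F"
  shows "proj a = proj c"
  using proj_rel[OF assms(1)] assms(2,3)
  by (simp add: alg_hom_minus[OF F.complex_algebra_axioms D.complex_algebra_axioms proj_hom] D.eq_iff_minus_zero)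

sublocale Dg: gm1_rep m n D "\<lambda>g. proj (lg g)"
proof
  show "proj (lg \<one>\<^bsub>G\<^esub>) = \<one>\<^bsub>D\<^esub>"
    unfolding alg_hom_one[OF proj_hom, symmetric]
    by (rule proj_eq) (use G.one_closed in \<open>simp_all add: do_relations_eq\<close>)
  fix x y assume xy: "x \<in> carrier G" "y \<in> carrier G"
  have "lg x \<otimes>\<^bsub>F\<^esub> lg y \<ominus>\<^bsub>F\<^esub> lg (x \<otimes>\<^bsub>G\<^esub> y) \<in> do_relations m n \<kappa>"
    unfolding do_relations_eq using xy by blast
  then show "proj (lg (x \<otimes>\<^bsub>G\<^esub> y)) = proj (lg x) \<otimes>\<^bsub>D\<^esub> proj (lg y)"
    unfolding alg_hom_mult[OF proj_hom letters_closed(1) letters_closed(1), OF xy, symmetric]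
    using xy by (intro proj_eq[symmetric]) auto
qed auto

lemma proj_bracket_zero:
  assumes "F.bracket a c \<in> do_relations m n \<kappa>" "a \<in> carrier F" "c \<in> carrier F"
  shows "proj a \<otimes>\<^bsub>D\<^esub> proj c = proj c \<otimes>\<^bsub>D\<^esub> proj a"
  using proj_eq[OF assms(1)[unfolded F.bracket_def]] assms(2,3) by (simp add: alg_hom_mult[OF proj_hom])

definition DY :: "nat \<Rightarrow> (do_gen list \<Rightarrow> complex) set" where
  "DY i = 2 \<odot>\<^bsub>D\<^esub> proj (lz i) \<oplus>\<^bsub>D\<^esub> \<kappa> \<odot>\<^bsub>D\<^esub> Dg.X i"

sublocale DY: gm1_equivariant m n D "\<lambda>g. proj (lg g)" DY
  unfolding DY_def
proof (rule Dg.gm1_equivariant_of_do)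
  show "proj (lz i) \<otimes>\<^bsub>D\<^esub> proj (lg (torus_gen m n r)) = proj (lg (torus_gen m n r)) \<otimes>\<^bsub>D\<^esub> proj (lz i)"
    if "i < n" "r < n" for i r
  proof (rule proj_bracket_zero)
    show "F.bracket (lz i) (lg (torus_gen m n r)) \<in> do_relations m n \<kappa>"
      unfolding do_relations_eq using that by blast
  qed (use that torus_gen_closed in auto)
  show "proj (lz j) \<otimes>\<^bsub>D\<^esub> proj (lg (refl_elt m n i (i + 1))) = proj (lg (refl_elt m n i (i + 1))) \<otimes>\<^bsub>D\<^esub> proj (lz j)"
    if "i + 1 < n" "j < n" "j \<noteq> i" "j \<noteq> i + 1" for i j
  proof (rule proj_bracket_zero)
    show "F.bracket (lz j) (lg (refl_elt m n i (i + 1))) \<in> do_relations m n \<kappa>"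
      unfolding do_relations_eq using that by blast
  qed (use that in \<open>auto intro!: letters_closed refl_elt_closed\<close>)
  show "proj (lz i) \<otimes>\<^bsub>D\<^esub> proj (lg (refl_elt m n i (i + 1))) =
      proj (lg (refl_elt m n i (i + 1))) \<otimes>\<^bsub>D\<^esub> proj (lz (i + 1)) \<ominus>\<^bsub>D\<^esub>
      \<kappa> \<odot>\<^bsub>D\<^esub> (\<Oplus>\<^bsub>D\<^esub>l\<in>{..<m}. proj (lg (torus_diff m n i (i + 1) l)))" if i: "i + 1 < n" for i
  proof -
    let ?s = "refl_elt m n i (i + 1)" and ?C = "\<Oplus>\<^bsub>F\<^esub>l\<in>{..<m}. lg (torus_diff m n i (i + 1) l)"
    have s: "lg ?s \<in> carrier F" "lz i \<in> carrier F" "lz (i + 1) \<in> carrier F" using i by (auto intro!: refl_elt_closed)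
    have C: "proj ?C = (\<Oplus>\<^bsub>D\<^esub>l\<in>{..<m}. proj (lg (torus_diff m n i (i + 1) l)))"
      by (rule alg_hom_finsum[OF F.complex_algebra_axioms D.complex_algebra_axioms proj_hom])
        (auto intro!: torus_diff_closed)
    have "proj (lz i \<otimes>\<^bsub>F\<^esub> lg ?s) = proj (lg ?s \<otimes>\<^bsub>F\<^esub> lz (i + 1) \<ominus>\<^bsub>F\<^esub> \<kappa> \<odot>\<^bsub>F\<^esub> ?C)"
    proof (rule proj_eq)
      show "lz i \<otimes>\<^bsub>F\<^esub> lg ?s \<ominus>\<^bsub>F\<^esub> (lg ?s \<otimes>\<^bsub>F\<^esub> lz (i + 1) \<ominus>\<^bsub>F\<^esub> \<kappa> \<odot>\<^bsub>F\<^esub> ?C) \<in> do_relations m n \<kappa>"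
        unfolding do_relations_eq using i by blast
    qed (use s hecke_sum_closed in auto)
    then show ?thesis
      unfolding C[symmetric] using s hecke_sum_closed
      by (simp add: alg_hom_mult[OF proj_hom] alg_hom_smult[OF proj_hom]
          alg_hom_minus[OF F.complex_algebra_axioms D.complex_algebra_axioms proj_hom])
  qed
qed auto

lemma D_shifted: "i < n \<Longrightarrow> DY.shifted \<kappa> i = 2 \<odot>\<^bsub>D\<^esub> proj (lz i)"
  unfolding DY.shifted_def DY_def by (simp add: a_minus_def D.a_assoc D.r_neg)

lemma D_bracket_shifted:
  assumes "p < n" "r < n"
  shows "D.bracket (DY.shifted \<kappa> p) (DY.shifted \<kappa> r) = \<zero>\<^bsub>D\<^esub>"
proof -
  have "proj (lz p) \<otimes>\<^bsub>D\<^esub> proj (lz r) = proj (lz r) \<otimes>\<^bsub>D\<^esub> proj (lz p)"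
  proof (rule proj_bracket_zero)
    show "F.bracket (lz p) (lz r) \<in> do_relations m n \<kappa>"
      unfolding do_relations_eq using assms by blast
  qed (use assms in auto)
  then have "D.bracket (proj (lz p)) (proj (lz r)) = \<zero>\<^bsub>D\<^esub>"
    using assms by (simp add: D.bracket_def a_minus_def D.r_neg)
  then show ?thesis using assms by (simp add: D_shifted D.bracket_smult)
qed

definition psi_gen :: "do_gen \<Rightarrow> (gm1 \<Rightarrow> nat list \<Rightarrow> complex) set" where
  "psi_gen x = (case x of Grp g \<Rightarrow> q (gelt g) | Z i \<Rightarrow> H.do_z \<kappa> i)"

definition psi :: "(do_gen list \<Rightarrow> complex) \<Rightarrow> (gm1 \<Rightarrow> nat list \<Rightarrow> complex) set" where
  "psi = free_ext H psi_gen"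

lemma psi_gen_closed: "psi_gen \<in> L \<rightarrow> carrier H"
  by (auto simp: psi_gen_def)

lemma psi_hom: "psi \<in> alg_hom F H"
  unfolding psi_def F_eq by (rule H.free_ext_hom[OF psi_gen_closed])

lemma psi_letters: "g \<in> carrier G \<Longrightarrow> psi (lg g) = q (gelt g)" "i < n \<Longrightarrow> psi (lz i) = H.do_z \<kappa> i"
  using H.free_ext_letter[OF psi_gen_closed, of "Grp g"] H.free_ext_letter[OF psi_gen_closed, of "Z i"]
  by (simp_all add: psi_def psi_gen_def)

lemma H_do_z_commute:
  assumes "i < n" "j < n" shows "H.bracket (H.do_z \<kappa> i) (H.do_z \<kappa> j) = \<zero>\<^bsub>H\<^esub>"
  using assms by (simp add: H.do_z_def H.bracket_smult H_bracket_shifted)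

lemma psi_rel:
  assumes "a \<in> do_relations m n \<kappa>"
  shows "psi a = \<zero>\<^bsub>H\<^esub>"
proof -
  note minus = alg_hom_minus[OF F.complex_algebra_axioms H.complex_algebra_axioms psi_hom]
  note mult = alg_hom_mult[OF psi_hom]
  have br: "psi (F.bracket a c) = H.bracket (psi a) (psi c)" if "a \<in> carrier F" "c \<in> carrier F" for a c
    unfolding F.bracket_def H.bracket_def using that by (simp add: minus mult)
  have comm: "H.bracket x y = \<zero>\<^bsub>H\<^esub>" if "x \<otimes>\<^bsub>H\<^esub> y = y \<otimes>\<^bsub>H\<^esub> x" "x \<in> carrier H" "y \<in> carrier H" for x y
    unfolding H.bracket_def using that by (simp add: a_minus_def H.r_neg)
  from assms show ?thesis
  proof (cases rule: do_rel_cases)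
    case (mult x y)
    then have "psi a = q (gelt x) \<otimes>\<^bsub>H\<^esub> q (gelt y) \<ominus>\<^bsub>H\<^esub> q (gelt x) \<otimes>\<^bsub>H\<^esub> q (gelt y)"
      by (simp add: minus alg_hom_mult[OF psi_hom] psi_letters H.e_mult)
    then show ?thesis using mult by (simp add: a_minus_def H.r_neg)
  next
    case one
    then have "psi a = \<one>\<^bsub>H\<^esub> \<ominus>\<^bsub>H\<^esub> \<one>\<^bsub>H\<^esub>"
      by (simp add: minus psi_letters H.e_one alg_hom_one[OF psi_hom])
    then show ?thesis by (simp add: a_minus_def H.r_neg)
  next
    case (zz i j)
    then show ?thesis by (simp add: br psi_letters H_do_z_commute)
  next
    case (torus i r)
    then show ?thesis
      using H.do_z_torus_gen[of i \<kappa> r] by (simp add: br psi_letters torus_gen_closed comm)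
  next
    case (refl i j)
    then have "refl_elt m n i (i + 1) \<in> carrier G" by (auto intro: refl_elt_closed)
    then show ?thesis
      using refl H.do_z_refl[of i j \<kappa>] by (simp add: br psi_letters comm)
  next
    case (hecke i)
    let ?s = "refl_elt m n i (i + 1)" and ?C = "\<Oplus>\<^bsub>F\<^esub>l\<in>{..<m}. lg (torus_diff m n i (i + 1) l)"
    have s: "?s \<in> carrier G" using hecke by (auto intro!: refl_elt_closed)
    have C: "psi ?C = (\<Oplus>\<^bsub>H\<^esub>l\<in>{..<m}. q (gelt (torus_diff m n i (i + 1) l)))"
      by (subst alg_hom_finsum[OF F.complex_algebra_axioms H.complex_algebra_axioms psi_hom], force intro: torus_diff_closed)
        (rule H.add.finprod_cong', simp_all add: torus_diff_closed psi_letters)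
    have "psi a = psi (lz i) \<otimes>\<^bsub>H\<^esub> psi (lg ?s) \<ominus>\<^bsub>H\<^esub> (psi (lg ?s) \<otimes>\<^bsub>H\<^esub> psi (lz (i + 1)) \<ominus>\<^bsub>H\<^esub> \<kappa> \<odot>\<^bsub>H\<^esub> psi ?C)"
      unfolding hecke(2) using hecke(1) s hecke_sum_closed[of i]
      by (simp add: minus alg_hom_mult[OF psi_hom] alg_hom_smult[OF psi_hom])
    also have "\<dots> = H.do_z \<kappa> i \<otimes>\<^bsub>H\<^esub> q (gelt ?s) \<ominus>\<^bsub>H\<^esub> H.do_z \<kappa> i \<otimes>\<^bsub>H\<^esub> q (gelt ?s)"
      unfolding C using hecke(1) s H.do_z_hecke[OF hecke(1), of \<kappa>] by (simp add: psi_letters)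
    also have "\<dots> = \<zero>\<^bsub>H\<^esub>" using hecke(1) s by (simp add: a_minus_def H.r_neg)
    finally show ?thesis .
  qed
qed

text \<open>
  The two homomorphisms exchange \<open>z\<^sub>i\<close> with \<open>(v\<^sub>i - \<kappa> X\<^sub>i) / 2\<close> and fix \<open>G\<close>.  As homomorphisms are determined by their values
  on generators, they are inverse to each other.
\<close>

theorem H_DO_isomorphic: "alg_isomorphic D H"
proof -
  have psi_J: "psi x = \<zero>\<^bsub>H\<^esub>" if "x \<in> J" for x
    using alg_hom_kills_genideal[OF F.complex_algebra_axioms H.complex_algebra_axioms psi_hom do_relations_subset psi_rel that] .
  obtain \<Psi> where \<Psi>: "\<Psi> \<in> alg_hom D H" and \<Psi>_proj: "\<And>a. a \<in> carrier F \<Longrightarrow> \<Psi> (proj a) = psi a"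
    using F.quot_lift[OF J_ideal H.complex_algebra_axioms psi_hom psi_J] unfolding proj_def D_eq by metis
  note lift = TG_lift[OF DY.gm1_equivariant_axioms D_bracket_shifted]
  obtain \<Theta> where \<Theta>: "\<Theta> \<in> alg_hom H D"
    and \<Theta>_var: "\<And>i. i < n \<Longrightarrow> \<Theta> (q (var i)) = DY i"
    and \<Theta>_g: "\<And>g. g \<in> carrier G \<Longrightarrow> \<Theta> (q (gelt g)) = proj (lg g)"
  proof -
    obtain \<Theta> where \<Theta>: "\<Theta> \<in> alg_hom H D"
      and eq: "\<And>a. a \<in> carrier TG \<Longrightarrow> \<Theta> (q a) = sd.sd_ext D (free_ext D DY) (\<lambda>g. proj (lg g)) a"
      using TG.quot_lift[OF I_ideal D.complex_algebra_axioms lift(1) lift(4)] unfolding q_eq H_eq by metis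
    show ?thesis
      by (rule that[OF \<Theta>]) (simp_all add: eq lift(2,3))
  qed
  have \<Theta>_X: "\<Theta> (H.X i) = Dg.X i" if "i < n" for i
    using gm1_rep_hom(2)[OF H.gm1_rep_axioms Dg.gm1_rep_axioms \<Theta> \<Theta>_g that] .
  have \<Psi>_X: "\<Psi> (Dg.X i) = H.X i" if "i < n" for i
    by (rule gm1_rep_hom(2)[OF Dg.gm1_rep_axioms H.gm1_rep_axioms \<Psi> _ that])
      (simp add: \<Psi>_proj psi_letters)
  have \<Theta>_z: "\<Theta> (H.do_z \<kappa> i) = proj (lz i)" if "i < n" for i
  proof -
    have "\<Theta> (H.do_z \<kappa> i) = (1 / 2) \<odot>\<^bsub>D\<^esub> DY.shifted \<kappa> i"
      unfolding H.do_z_def H.shifted_def DY.shifted_def using that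
      by (simp add: alg_hom_smult[OF \<Theta>] alg_hom_minus[OF H.complex_algebra_axioms D.complex_algebra_axioms \<Theta>] \<Theta>_var \<Theta>_X)
    then show ?thesis using that by (simp add: D_shifted flip: D.smult_assoc)
  qed
  have \<Theta>\<Psi>: "\<Theta> (\<Psi> x) = x" if x: "x \<in> carrier D" for x
  proof -
    obtain a where a: "a \<in> carrier F" "x = proj a" using x proj_surj by blast
    have "\<Theta> (psi a) = proj a"
      by (rule free_algebra_hom_unique[OF D.complex_algebra_axioms, of "\<lambda>a. \<Theta> (psi a)" L])
        (use a alg_hom_comp[OF psi_hom \<Theta>] proj_hom \<Theta>_z \<Theta>_g in \<open>auto simp: psi_letters simp flip: F_eq\<close>)
    then show ?thesis using a by (simp add: \<Psi>_proj)
  qed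
  have \<Psi>\<Theta>: "\<Psi> (\<Theta> x) = x" if x: "x \<in> carrier H" for x
  proof -
    obtain a where a: "a \<in> carrier TG" "x = q a" using x q_surj by blast
    have "\<Psi> (DY i) = q (var i)" if "i < n" for i
    proof -
      have "\<Psi> (DY i) = 2 \<odot>\<^bsub>H\<^esub> H.do_z \<kappa> i \<oplus>\<^bsub>H\<^esub> \<kappa> \<odot>\<^bsub>H\<^esub> H.X i"
        unfolding DY_def using that
        by (simp add: alg_hom_add[OF \<Psi>] alg_hom_smult[OF \<Psi>] \<Psi>_X \<Psi>_proj psi_letters)
      then show ?thesis using that by (simp add: H.do_z_double)
    qed
    then have "\<Psi> (\<Theta> (q a)) = q a"
      by (intro TG_hom_unique[OF H.complex_algebra_axioms alg_hom_comp[OF q_hom alg_hom_comp[OF \<Theta> \<Psi>]] q_hom _ _ a(1)])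
        (simp_all add: \<Theta>_var \<Theta>_g \<Psi>_proj psi_letters)
    then show ?thesis using a by simp
  qed
  have "bij_betw \<Psi> (carrier D) (carrier H)"
    by (rule bij_betw_byWitness[of _ \<Theta>]) (use \<Theta>\<Psi> \<Psi>\<Theta> alg_hom_closed[OF \<Theta>] alg_hom_closed[OF \<Psi>] in auto)
  then have "\<Psi> \<in> alg_iso D H"
    using \<Psi> by (auto simp: alg_iso_def alg_hom_def ring_iso_def)
  then show ?thesis by (auto simp: alg_isomorphic_def)
qed

end

section \<open>Filtered algebras and their graded algebras\<close>

locale filtered_algebra = complex_algebra A
  for A :: "(complex, 'a) module" (structure) +
  fixes F :: "nat \<Rightarrow> 'a set"
  assumes F_subset: "F i \<subseteq> carrier A"
    and F_zero: "\<zero> \<in> F i"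
    and F_add: "x \<in> F i \<Longrightarrow> y \<in> F i \<Longrightarrow> x \<oplus> y \<in> F i"
    and F_smult: "x \<in> F i \<Longrightarrow> c \<odot> x \<in> F i"
    and F_mono: "F i \<subseteq> F (Suc i)"
    and F_mult: "x \<in> F i \<Longrightarrow> y \<in> F j \<Longrightarrow> x \<otimes> y \<in> F (i + j)"
begin

abbreviation "below \<equiv> filt_below A F"

lemma below_simps: "below 0 = {\<zero>}" "below (Suc i) = F i"
  by (simp_all add: filt_below_def)

lemma F_carrier: "x \<in> F i \<Longrightarrow> x \<in> carrier A"
  using F_subset by blast

lemma below_F: "x \<in> below i \<Longrightarrow> x \<in> F i"
  using F_mono F_zero by (cases i) (auto simp: below_simps)

lemma below_carrier: "x \<in> below i \<Longrightarrow> x \<in> carrier A"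
  using below_F F_carrier by blast

lemma below_zero: "\<zero> \<in> below i"
  using F_zero by (cases i) (auto simp: below_simps)

lemma below_add: "x \<in> below i \<Longrightarrow> y \<in> below i \<Longrightarrow> x \<oplus> y \<in> below i"
  using F_add by (cases i) (auto simp: below_simps)

lemma below_smult: "x \<in> below i \<Longrightarrow> c \<odot> x \<in> below i"
  using F_smult by (cases i) (auto simp: below_simps)

lemma below_a_inv: "x \<in> below i \<Longrightarrow> \<ominus> x \<in> below i"
  using below_smult[of x i "- 1"] below_carrier[of x i] by simp

lemma below_mult_left: "x \<in> below i \<Longrightarrow> y \<in> F j \<Longrightarrow> x \<otimes> y \<in> below (i + j)"
  using F_mult[of x "i - 1" y j] F_carrier[of y j] below_zero[of "i + j"] by (cases i) (auto simp: below_simps)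

lemma below_mult_right: "x \<in> F i \<Longrightarrow> y \<in> below j \<Longrightarrow> x \<otimes> y \<in> below (i + j)"
  using F_mult[of x i y "j - 1"] F_carrier[of x i] below_zero[of "i + j"] by (cases j) (auto simp: below_simps)

lemma below_finsum: "(\<And>j. j \<in> S \<Longrightarrow> f j \<in> below i) \<Longrightarrow> (\<Oplus>j\<in>S. f j) \<in> below i"
proof (induct S rule: infinite_finite_induct)
  case (insert j S)
  then show ?case using below_carrier by (subst finsum_insert) (auto intro!: below_add)
qed (simp_all add: below_zero)

lemma below_coset_iff:
  assumes "a \<in> carrier A"
  shows "x \<in> below i +> a \<longleftrightarrow> x \<in> carrier A \<and> x \<ominus> a \<in> below i"
proof
  assume "x \<in> below i +> a"
  then have "\<exists>h\<in>below i. x = h \<oplus> a" by (simp add: a_r_coset_def')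
  then obtain h where h: "h \<in> below i" "x = h \<oplus> a" ..
  have "h \<in> carrier A" by (rule below_carrier[OF h(1)])
  then have "x \<ominus> a = h" unfolding h(2) using assms by algebra
  then show "x \<in> carrier A \<and> x \<ominus> a \<in> below i" using h assms \<open>h \<in> carrier A\<close> by simp
next
  assume x: "x \<in> carrier A \<and> x \<ominus> a \<in> below i"
  then have "x = (x \<ominus> a) \<oplus> a" using assms by algebra
  then have "\<exists>h\<in>below i. x = h \<oplus> a" using x by (intro bexI[of _ "x \<ominus> a"]) auto
  then show "x \<in> below i +> a" by (simp add: a_r_coset_def')
qed

lemma below_coset_eq_iff:
  assumes a: "a \<in> carrier A" and b: "b \<in> carrier A"
  shows "below i +> a = below i +> b \<longleftrightarrow> a \<ominus> b \<in> below i"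
proof
  assume "below i +> a = below i +> b"
  moreover have "a \<in> below i +> a"
    using below_coset_iff[OF a, of a i] a below_zero by (simp add: a_minus_def r_neg)
  ultimately show "a \<ominus> b \<in> below i" using below_coset_iff[OF b] by blast
next
  assume ab: "a \<ominus> b \<in> below i"
  show "below i +> a = below i +> b"
  proof (rule Set.set_eqI)
    fix x
    have "x \<ominus> a \<in> below i \<longleftrightarrow> x \<ominus> b \<in> below i" if x: "x \<in> carrier A"
    proof
      assume "x \<ominus> a \<in> below i"
      then have "(x \<ominus> a) \<oplus> (a \<ominus> b) \<in> below i" using ab by (rule below_add)
      moreover have "(x \<ominus> a) \<oplus> (a \<ominus> b) = x \<ominus> b" using x a b by algebra
      ultimately show "x \<ominus> b \<in> below i" by simp
    next
      assume "x \<ominus> b \<in> below i"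
      then have "(x \<ominus> b) \<oplus> (\<ominus> (a \<ominus> b)) \<in> below i" using ab by (intro below_add below_a_inv)
      moreover have "(x \<ominus> b) \<oplus> (\<ominus> (a \<ominus> b)) = x \<ominus> a" using x a b by algebra
      ultimately show "x \<ominus> a \<in> below i" by simp
    qed
    then show "x \<in> below i +> a \<longleftrightarrow> x \<in> below i +> b"
      using below_coset_iff a b by blast
  qed
qed

lemma below_coset_zero: "below i +> \<zero> = below i"
  using below_carrier by (intro a_coset_add_zero) auto

text \<open>
  The element of the graded algebra with components the classes of \<open>a\<^sub>i \<in> F\<^sub>i\<close>; it is the convenient form of a
  general element, as all operations can be computed on the representatives \<open>a\<^sub>i\<close>.
\<close>

definition cls :: "(nat \<Rightarrow> 'a) \<Rightarrow> nat \<Rightarrow> 'a set" where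
  "cls a = (\<lambda>i. below i +> a i)"

abbreviation "gr \<equiv> assoc_graded A F"

lemma cls_add:
  assumes "\<And>i. a i \<in> F i" "\<And>i. b i \<in> F i"
  shows "cls a \<oplus>\<^bsub>gr\<^esub> cls b = cls (\<lambda>i. a i \<oplus> b i)"
proof
  fix i
  note [simp] = F_carrier[OF assms(1)] F_carrier[OF assms(2)]
  have "(below i +> a i) <+>\<^bsub>A\<^esub> (below i +> b i) = below i +> (a i \<oplus> b i)"
  proof (intro Set.set_eqI iffI)
    fix x assume "x \<in> (below i +> a i) <+>\<^bsub>A\<^esub> (below i +> b i)"
    then obtain y z where yz: "y \<in> below i +> a i" "z \<in> below i +> b i" "x = y \<oplus> z"
      unfolding set_add_def' by blast
    then have yz': "y \<in> carrier A" "z \<in> carrier A" "y \<ominus> a i \<in> below i" "z \<ominus> b i \<in> below i"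
      by (simp_all add: below_coset_iff)
    have "(y \<ominus> a i) \<oplus> (z \<ominus> b i) = x \<ominus> (a i \<oplus> b i)" unfolding yz(3) using yz' by (simp add: minus_add_distrib)
    then show "x \<in> below i +> (a i \<oplus> b i)"
      using below_add[OF yz'(3,4)] yz' yz(3) by (simp add: below_coset_iff)
  next
    fix x assume "x \<in> below i +> (a i \<oplus> b i)"
    then have x: "x \<in> carrier A" "x \<ominus> (a i \<oplus> b i) \<in> below i" by (simp_all add: below_coset_iff)
    have ab: "a i \<in> carrier A" "b i \<in> carrier A" by simp_all
    have eq: "x \<ominus> (a i \<oplus> b i) = (x \<ominus> b i) \<ominus> a i" "x = (x \<ominus> b i) \<oplus> b i"
      using x(1) ab by algebra+
    have "x \<ominus> b i \<in> below i +> a i" using x eq(1) by (simp add: below_coset_iff)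
    moreover have "b i \<in> below i +> b i" by (simp add: below_coset_iff below_zero a_minus_def r_neg)
    ultimately show "x \<in> (below i +> a i) <+>\<^bsub>A\<^esub> (below i +> b i)"
      using eq(2) unfolding set_add_def' by blast
  qed
  then show "(cls a \<oplus>\<^bsub>gr\<^esub> cls b) i = cls (\<lambda>i. a i \<oplus> b i) i"
    by (simp add: assoc_graded_def cls_def)
qed

lemma below_add_coset:
  assumes "U \<subseteq> below i +> a" "a \<in> U" "a \<in> carrier A"
  shows "below i <+>\<^bsub>A\<^esub> U = below i +> a"
proof (intro Set.set_eqI iffI)
  fix x assume "x \<in> below i <+>\<^bsub>A\<^esub> U"
  then obtain h u where hu: "h \<in> below i" "u \<in> U" "x = h \<oplus> u" unfolding set_add_def' by blast
  then have u: "u \<in> carrier A" "u \<ominus> a \<in> below i" using assms by (auto simp: below_coset_iff)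
  have "h \<in> carrier A" using hu below_carrier by blast
  then have "x \<ominus> a = h \<oplus> (u \<ominus> a)" unfolding hu(3) using u assms(3) by algebra
  then show "x \<in> below i +> a"
    using below_add[OF hu(1) u(2)] u \<open>h \<in> carrier A\<close> assms(3) hu(3) by (simp add: below_coset_iff)
next
  fix x assume "x \<in> below i +> a"
  then have "\<exists>h\<in>below i. x = h \<oplus> a" by (simp add: a_r_coset_def')
  then show "x \<in> below i <+>\<^bsub>A\<^esub> U" unfolding set_add_def' using assms(2) by blast
qed

lemma cls_smult:
  assumes "\<And>i. a i \<in> F i"
  shows "c \<odot>\<^bsub>gr\<^esub> cls a = cls (\<lambda>i. c \<odot> a i)"
proof
  fix i
  note [simp] = F_carrier[OF assms]
  have "below i <+>\<^bsub>A\<^esub> ((\<lambda>x. c \<odot> x) ` (below i +> a i)) = below i +> c \<odot> a i"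
  proof (rule below_add_coset)
    show "(\<lambda>x. c \<odot> x) ` (below i +> a i) \<subseteq> below i +> c \<odot> a i"
    proof
      fix x assume "x \<in> (\<lambda>x. c \<odot> x) ` (below i +> a i)"
      then obtain y where y: "y \<in> below i +> a i" "x = c \<odot> y" by blast
      then have "y \<in> carrier A" "y \<ominus> a i \<in> below i" by (simp_all add: below_coset_iff)
      then show "x \<in> below i +> c \<odot> a i"
        using below_smult[of "y \<ominus> a i" i c] y(2) by (simp add: below_coset_iff smult_minus_right)
    qed
    have "a i \<in> below i +> a i" by (simp add: below_coset_iff below_zero a_minus_def r_neg)
    then show "c \<odot> a i \<in> (\<lambda>x. c \<odot> x) ` (below i +> a i)" by blast
  qed simp
  then show "(c \<odot>\<^bsub>gr\<^esub> cls a) i = cls (\<lambda>i. c \<odot> a i) i"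
    by (simp add: assoc_graded_def cls_def)
qed

lemma cls_mult:
  assumes a: "\<And>i. a i \<in> F i" and b: "\<And>i. b i \<in> F i"
  shows "cls a \<otimes>\<^bsub>gr\<^esub> cls b = cls (\<lambda>k. \<Oplus>i\<in>{..k}. a i \<otimes> b (k - i))"
proof
  fix k
  note [simp] = F_carrier[OF a] F_carrier[OF b]
  let ?U = "{(\<Oplus>i\<in>{..k}. x i \<otimes> y (k - i)) | x y. \<forall>i\<le>k. x i \<in> cls a i \<and> y i \<in> cls b i}"
  have "below k <+>\<^bsub>A\<^esub> ?U = below k +> (\<Oplus>i\<in>{..k}. a i \<otimes> b (k - i))"
  proof (rule below_add_coset)
    show "?U \<subseteq> below k +> (\<Oplus>i\<in>{..k}. a i \<otimes> b (k - i))"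
    proof
      fix u assume "u \<in> ?U"
      then obtain x y where u: "u = (\<Oplus>i\<in>{..k}. x i \<otimes> y (k - i))"
        and "\<forall>i\<le>k. x i \<in> cls a i \<and> y i \<in> cls b i" by blast
      then have xy: "x i \<in> carrier A" "y i \<in> carrier A" "x i \<ominus> a i \<in> below i" "y i \<ominus> b i \<in> below i"
        if "i \<le> k" for i using that by (auto simp: cls_def below_coset_iff)
      have "u \<ominus> (\<Oplus>i\<in>{..k}. a i \<otimes> b (k - i)) = (\<Oplus>i\<in>{..k}. x i \<otimes> y (k - i) \<ominus> a i \<otimes> b (k - i))"
        unfolding u by (rule finsum_minus) (auto simp: xy)
      also have "\<dots> \<in> below k"
      proof (rule below_finsum)
        fix i assume "i \<in> {..k}"
        then have i: "i \<le> k" by simp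
        let ?j = "k - i"
        have cl: "x i \<in> carrier A" "a i \<in> carrier A" "y ?j \<in> carrier A" "b ?j \<in> carrier A" using xy i by auto
        \<comment> \<open>Each of the two terms has a factor of lower degree, so the product of classes does not depend on the representatives.\<close>
        have eq: "x i \<otimes> y ?j \<ominus> a i \<otimes> b ?j = (x i \<ominus> a i) \<otimes> y ?j \<oplus> a i \<otimes> (y ?j \<ominus> b ?j)"
          using cl by algebra
        have "y ?j = (y ?j \<ominus> b ?j) \<oplus> b ?j" using cl by algebra
        also have "\<dots> \<in> F ?j" using xy[of ?j] by (intro F_add below_F b) auto
        finally have "(x i \<ominus> a i) \<otimes> y ?j \<in> below (i + ?j)" by (intro below_mult_left xy i)
        moreover have "a i \<otimes> (y ?j \<ominus> b ?j) \<in> below (i + ?j)" by (intro below_mult_right a xy) simp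
        ultimately show "x i \<otimes> y ?j \<ominus> a i \<otimes> b ?j \<in> below k" unfolding eq using i by (simp add: below_add)
      qed
      finally show "u \<in> below k +> (\<Oplus>i\<in>{..k}. a i \<otimes> b (k - i))"
        using xy by (simp add: below_coset_iff finsum_closed Pi_iff u)
    qed
    have "\<forall>i\<le>k. a i \<in> cls a i \<and> b i \<in> cls b i"
      by (simp add: cls_def below_coset_iff below_zero a_minus_def r_neg)
    then show "(\<Oplus>i\<in>{..k}. a i \<otimes> b (k - i)) \<in> ?U" by blast
  qed (simp add: finsum_closed Pi_iff)
  then show "(cls a \<otimes>\<^bsub>gr\<^esub> cls b) k = cls (\<lambda>k. \<Oplus>i\<in>{..k}. a i \<otimes> b (k - i)) k"
    by (simp add: assoc_graded_def cls_def)
qed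

lemma homogeneous_class_eq: "homogeneous_class A F k x = cls (\<lambda>i. if i = k then x else \<zero>)"
  by (simp add: homogeneous_class_def cls_def below_coset_zero fun_eq_iff)

lemma cls_closed:
  assumes "\<And>i. a i \<in> F i" "finite {i. a i \<noteq> \<zero>}"
  shows "cls a \<in> carrier gr"
proof -
  have "{i. cls a i \<noteq> below i} \<subseteq> {i. a i \<noteq> \<zero>}" by (auto simp: cls_def below_coset_zero)
  then have "finite {i. cls a i \<noteq> below i}" using assms(2) by (rule finite_subset)
  then show ?thesis using assms(1) by (auto simp: assoc_graded_def cls_def)
qed

text \<open>
  If \<open>R\<close> is graded by the components \<open>c\<^sub>i\<close> and \<open>q\<close> is compatible with the filtration, then taking the classes of the
  components is a homomorphism to the graded algebra.
\<close>

lemma graded_hom: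
  assumes R: "complex_algebra R" and q: "q \<in> alg_hom R A"
    and cF: "\<And>i f. f \<in> carrier R \<Longrightarrow> c i f \<in> carrier R \<and> q (c i f) \<in> F i"
    and fin: "\<And>f. f \<in> carrier R \<Longrightarrow> finite {i. c i f \<noteq> \<zero>\<^bsub>R\<^esub>}"
    and c_one: "\<And>i. c i \<one>\<^bsub>R\<^esub> = (if i = 0 then \<one>\<^bsub>R\<^esub> else \<zero>\<^bsub>R\<^esub>)"
    and c_add: "\<And>i f g. f \<in> carrier R \<Longrightarrow> g \<in> carrier R \<Longrightarrow> c i (f \<oplus>\<^bsub>R\<^esub> g) = c i f \<oplus>\<^bsub>R\<^esub> c i g"
    and c_smult: "\<And>i s f. f \<in> carrier R \<Longrightarrow> c i (s \<odot>\<^bsub>R\<^esub> f) = s \<odot>\<^bsub>R\<^esub> c i f"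
    and c_mult: "\<And>k f g. f \<in> carrier R \<Longrightarrow> g \<in> carrier R \<Longrightarrow>
      c k (f \<otimes>\<^bsub>R\<^esub> g) = (\<Oplus>\<^bsub>R\<^esub>i\<in>{..k}. c i f \<otimes>\<^bsub>R\<^esub> c (k - i) g)"
  shows "(\<lambda>f. cls (\<lambda>i. q (c i f))) \<in> alg_hom R gr"
proof (rule alg_homI)
  interpret R: complex_algebra R by fact
  note q_zero = alg_hom_zero[OF R complex_algebra_axioms q]
  show "cls (\<lambda>i. q (c i f)) \<in> carrier gr" if f: "f \<in> carrier R" for f
  proof (rule cls_closed)
    show "finite {i. q (c i f) \<noteq> \<zero>}"
      by (rule finite_subset[OF _ fin[OF f]]) (auto simp: q_zero)
  qed (use f cF in auto)
  show "cls (\<lambda>i. q (c i (f \<oplus>\<^bsub>R\<^esub> g))) = cls (\<lambda>i. q (c i f)) \<oplus>\<^bsub>gr\<^esub> cls (\<lambda>i. q (c i g))"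
    if "f \<in> carrier R" "g \<in> carrier R" for f g
    using that cF by (subst cls_add) (auto simp: c_add alg_hom_add[OF q])
  show "cls (\<lambda>i. q (c i (s \<odot>\<^bsub>R\<^esub> f))) = s \<odot>\<^bsub>gr\<^esub> cls (\<lambda>i. q (c i f))" if "f \<in> carrier R" for s f
    using that cF by (subst cls_smult) (auto simp: c_smult alg_hom_smult[OF q])
  show "cls (\<lambda>i. q (c i \<one>\<^bsub>R\<^esub>)) = \<one>\<^bsub>gr\<^esub>"
  proof -
    have "q (c i \<one>\<^bsub>R\<^esub>) = (if i = 0 then \<one> else \<zero>)" for i
      by (simp add: c_one q_zero alg_hom_one[OF q])
    then show ?thesis by (simp add: assoc_graded_def homogeneous_class_eq)
  qed
  show "cls (\<lambda>i. q (c i (f \<otimes>\<^bsub>R\<^esub> g))) = cls (\<lambda>i. q (c i f)) \<otimes>\<^bsub>gr\<^esub> cls (\<lambda>i. q (c i g))"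
    if f: "f \<in> carrier R" and g: "g \<in> carrier R" for f g
  proof -
    have "q (c k (f \<otimes>\<^bsub>R\<^esub> g)) = (\<Oplus>i\<in>{..k}. q (c i f) \<otimes> q (c (k - i) g))" for k
      unfolding c_mult[OF f g] using f g cF
      by (subst alg_hom_finsum[OF R complex_algebra_axioms q])
        (auto simp: alg_hom_mult[OF q] intro!: add.finprod_cong' alg_hom_closed[OF q])
    then show ?thesis using f g cF by (subst cls_mult) auto
  qed
qed

end

section \<open>Homogeneous parts and the symbol map\<close>

context gm1
begin

abbreviation "bas g c u \<equiv> mon_elt G T g (monomial c u)"

lemma monomial_T [simp, intro]: "u \<in> lists {..<n} \<Longrightarrow> monomial c u \<in> carrier T"
  by (simp only: tensor_algebra_simps monomial_closed)

lemma bas_closed [simp, intro]: "u \<in> lists {..<n} \<Longrightarrow> bas g c u \<in> carrier TG"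
  unfolding TG_eq by (rule sd.mon_closed) (rule monomial_T)

lemma TG_induct [consumes 1, case_names bas add]:
  assumes f: "f \<in> carrier TG"
    and bas: "\<And>g c u. g \<in> carrier G \<Longrightarrow> u \<in> lists {..<n} \<Longrightarrow> P (bas g c u)"
    and add: "\<And>f f'. f \<in> carrier TG \<Longrightarrow> f' \<in> carrier TG \<Longrightarrow> P f \<Longrightarrow> P f' \<Longrightarrow> P (f \<oplus>\<^bsub>TG\<^esub> f')"
  shows "P f"
  using f unfolding TG_eq
proof (induct f rule: sd.S_induct)
  case (mon g t)
  from mon(2) have "t \<in> carrier (free_algebra {..<n})" by (simp add: tensor_algebra_simps)
  then show ?case
  proof (induct t rule: free_algebra_induct)
    case (monomial c u)
    then show ?case using bas mon by simp
  next
    case (add s t)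
    have st: "s \<in> carrier T" "t \<in> carrier T" using add by (simp_all add: tensor_algebra_simps)
    have "(\<lambda>w. s w + t w) = s \<oplus>\<^bsub>T\<^esub> t" by (simp add: tensor_algebra_simps free_algebra_simps)
    then have "mon_elt G T g (\<lambda>w. s w + t w) = mon_elt G T g s \<oplus>\<^bsub>TG\<^esub> mon_elt G T g t"
      using sd.mon_add[OF st] by (simp add: TG_eq)
    then show ?case
      using assms(3)[of "mon_elt G T g s" "mon_elt G T g t"] add st by (simp add: TG_eq)
  qed
qed (use add in \<open>simp add: TG_eq\<close>)

lemma TG_apply:
  "f \<oplus>\<^bsub>TG\<^esub> f' = (\<lambda>x\<in>carrier G. \<lambda>w. f x w + f' x w)"
  "c \<odot>\<^bsub>TG\<^esub> f = (\<lambda>x\<in>carrier G. \<lambda>w. c * f x w)"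
  "\<zero>\<^bsub>TG\<^esub> = (\<lambda>x\<in>carrier G. \<lambda>w. 0)"
  by (simp_all add: TG_eq semidirect_algebra_simps tensor_algebra_simps free_algebra_simps)

lemma TG_carrier: "f \<in> carrier TG \<longleftrightarrow> f \<in> carrier G \<rightarrow>\<^sub>E carrier T"
  by (simp add: TG_eq semidirect_algebra_simps)

lemma TG_apply_closed: "f \<in> carrier TG \<Longrightarrow> g \<in> carrier G \<Longrightarrow> f g \<in> carrier T"
  unfolding TG_eq by (rule sd.carrier_apply)

lemma TG_eqI: "f \<in> carrier TG \<Longrightarrow> f' \<in> carrier TG \<Longrightarrow> (\<And>g w. g \<in> carrier G \<Longrightarrow> f g w = f' g w) \<Longrightarrow> f = f'"
  unfolding TG_eq by (rule sd.S_eqI) auto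

lemma bas_apply: "x \<in> carrier G \<Longrightarrow> bas g c u x w = (if x = g \<and> w = u then c else 0)"
  by (simp add: mon_elt_apply monomial_def tensor_algebra_simps free_algebra_simps)

lemma bas_mult:
  assumes "g \<in> carrier G" "h \<in> carrier G" "u \<in> lists {..<n}" "v \<in> lists {..<n}"
  shows "bas g c u \<otimes>\<^bsub>TG\<^esub> bas h d v = bas (g \<otimes>\<^bsub>G\<^esub> h) (c * d) (u @ map (fst g) v)"
  unfolding TG_eq using assms
  by (subst sd.mon_mult) (auto simp: tact_monomial, simp add: tensor_algebra_simps conv_monomial)

lemma bas_zero: "bas g 0 u = \<zero>\<^bsub>TG\<^esub>"
  by (simp add: TG_apply mon_elt_def monomial_def tensor_algebra_simps free_algebra_simps cong: if_cong)

lemma gelt_bas: "gelt g = bas g 1 []"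
  by (simp add: group_elt_eq_mon tensor_algebra_simps free_algebra_simps)

lemma one_bas: "\<one>\<^bsub>TG\<^esub> = bas \<one>\<^bsub>G\<^esub> 1 []"
  using gelt_one gelt_bas by simp

definition homog_part :: "nat \<Rightarrow> (gm1 \<Rightarrow> nat list \<Rightarrow> complex) \<Rightarrow> gm1 \<Rightarrow> nat list \<Rightarrow> complex" where
  "homog_part i f = (\<lambda>g\<in>carrier G. \<lambda>w. if length w = i then f g w else 0)"

lemma T_cut: "t \<in> carrier T \<Longrightarrow> (\<And>w. t' w \<noteq> 0 \<Longrightarrow> t w \<noteq> 0) \<Longrightarrow> t' \<in> carrier T"
proof -
  assume t: "t \<in> carrier T" and sub: "\<And>w. t' w \<noteq> 0 \<Longrightarrow> t w \<noteq> 0"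
  then have "{w. t' w \<noteq> 0} \<subseteq> {w. t w \<noteq> 0}" by auto
  then show ?thesis
    using t unfolding tensor_algebra_simps free_algebra_simps by (meson finite_subset order_trans)
qed

lemma homog_part_closed [simp, intro]:
  assumes "f \<in> carrier TG" shows "homog_part i f \<in> carrier TG"
  unfolding TG_carrier homog_part_def
proof (rule restrict_PiE_iff[THEN iffD2], rule ballI)
  fix g assume "g \<in> carrier G"
  then show "(\<lambda>w. if length w = i then f g w else 0) \<in> carrier T"
    by (rule T_cut[OF TG_apply_closed[OF assms]]) (simp split: if_splits)
qed

lemma homog_part_bas: "homog_part i (bas g c u) = bas g (if length u = i then c else 0) u"
  by (auto simp: homog_part_def mon_elt_def monomial_def fun_eq_iff tensor_algebra_simps free_algebra_simps)

lemma homog_part_add: "homog_part i (f \<oplus>\<^bsub>TG\<^esub> g) = homog_part i f \<oplus>\<^bsub>TG\<^esub> homog_part i g"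
  by (auto simp: homog_part_def TG_apply fun_eq_iff)

lemma homog_part_smult: "homog_part i (c \<odot>\<^bsub>TG\<^esub> f) = c \<odot>\<^bsub>TG\<^esub> homog_part i f"
  by (auto simp: homog_part_def TG_apply fun_eq_iff)

lemma homog_part_one: "homog_part i \<one>\<^bsub>TG\<^esub> = (if i = 0 then \<one>\<^bsub>TG\<^esub> else \<zero>\<^bsub>TG\<^esub>)"
  by (simp add: one_bas homog_part_bas bas_zero)

lemma homog_part_finite:
  assumes "f \<in> carrier TG" shows "finite {i. homog_part i f \<noteq> \<zero>\<^bsub>TG\<^esub>}"
  using assms
proof (induct f rule: TG_induct)
  case (bas g c u)
  show ?case by (rule finite_subset[of _ "{length u}"]) (auto simp: homog_part_bas bas_zero)
next
  case (add f f')
  have "{i. homog_part i (f \<oplus>\<^bsub>TG\<^esub> f') \<noteq> \<zero>\<^bsub>TG\<^esub>} \<subseteq> {i. homog_part i f \<noteq> \<zero>\<^bsub>TG\<^esub>} \<union> {i. homog_part i f' \<noteq> \<zero>\<^bsub>TG\<^esub>}"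
    using add by (auto simp: homog_part_add)
  then show ?case using add by (meson finite_UnI finite_subset)
qed

lemma homog_part_mult:
  assumes f: "f \<in> carrier TG" and f': "f' \<in> carrier TG"
  shows "homog_part k (f \<otimes>\<^bsub>TG\<^esub> f') = (\<Oplus>\<^bsub>TG\<^esub>i\<in>{..k}. homog_part i f \<otimes>\<^bsub>TG\<^esub> homog_part (k - i) f')"
  using f
proof (induct f rule: TG_induct)
  case (bas g c u)
  show ?case
    using f'
  proof (induct f' rule: TG_induct)
    case (bas h d v)
    note * = \<open>g \<in> carrier G\<close> \<open>h \<in> carrier G\<close> \<open>u \<in> lists {..<n}\<close> \<open>v \<in> lists {..<n}\<close>
    have uv: "u @ map (fst g) v \<in> lists {..<n}" using * map_fst_lists[OF *(1,4)] by auto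
    have tm: "homog_part i (bas g c u) \<otimes>\<^bsub>TG\<^esub> homog_part (k - i) (bas h d v) =
       bas (g \<otimes>\<^bsub>G\<^esub> h) ((if length u = i then c else 0) * (if length v = k - i then d else 0)) (u @ map (fst g) v)" for i
      unfolding homog_part_bas bas_mult[OF *] ..
    have lhs: "homog_part k (bas g c u \<otimes>\<^bsub>TG\<^esub> bas h d v) =
       bas (g \<otimes>\<^bsub>G\<^esub> h) (if length u + length v = k then c * d else 0) (u @ map (fst g) v)"
      by (simp add: bas_mult[OF *] homog_part_bas)
    show ?case
    proof (cases "length u \<le> k")
      case True
      have "(\<Oplus>\<^bsub>TG\<^esub>i\<in>{..k}. homog_part i (bas g c u) \<otimes>\<^bsub>TG\<^esub> homog_part (k - i) (bas h d v))
        = homog_part (length u) (bas g c u) \<otimes>\<^bsub>TG\<^esub> homog_part (k - length u) (bas h d v)"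
        by (rule TG.finsum_single) (use True uv in \<open>auto simp: tm bas_zero\<close>)
      then show ?thesis using True unfolding lhs tm by (auto simp: bas_zero)
    next
      case False
      have "(\<Oplus>\<^bsub>TG\<^esub>i\<in>{..k}. homog_part i (bas g c u) \<otimes>\<^bsub>TG\<^esub> homog_part (k - i) (bas h d v)) = \<zero>\<^bsub>TG\<^esub>"
        by (rule TG.add.finprod_one_eqI) (use False in \<open>auto simp: tm bas_zero\<close>)
      then show ?thesis using False unfolding lhs by (simp add: bas_zero)
    qed
  next
    case (add f f')
    have b: "bas g c u \<in> carrier TG" using bas by simp
    have "(\<Oplus>\<^bsub>TG\<^esub>i\<in>{..k}. homog_part i (bas g c u) \<otimes>\<^bsub>TG\<^esub> homog_part (k - i) (f \<oplus>\<^bsub>TG\<^esub> f')) =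
      (\<Oplus>\<^bsub>TG\<^esub>i\<in>{..k}. homog_part i (bas g c u) \<otimes>\<^bsub>TG\<^esub> homog_part (k - i) f \<oplus>\<^bsub>TG\<^esub> homog_part i (bas g c u) \<otimes>\<^bsub>TG\<^esub> homog_part (k - i) f')"
      by (rule TG.add.finprod_cong') (use add b in \<open>simp_all add: homog_part_add TG.r_distr Pi_iff\<close>)
    also have "\<dots> = (\<Oplus>\<^bsub>TG\<^esub>i\<in>{..k}. homog_part i (bas g c u) \<otimes>\<^bsub>TG\<^esub> homog_part (k - i) f)
       \<oplus>\<^bsub>TG\<^esub> (\<Oplus>\<^bsub>TG\<^esub>i\<in>{..k}. homog_part i (bas g c u) \<otimes>\<^bsub>TG\<^esub> homog_part (k - i) f')"
      by (rule TG.finsum_addf) (use add b in auto)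
    finally show ?case using add b by (simp add: TG.r_distr homog_part_add)
  qed
next
  case (add f f'')
  have "(\<Oplus>\<^bsub>TG\<^esub>i\<in>{..k}. homog_part i (f \<oplus>\<^bsub>TG\<^esub> f'') \<otimes>\<^bsub>TG\<^esub> homog_part (k - i) f') =
    (\<Oplus>\<^bsub>TG\<^esub>i\<in>{..k}. homog_part i f \<otimes>\<^bsub>TG\<^esub> homog_part (k - i) f' \<oplus>\<^bsub>TG\<^esub> homog_part i f'' \<otimes>\<^bsub>TG\<^esub> homog_part (k - i) f')"
    by (rule TG.add.finprod_cong') (use add f' in \<open>simp_all add: homog_part_add TG.l_distr Pi_iff\<close>)
  also have "\<dots> = (\<Oplus>\<^bsub>TG\<^esub>i\<in>{..k}. homog_part i f \<otimes>\<^bsub>TG\<^esub> homog_part (k - i) f')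
     \<oplus>\<^bsub>TG\<^esub> (\<Oplus>\<^bsub>TG\<^esub>i\<in>{..k}. homog_part i f'' \<otimes>\<^bsub>TG\<^esub> homog_part (k - i) f')"
    by (rule TG.finsum_addf) (use add f' in auto)
  finally show ?case using add f' by (simp add: TG.l_distr homog_part_add)
qed

definition TG_le :: "nat \<Rightarrow> (gm1 \<Rightarrow> nat list \<Rightarrow> complex) set" where
  "TG_le i = {f \<in> carrier TG. \<forall>g\<in>carrier G. \<forall>w. f g w \<noteq> 0 \<longrightarrow> length w \<le> i}"

lemma TG_le_iff: "f \<in> TG_le i \<longleftrightarrow> f \<in> carrier TG \<and> (\<forall>k>i. homog_part k f = \<zero>\<^bsub>TG\<^esub>)"
proof (cases "f \<in> carrier TG")
  case True
  have "(\<forall>k>i. homog_part k f = \<zero>\<^bsub>TG\<^esub>) \<longleftrightarrow> (\<forall>g\<in>carrier G. \<forall>w. f g w \<noteq> 0 \<longrightarrow> length w \<le> i)"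
    by (auto simp: homog_part_def TG_apply fun_eq_iff restrict_def not_le[symmetric])
  then show ?thesis using True by (simp add: TG_le_def)
qed (simp add: TG_le_def)

lemma TG_le_carrier: "f \<in> TG_le i \<Longrightarrow> f \<in> carrier TG"
  by (simp add: TG_le_def)

lemma TG_le_mult:
  assumes f: "f \<in> TG_le i" and f': "f' \<in> TG_le j"
  shows "f \<otimes>\<^bsub>TG\<^esub> f' \<in> TG_le (i + j)"
proof -
  note ff' = f[unfolded TG_le_iff] f'[unfolded TG_le_iff]
  have "homog_part k (f \<otimes>\<^bsub>TG\<^esub> f') = \<zero>\<^bsub>TG\<^esub>" if k: "k > i + j" for k
  proof -
    have "homog_part a f \<otimes>\<^bsub>TG\<^esub> homog_part (k - a) f' = \<zero>\<^bsub>TG\<^esub>" if "a \<le> k" for a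
    proof (cases "a > i")
      case False
      then have "k - a > j" using k by simp
      then show ?thesis using ff' by simp
    qed (use ff' in simp)
    then show ?thesis
      using ff' by (subst homog_part_mult) (auto intro!: TG.add.finprod_one_eqI)
  qed
  then show ?thesis using ff' by (auto simp: TG_le_iff)
qed

lemma homog_part_TG_le: "f \<in> carrier TG \<Longrightarrow> homog_part i f \<in> TG_le i"
  using homog_part_closed[of f i] by (auto simp: TG_le_def homog_part_def split: if_splits)

lemma homog_part_homog_part: "homog_part i (homog_part j f) = (if i = j then homog_part i f else \<zero>\<^bsub>TG\<^esub>)"
  by (auto simp: homog_part_def TG_apply fun_eq_iff)

end

context gm1_kappa
begin

abbreviation "Fil \<equiv> commutator_filtration G n (perm_rep n) b"

lemma Fil_eq: "Fil i = q ` TG_le i"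
  by (simp add: commutator_filtration_def TG_le_def)

sublocale Hf: filtered_algebra H Fil
proof
  fix i j x y and c :: complex
  note hom = alg_homD[OF q_hom]
  show "Fil i \<subseteq> carrier H" by (auto simp: Fil_eq TG_le_carrier)
  have "\<zero>\<^bsub>TG\<^esub> \<in> TG_le i" by (auto simp: TG_le_def TG_apply(3), auto simp flip: TG_apply(3))
  then show "\<zero>\<^bsub>H\<^esub> \<in> Fil i"
    unfolding Fil_eq using q_zero by (metis imageI)
  have "TG_le i \<subseteq> TG_le (Suc i)" by (auto simp: TG_le_iff)
  then show "Fil i \<subseteq> Fil (Suc i)" by (auto simp: Fil_eq)
  assume "x \<in> Fil i"
  then obtain f where f: "f \<in> TG_le i" "x = q f" by (auto simp: Fil_eq)
  have "c \<odot>\<^bsub>TG\<^esub> f \<in> TG_le i" using f by (auto simp: TG_le_iff homog_part_smult)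
  then show "c \<odot>\<^bsub>H\<^esub> x \<in> Fil i" using f hom(5)[OF TG_le_carrier] by (auto simp: Fil_eq simp flip: hom(5)[OF TG_le_carrier])
  {
    assume "y \<in> Fil i"
    then obtain h where h: "h \<in> TG_le i" "y = q h" by (auto simp: Fil_eq)
    have "f \<oplus>\<^bsub>TG\<^esub> h \<in> TG_le i" using f h by (auto simp: TG_le_iff homog_part_add)
    then show "x \<oplus>\<^bsub>H\<^esub> y \<in> Fil i" using f h by (auto simp: Fil_eq TG_le_carrier simp flip: hom(3))
  }
  {
    assume "y \<in> Fil j"
    then obtain h where h: "h \<in> TG_le j" "y = q h" by (auto simp: Fil_eq)
    have "f \<otimes>\<^bsub>TG\<^esub> h \<in> TG_le (i + j)" using f h by (intro TG_le_mult)
    then show "x \<otimes>\<^bsub>H\<^esub> y \<in> Fil (i + j)" using f h by (auto simp: Fil_eq TG_le_carrier simp flip: hom(2))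
  }
qed

abbreviation "GR \<equiv> assoc_graded H Fil"

definition symbol :: "(gm1 \<Rightarrow> nat list \<Rightarrow> complex) \<Rightarrow> nat \<Rightarrow> (gm1 \<Rightarrow> nat list \<Rightarrow> complex) set set" where
  "symbol f = Hf.cls (\<lambda>i. q (homog_part i f))"

lemma q_homog_part_Fil: "f \<in> carrier TG \<Longrightarrow> q (homog_part i f) \<in> Fil i"
  by (simp add: Fil_eq homog_part_TG_le)

lemma symbol_hom: "symbol \<in> alg_hom TG GR"
  unfolding symbol_def[abs_def]
  by (rule Hf.graded_hom[OF TG.complex_algebra_axioms q_hom])
    (auto simp: q_homog_part_Fil homog_part_finite homog_part_one homog_part_add homog_part_smult homog_part_mult)

text \<open>
  A representative of a class in degree \<open>i\<close> may be replaced by its homogeneous part of degree \<open>i\<close>, since the difference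
  has lower degree; the sum of these parts is a preimage.
\<close>

lemma symbol_surj: "symbol ` carrier TG = carrier GR"
proof (intro equalityI subsetI)
  fix X assume "X \<in> symbol ` carrier TG"
  then show "X \<in> carrier GR" using alg_hom_closed[OF symbol_hom] by blast
next
  fix X assume "X \<in> carrier GR"
  then have X: "\<And>i. \<exists>a\<in>Fil i. X i = Hf.below i +>\<^bsub>H\<^esub> a" and fin: "finite {i. X i \<noteq> Hf.below i}"
    by (auto simp: assoc_graded_def)
  have "\<exists>f. f \<in> TG_le i \<and> X i = Hf.below i +>\<^bsub>H\<^esub> q f" for i
    using X[of i] by (auto simp: Fil_eq)
  then obtain f where f: "\<And>i. f i \<in> TG_le i" "\<And>i. X i = Hf.below i +>\<^bsub>H\<^esub> q (f i)" by metis
  let ?S = "{i. X i \<noteq> Hf.below i}"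
  define h where "h = (\<Oplus>\<^bsub>TG\<^esub>i\<in>?S. homog_part i (f i))"
  have fc: "f i \<in> carrier TG" for i using f TG_le_carrier by blast
  have h: "h \<in> carrier TG" unfolding h_def by (rule TG.finsum_closed) (use fc in auto)
  have hk: "homog_part k h = (if k \<in> ?S then homog_part k (f k) else \<zero>\<^bsub>TG\<^esub>)" for k
  proof -
    have "homog_part k (\<Oplus>\<^bsub>TG\<^esub>i\<in>S. homog_part i (f i)) = (\<Oplus>\<^bsub>TG\<^esub>i\<in>S. homog_part k (homog_part i (f i)))" if "finite S" for S
      using that
    proof (induct S rule: finite_induct)
      case empty
      have "homog_part k \<zero>\<^bsub>TG\<^esub> = \<zero>\<^bsub>TG\<^esub>" by (auto simp: homog_part_def TG_apply fun_eq_iff)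
      then show ?case by simp
    next
      case (insert i S)
      then show ?case using fc by (simp add: homog_part_add Pi_iff)
    qed
    then have eq: "homog_part k h = (\<Oplus>\<^bsub>TG\<^esub>i\<in>?S. homog_part k (homog_part i (f i)))" unfolding h_def using fin .
    show ?thesis
    proof (cases "k \<in> ?S")
      case True
      have "(\<Oplus>\<^bsub>TG\<^esub>i\<in>?S. homog_part k (homog_part i (f i))) = homog_part k (homog_part k (f k))"
        by (rule TG.finsum_single[OF fin True]) (use fc in \<open>auto simp: homog_part_homog_part\<close>)
      then show ?thesis using True eq by (simp add: homog_part_homog_part)
    next
      case False
      have "(\<Oplus>\<^bsub>TG\<^esub>i\<in>?S. homog_part k (homog_part i (f i))) = \<zero>\<^bsub>TG\<^esub>"
        by (rule TG.add.finprod_one_eqI) (use False in \<open>auto simp: homog_part_homog_part\<close>)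
      then show ?thesis using False eq by simp
    qed
  qed
  have "symbol h = X"
  proof
    fix k
    show "symbol h k = X k"
    proof (cases "k \<in> ?S")
      case False
      then show ?thesis by (simp add: symbol_def Hf.cls_def hk q_zero Hf.below_coset_zero)
    next
      case True
      define d where "d = homog_part k (f k) \<ominus>\<^bsub>TG\<^esub> f k"
      have d: "d \<in> carrier TG" using fc by (simp add: d_def)
      have d': "d = homog_part k (f k) \<oplus>\<^bsub>TG\<^esub> (- 1) \<odot>\<^bsub>TG\<^esub> f k" using fc by (simp add: d_def a_minus_def)
      have dl: "homog_part j d = \<zero>\<^bsub>TG\<^esub>" if "j \<ge> k" for j
      proof (cases "j = k")
        case True
        then show ?thesis by (auto simp: d' homog_part_def TG_apply fun_eq_iff)
      next
        case False
        then have "homog_part j (f k) = \<zero>\<^bsub>TG\<^esub>" using f(1)[of k] that by (simp add: TG_le_iff)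
        then show ?thesis using False unfolding d' by (simp add: homog_part_add homog_part_smult homog_part_homog_part)
      qed
      have "q d \<in> Hf.below k"
      proof (cases k)
        case 0
        have "d = \<zero>\<^bsub>TG\<^esub>"
        proof (rule TG_eqI[OF d])
          fix g w assume g: "g \<in> carrier G"
          have "homog_part (length w) d g w = 0" using dl[of "length w"] 0 g by (simp add: TG_apply)
          then show "d g w = \<zero>\<^bsub>TG\<^esub> g w" using g by (simp add: homog_part_def TG_apply)
        qed simp
        then show ?thesis using 0 q_zero by (simp add: Hf.below_simps)
      next
        case (Suc l)
        have "d \<in> TG_le l" using d dl Suc by (auto simp: TG_le_iff)
        then show ?thesis using Suc by (auto simp: Hf.below_simps Fil_eq)
      qed
      then have "q (homog_part k (f k)) \<ominus>\<^bsub>H\<^esub> q (f k) \<in> Hf.below k"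
        using fc unfolding d_def by (simp add: q_minus)
      then show ?thesis
        using True fc by (simp add: symbol_def Hf.cls_def hk f(2) Hf.below_coset_eq_iff)
    qed
  qed
  then show "X \<in> symbol ` carrier TG" using h by blast
qed

end

section \<open>The map to the semidirect product with the symmetric algebra\<close>

context gm1
begin

abbreviation "SI \<equiv> sym_ideal n"
abbreviation "SA \<equiv> sym_algebra n"

definition sym_rel :: "complex vec \<Rightarrow> complex vec \<Rightarrow> nat list \<Rightarrow> complex" where
  "sym_rel u v = tensor_vec u \<otimes>\<^bsub>T\<^esub> tensor_vec v \<ominus>\<^bsub>T\<^esub> tensor_vec v \<otimes>\<^bsub>T\<^esub> tensor_vec u"

lemma SI_eq: "SI = Idl\<^bsub>T\<^esub> {sym_rel u v | u v. u \<in> carrier_vec n \<and> v \<in> carrier_vec n}"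
  by (simp add: sym_ideal_def sym_rel_def Let_def)

lemma sym_rels_subset: "{sym_rel u v | u v. u \<in> carrier_vec n \<and> v \<in> carrier_vec n} \<subseteq> carrier T"
  unfolding sym_rel_def using tensor_vec_closed by auto

lemma SI_ideal: "ideal SI T"
  unfolding SI_eq by (rule sd.T.genideal_ideal[OF sym_rels_subset])

lemma SA_eq: "SA = quot_algebra T SI"
  by (simp add: sym_algebra_def)

sublocale SA: complex_algebra SA
  unfolding SA_eq by (rule sd.T.quot_algebra_complex_algebra[OF SI_ideal])

abbreviation "sq t \<equiv> SI +>\<^bsub>T\<^esub> t"

lemma sq_hom: "sq \<in> alg_hom T SA"
  unfolding SA_eq by (rule sd.T.quot_proj_hom[OF SI_ideal])

lemma sq_surj: "(\<lambda>t. sq t) ` carrier T = carrier SA"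
  by (simp add: SA_eq sd.T.quot_algebra_simps[OF SI_ideal])

lemma sq_eq_iff: "s \<in> carrier T \<Longrightarrow> t \<in> carrier T \<Longrightarrow> sq s = sq t \<longleftrightarrow> s \<ominus>\<^bsub>T\<^esub> t \<in> SI"
  by (rule sd.T.quot_algebra_eq_iff[OF SI_ideal])

lemma sq_zero: "sq \<zero>\<^bsub>T\<^esub> = \<zero>\<^bsub>SA\<^esub>"
  by (rule alg_hom_zero[OF sd.T.complex_algebra_axioms SA.complex_algebra_axioms sq_hom])

lemma sq_zero_iff: "t \<in> carrier T \<Longrightarrow> sq t = \<zero>\<^bsub>SA\<^esub> \<longleftrightarrow> t \<in> SI"
  using sq_eq_iff[of t "\<zero>\<^bsub>T\<^esub>"] by (simp add: sq_zero a_minus_def)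

lemma SI_carrier: "t \<in> SI \<Longrightarrow> t \<in> carrier T"
  by (rule ideal.Icarr[OF SI_ideal])

lemma sym_rel_SI: "u \<in> carrier_vec n \<Longrightarrow> v \<in> carrier_vec n \<Longrightarrow> sym_rel u v \<in> SI"
  unfolding SI_eq by (rule sd.T.genideal_self[OF sym_rels_subset, THEN subsetD]) blast

lemma sq_tensor_commute:
  assumes "u \<in> carrier_vec n" "v \<in> carrier_vec n"
  shows "sq (tensor_vec u) \<otimes>\<^bsub>SA\<^esub> sq (tensor_vec v) = sq (tensor_vec v) \<otimes>\<^bsub>SA\<^esub> sq (tensor_vec u)"
  using sym_rel_SI[OF assms] sq_eq_iff[of "tensor_vec u \<otimes>\<^bsub>T\<^esub> tensor_vec v" "tensor_vec v \<otimes>\<^bsub>T\<^esub> tensor_vec u"]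
  by (simp add: sym_rel_def tensor_vec_closed assms flip: alg_hom_mult[OF sq_hom])

lemma sq_letter_commute: "i < n \<Longrightarrow> j < n \<Longrightarrow>
    sq (letter i) \<otimes>\<^bsub>SA\<^esub> sq (letter j) = sq (letter j) \<otimes>\<^bsub>SA\<^esub> sq (letter i)"
  using sq_tensor_commute[of "unit_vec n i" "unit_vec n j"] by (simp add: tensor_vec_unit)

lemma sq_monomial_Cons:
  assumes "i < n" "u \<in> lists {..<n}"
  shows "sq (monomial c (i # u)) = sq (letter i) \<otimes>\<^bsub>SA\<^esub> sq (monomial c u)"
proof -
  have "monomial c (i # u) = letter i \<otimes>\<^bsub>T\<^esub> monomial c u"
    by (simp add: letter_eq_monomial tensor_algebra_simps conv_monomial)
  then show ?thesis using assms by (simp add: alg_hom_mult[OF sq_hom])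
qed

lemma sq_closed [simp, intro]: "t \<in> carrier T \<Longrightarrow> sq t \<in> carrier SA"
  by (rule alg_hom_closed[OF sq_hom])

text \<open>
  The letter is moved to the front by commuting it with one letter of \<open>u\<close> after the other.
\<close>

lemma sq_monomial_move:
  assumes "i < n" "u \<in> lists {..<n}" "v \<in> lists {..<n}"
  shows "sq (monomial c (u @ i # v)) = sq (monomial c (i # u @ v))"
  using assms(2)
proof (induct u)
  case (Cons j u)
  then have j: "j < n" "u \<in> lists {..<n}" by auto
  have "sq (monomial c ((j # u) @ i # v)) = sq (letter j) \<otimes>\<^bsub>SA\<^esub> sq (monomial c (i # u @ v))"
    using Cons j assms by (simp add: sq_monomial_Cons del: Cons_in_lists_iff)
  also have "\<dots> = sq (letter i) \<otimes>\<^bsub>SA\<^esub> sq (letter j) \<otimes>\<^bsub>SA\<^esub> sq (monomial c (u @ v))"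
    using j assms by (simp add: sq_monomial_Cons sq_letter_commute[of i j] flip: SA.m_assoc)
  also have "\<dots> = sq (monomial c (i # (j # u) @ v))"
    using j assms by (simp add: sq_monomial_Cons SA.m_assoc)
  finally show ?case .
qed simp

lemma sq_monomial_perm:
  "u \<in> lists {..<n} \<Longrightarrow> mset u = mset v \<Longrightarrow> sq (monomial c u) = sq (monomial c v)"
proof (induct u arbitrary: v)
  case (Cons i u)
  then have i: "i < n" "u \<in> lists {..<n}" by auto
  have "i \<in> set v" using Cons(3) by (metis list.set_intros(1) set_mset_mset)
  then obtain v1 v2 where v: "v = v1 @ i # v2" by (meson split_list)
  have "set v = set (i # u)" using Cons(3) by (metis set_mset_mset)
  then have vl: "v1 \<in> lists {..<n}" "v2 \<in> lists {..<n}" using Cons(2) v by auto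
  have "mset u = mset (v1 @ v2)" using Cons(3) v by simp
  then have "sq (monomial c u) = sq (monomial c (v1 @ v2))" using Cons(1) i by blast
  then have "sq (monomial c (i # u)) = sq (monomial c (i # v1 @ v2))"
    using i vl by (simp add: sq_monomial_Cons)
  also have "\<dots> = sq (monomial c v)" unfolding v using sq_monomial_move[OF i(1) vl] by simp
  finally show ?case .
qed simp

text \<open>
  The coefficient of a monomial in the image of \<open>t\<close> in the commutative polynomial ring.
\<close>

definition mset_sum :: "(nat list \<Rightarrow> complex) \<Rightarrow> nat multiset \<Rightarrow> complex" where
  "mset_sum t \<mu> = (\<Sum>w | mset w = \<mu>. t w)"

lemma finite_mset_eq: "finite {w. mset w = \<mu>}"
proof (rule finite_subset)
  show "{w. mset w = \<mu>} \<subseteq> {w. set w \<subseteq> set_mset \<mu> \<and> length w = size \<mu>}" by auto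
qed (rule finite_lists_length_eq, simp)

text \<open>
  Modulo the ideal every word equals its sorted version.  So \<open>t\<close> is congruent to the combination of sorted words with
  coefficients \<open>mset_sum t\<close>.
\<close>

lemma sym_ideal_criterion:
  assumes t: "t \<in> carrier T" and zero: "\<And>\<mu>. mset_sum t \<mu> = 0"
  shows "t \<in> SI"
proof -
  \<comment> \<open>The normal form of \<open>t\<close>, a combination of sorted words.\<close>
  let ?N = "\<lambda>t w. if sorted w then mset_sum t (mset w) else 0"
  have "?N t \<in> carrier T \<and> sq t = sq (?N t)"
    using t unfolding tensor_algebra_simps
  proof (induct t rule: free_algebra_induct)
    case (monomial c u)
    have "mset_sum (monomial c u) \<mu> = (if \<mu> = mset u then c else 0)" for \<mu>
      using finite_mset_eq[of \<mu>] by (auto simp: mset_sum_def monomial_def)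
    then have "?N (monomial c u) = monomial c (sort u)"
      by (auto simp: monomial_def fun_eq_iff dest: properties_for_sort)
    moreover have "monomial c (sort u) \<in> carrier T" using monomial by (intro monomial_T) auto
    ultimately show ?case
      using monomial sq_monomial_perm[of u "sort u" c] by (simp add: tensor_algebra_simps[symmetric])
  next
    case (add f g)
    have fg: "f \<in> carrier T" "g \<in> carrier T" "?N f \<in> carrier T" "?N g \<in> carrier T"
      using add by (simp_all add: tensor_algebra_simps)
    have "?N (\<lambda>w. f w + g w) = ?N f \<oplus>\<^bsub>T\<^esub> ?N g"
      by (auto simp: tensor_algebra_simps free_algebra_simps mset_sum_def sum.distrib)
    moreover have "(\<lambda>w. f w + g w) = f \<oplus>\<^bsub>T\<^esub> g" by (simp add: tensor_algebra_simps free_algebra_simps)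
    ultimately show ?case
      using fg add by (simp add: alg_hom_add[OF sq_hom] flip: tensor_algebra_simps)
  qed
  moreover have "?N t = \<zero>\<^bsub>T\<^esub>" using zero by (simp add: tensor_algebra_simps free_algebra_simps fun_eq_iff)
  ultimately show ?thesis using sq_zero_iff[OF t] sq_zero by simp
qed

lemma tact_tensor_vec:
  assumes x: "x \<in> carrier G" and u: "u \<in> carrier_vec n"
  shows "\<exists>u'\<in>carrier_vec n. tact x (tensor_vec u) = tensor_vec u'"
proof
  let ?u = "vec n (\<lambda>i. u $ inv_into UNIV (fst x) i)"
  have "inv_into UNIV (fst x) i < n \<longleftrightarrow> i < n" for i
    using permutes_less[OF permutes_inv[OF Gm1_fst_permutes[OF x]]] by simp
  then show "tact x (tensor_vec u) = tensor_vec ?u"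
    using u by (auto simp: tact_apply[OF x] tensor_vec_def fun_eq_iff split: list.splits)
qed simp

text \<open>
  The action maps commutators of vectors to commutators of vectors.
\<close>

lemma tact_SI:
  assumes x: "x \<in> carrier G" and t: "t \<in> SI"
  shows "tact x t \<in> SI"
proof -
  note hom = alg_hom_comp[OF tact_hom[OF x] sq_hom]
  have "sq (tact x t) = \<zero>\<^bsub>SA\<^esub>"
  proof (rule alg_hom_kills_genideal[OF sd.T.complex_algebra_axioms SA.complex_algebra_axioms hom sym_rels_subset _ t[unfolded SI_eq]])
    fix s assume "s \<in> {sym_rel u v | u v. u \<in> carrier_vec n \<and> v \<in> carrier_vec n}"
    then obtain u v where uv: "u \<in> carrier_vec n" "v \<in> carrier_vec n" "s = sym_rel u v" by blast
    obtain u' v' where uv': "u' \<in> carrier_vec n" "tact x (tensor_vec u) = tensor_vec u'"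
      "v' \<in> carrier_vec n" "tact x (tensor_vec v) = tensor_vec v'"
      using tact_tensor_vec[OF x] uv by metis
    have "tact x s = sym_rel u' v'"
      unfolding uv(3) sym_rel_def uv'(2,4)[symmetric] using uv tensor_vec_closed
      by (simp add: alg_hom_minus[OF sd.T.complex_algebra_axioms sd.T.complex_algebra_axioms tact_hom[OF x]]
          alg_hom_mult[OF tact_hom[OF x]])
    then show "sq (tact x s) = \<zero>\<^bsub>SA\<^esub>"
      using sym_rel_SI[OF uv'(1,3)] sq_zero_iff[OF SI_carrier] by simp
  qed
  then show ?thesis using sq_zero_iff[of "tact x t"] sd.act_closed[OF x SI_carrier[OF t]] by simp
qed

lemma sym_act_sq:
  assumes x: "x \<in> carrier G" and t: "t \<in> carrier T"
  shows "sym_act n (perm_rep n x) (sq t) = sq (tact x t)"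
proof (intro equalityI subsetI)
  fix y assume "y \<in> sym_act n (perm_rep n x) (sq t)"
  then have "\<exists>i\<in>SI. y = tact x (i \<oplus>\<^bsub>T\<^esub> t)" by (auto simp: sym_act_def a_r_coset_def')
  then obtain i where i: "i \<in> SI" "y = tact x (i \<oplus>\<^bsub>T\<^esub> t)" ..
  then have "y = tact x i \<oplus>\<^bsub>T\<^esub> tact x t" using t SI_carrier alg_hom_add[OF tact_hom[OF x]] by simp
  then show "y \<in> sq (tact x t)" using tact_SI[OF x i(1)] unfolding a_r_coset_def' by blast
next
  fix y assume "y \<in> sq (tact x t)"
  then have "\<exists>i\<in>SI. y = i \<oplus>\<^bsub>T\<^esub> tact x t" by (simp add: a_r_coset_def')
  then obtain i where i: "i \<in> SI" "y = i \<oplus>\<^bsub>T\<^esub> tact x t" ..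
  define j where "j = tact (inv\<^bsub>G\<^esub> x) i"
  have j: "j \<in> SI" unfolding j_def using i x by (intro tact_SI) auto
  have "tact x j = i"
    unfolding j_def using x i SI_carrier sd.act_mult[of x "inv\<^bsub>G\<^esub> x" i] sd.act_one[of i] by simp
  then have "y = tact x (j \<oplus>\<^bsub>T\<^esub> t)"
    using i j t SI_carrier alg_hom_add[OF tact_hom[OF x], of j t] by simp
  moreover have "j \<oplus>\<^bsub>T\<^esub> t \<in> sq t" using j unfolding a_r_coset_def' by blast
  ultimately show "y \<in> sym_act n (perm_rep n x) (sq t)" unfolding sym_act_def by blast
qed

abbreviation "SG \<equiv> sym_semidirect G n (perm_rep n)"

lemma SG_eq: "SG = semidirect_algebra G SA (\<lambda>g. sym_act n (perm_rep n g))"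
  by (simp add: sym_semidirect_def)

definition to_sym :: "(gm1 \<Rightarrow> nat list \<Rightarrow> complex) \<Rightarrow> gm1 \<Rightarrow> (nat list \<Rightarrow> complex) set" where
  "to_sym f = (\<lambda>g\<in>carrier G. sq (f g))"

lemma to_sym_hom: "to_sym \<in> alg_hom TG SG"
proof (rule alg_homI)
  fix f f' and c assume f: "f \<in> carrier TG"
  note [simp] = TG_apply_closed[OF f]
  show "to_sym f \<in> carrier SG" by (auto simp: SG_eq semidirect_algebra_simps to_sym_def)
  show "to_sym (c \<odot>\<^bsub>TG\<^esub> f) = c \<odot>\<^bsub>SG\<^esub> to_sym f"
    by (auto simp: to_sym_def TG_eq SG_eq semidirect_algebra_simps alg_hom_smult[OF sq_hom] fun_eq_iff restrict_def)
  assume f': "f' \<in> carrier TG"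
  note [simp] = TG_apply_closed[OF f']
  show "to_sym (f \<oplus>\<^bsub>TG\<^esub> f') = to_sym f \<oplus>\<^bsub>SG\<^esub> to_sym f'"
    by (auto simp: to_sym_def TG_eq SG_eq semidirect_algebra_simps alg_hom_add[OF sq_hom] fun_eq_iff restrict_def)
  show "to_sym (f \<otimes>\<^bsub>TG\<^esub> f') = to_sym f \<otimes>\<^bsub>SG\<^esub> to_sym f'"
  proof
    fix x
    show "to_sym (f \<otimes>\<^bsub>TG\<^esub> f') x = (to_sym f \<otimes>\<^bsub>SG\<^esub> to_sym f') x"
    proof (cases "x \<in> carrier G")
      case x: True
      have "to_sym (f \<otimes>\<^bsub>TG\<^esub> f') x = sq (\<Oplus>\<^bsub>T\<^esub>g\<in>carrier G. f g \<otimes>\<^bsub>T\<^esub> tact g (f' (inv\<^bsub>G\<^esub> g \<otimes>\<^bsub>G\<^esub> x)))"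
        using x by (simp add: to_sym_def TG_eq semidirect_algebra_simps)
      also have "\<dots> = (\<Oplus>\<^bsub>SA\<^esub>g\<in>carrier G. sq (f g \<otimes>\<^bsub>T\<^esub> tact g (f' (inv\<^bsub>G\<^esub> g \<otimes>\<^bsub>G\<^esub> x))))"
        by (rule alg_hom_finsum[OF sd.T.complex_algebra_axioms SA.complex_algebra_axioms sq_hom]) (use x in auto)
      also have "\<dots> = (\<Oplus>\<^bsub>SA\<^esub>g\<in>carrier G. to_sym f g \<otimes>\<^bsub>SA\<^esub> sym_act n (perm_rep n g) (to_sym f' (inv\<^bsub>G\<^esub> g \<otimes>\<^bsub>G\<^esub> x)))"
        by (rule SA.add.finprod_cong') (use x in \<open>auto simp: to_sym_def alg_hom_mult[OF sq_hom] sym_act_sq\<close>)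
      also have "\<dots> = (to_sym f \<otimes>\<^bsub>SG\<^esub> to_sym f') x" using x by (simp add: SG_eq semidirect_algebra_simps)
      finally show ?thesis .
    qed (simp add: to_sym_def SG_eq semidirect_algebra_simps)
  qed
next
  show "to_sym \<one>\<^bsub>TG\<^esub> = \<one>\<^bsub>SG\<^esub>"
    by (auto simp: to_sym_def TG_eq SG_eq semidirect_algebra_simps mon_elt_def alg_hom_one[OF sq_hom] sq_zero fun_eq_iff restrict_def)
qed

lemma to_sym_surj: "to_sym ` carrier TG = carrier SG"
proof (intro equalityI subsetI)
  fix X assume "X \<in> to_sym ` carrier TG"
  then show "X \<in> carrier SG" using alg_hom_closed[OF to_sym_hom] by blast
next
  fix X assume "X \<in> carrier SG"
  then have X: "X \<in> carrier G \<rightarrow>\<^sub>E carrier SA" by (simp add: SG_eq semidirect_algebra_simps)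
  then have "\<forall>g\<in>carrier G. \<exists>t\<in>carrier T. X g = sq t" using sq_surj by blast
  then obtain f where f: "\<And>g. g \<in> carrier G \<Longrightarrow> f g \<in> carrier T \<and> X g = sq (f g)" by metis
  then have "restrict f (carrier G) \<in> carrier TG" by (simp add: TG_carrier)
  moreover have "to_sym (restrict f (carrier G)) = X"
    using f X by (auto simp: to_sym_def fun_eq_iff PiE_iff extensional_def restrict_def)
  ultimately show "X \<in> to_sym ` carrier TG" by blast
qed

lemma to_sym_eq_iff:
  assumes "f \<in> carrier TG" "f' \<in> carrier TG"
  shows "to_sym f = to_sym f' \<longleftrightarrow> (\<forall>g\<in>carrier G. (f \<ominus>\<^bsub>TG\<^esub> f') g \<in> SI)"
proof -
  have "(f \<ominus>\<^bsub>TG\<^esub> f') g = f g \<ominus>\<^bsub>T\<^esub> f' g" if g: "g \<in> carrier G" for g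
  proof -
    have eq: "f \<ominus>\<^bsub>TG\<^esub> f' = f \<oplus>\<^bsub>TG\<^esub> (- 1) \<odot>\<^bsub>TG\<^esub> f'" using assms by (simp add: a_minus_def)
    have "(f \<oplus>\<^bsub>TG\<^esub> (- 1) \<odot>\<^bsub>TG\<^esub> f') g = f g \<oplus>\<^bsub>T\<^esub> (- 1) \<odot>\<^bsub>T\<^esub> f' g"
      using g by (simp only: TG_eq semidirect_algebra_simps restrict_apply if_True)
    then show ?thesis unfolding eq using TG_apply_closed[OF assms(2) g] by (simp add: a_minus_def)
  qed
  moreover have "to_sym f = to_sym f' \<longleftrightarrow> (\<forall>g\<in>carrier G. sq (f g) = sq (f' g))"
    by (auto simp: to_sym_def fun_eq_iff restrict_def)
  ultimately show ?thesis using sq_eq_iff TG_apply_closed assms by simp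
qed

lemma to_sym_group_elt: "to_sym (gelt g) = group_elt G SA g"
  by (auto simp: to_sym_def group_elt_def alg_hom_one[OF sq_hom] sq_zero fun_eq_iff restrict_def)

lemma to_sym_vec_elt: "to_sym (vec_elt v) = alg_elt G SA (sym_vec n v)"
  by (auto simp: to_sym_def alg_elt_def sym_vec_def sq_zero fun_eq_iff restrict_def)

end

section \<open>A representation and the PBW property\<close>

text \<open>
  Linear operators on the functions on \<open>P\<close>.  To avoid a type that depends on \<open>P\<close>, functions on the whole type are used,
  and an operator ignores the values outside \<open>P\<close> and produces functions that vanish there.  The identity of this algebra is
  therefore the restriction to \<open>P\<close>.
\<close>

definition operator_algebra :: "'s set \<Rightarrow> (complex, ('s \<Rightarrow> complex) \<Rightarrow> 's \<Rightarrow> complex) module" where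
  "operator_algebra P = \<lparr>
     carrier = {T. (\<forall>\<Phi> \<Phi>'. T (\<lambda>s. \<Phi> s + \<Phi>' s) = (\<lambda>s. T \<Phi> s + T \<Phi>' s)) \<and>
                   (\<forall>c \<Phi>. T (\<lambda>s. c * \<Phi> s) = (\<lambda>s. c * T \<Phi> s)) \<and>
                   (\<forall>\<Phi>. T (\<lambda>s. if s \<in> P then \<Phi> s else 0) = T \<Phi>) \<and>
                   (\<forall>\<Phi> s. s \<notin> P \<longrightarrow> T \<Phi> s = 0)},
     monoid.mult = (\<lambda>T T' \<Phi>. T (T' \<Phi>)),
     one = (\<lambda>\<Phi> s. if s \<in> P then \<Phi> s else 0),
     zero = (\<lambda>\<Phi> s. 0),
     add = (\<lambda>T T' \<Phi> s. T \<Phi> s + T' \<Phi> s),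
     smult = (\<lambda>c T \<Phi> s. c * T \<Phi> s)\<rparr>"

lemma operator_algebra_simps:
  "U \<in> carrier (operator_algebra P) \<longleftrightarrow>
     (\<forall>\<Phi> \<Phi>'. U (\<lambda>s. \<Phi> s + \<Phi>' s) = (\<lambda>s. U \<Phi> s + U \<Phi>' s)) \<and>
     (\<forall>c \<Phi>. U (\<lambda>s. c * \<Phi> s) = (\<lambda>s. c * U \<Phi> s)) \<and>
     (\<forall>\<Phi>. U (\<lambda>s. if s \<in> P then \<Phi> s else 0) = U \<Phi>) \<and>
     (\<forall>\<Phi> s. s \<notin> P \<longrightarrow> U \<Phi> s = 0)"
  "U \<otimes>\<^bsub>operator_algebra P\<^esub> U' = (\<lambda>\<Phi>. U (U' \<Phi>))"
  "\<one>\<^bsub>operator_algebra P\<^esub> = (\<lambda>\<Phi> s. if s \<in> P then \<Phi> s else 0)"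
  "\<zero>\<^bsub>operator_algebra P\<^esub> = (\<lambda>\<Phi> s. 0)"
  "U \<oplus>\<^bsub>operator_algebra P\<^esub> U' = (\<lambda>\<Phi> s. U \<Phi> s + U' \<Phi> s)"
  "c \<odot>\<^bsub>operator_algebra P\<^esub> U = (\<lambda>\<Phi> s. c * U \<Phi> s)"
  by (simp_all add: operator_algebra_def)

lemma operator_algebraI:
  assumes "\<And>\<Phi> \<Phi>' s. s \<in> P \<Longrightarrow> U (\<lambda>s. \<Phi> s + \<Phi>' s) s = U \<Phi> s + U \<Phi>' s"
    and "\<And>c \<Phi> s. s \<in> P \<Longrightarrow> U (\<lambda>s. c * \<Phi> s) s = c * U \<Phi> s"
    and "\<And>\<Phi> s. s \<in> P \<Longrightarrow> U (\<lambda>s. if s \<in> P then \<Phi> s else 0) s = U \<Phi> s"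
    and "\<And>\<Phi> s. s \<notin> P \<Longrightarrow> U \<Phi> s = 0"
  shows "U \<in> carrier (operator_algebra P)"
  unfolding operator_algebra_simps fun_eq_iff
proof (intro conjI allI impI)
  fix \<Phi> \<Phi>' s c
  show "U (\<lambda>s. \<Phi> s + \<Phi>' s) s = U \<Phi> s + U \<Phi>' s" by (cases "s \<in> P") (simp_all add: assms)
  show "U (\<lambda>s. c * \<Phi> s) s = c * U \<Phi> s" by (cases "s \<in> P") (simp_all add: assms)
  show "U (\<lambda>s. if s \<in> P then \<Phi> s else 0) s = U \<Phi> s" by (cases "s \<in> P") (simp_all add: assms)
qed (simp add: assms)

lemma operator_algebra_eqI:
  assumes "U \<in> carrier (operator_algebra P)" "U' \<in> carrier (operator_algebra P)"
    and "\<And>\<Phi> s. s \<in> P \<Longrightarrow> U \<Phi> s = U' \<Phi> s"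
  shows "U = U'"
  using assms unfolding operator_algebra_simps fun_eq_iff by metis

lemma operator_algebra_complex_algebra: "complex_algebra (operator_algebra P)"
proof (rule complex_algebraI)
  let ?B = "operator_algebra P"
  fix U V :: "('a \<Rightarrow> complex) \<Rightarrow> 'a \<Rightarrow> complex" and c
  assume U: "U \<in> carrier ?B"
  note u = U[unfolded operator_algebra_simps(1)]
  show "c \<odot>\<^bsub>?B\<^esub> U \<in> carrier ?B" using u by (simp add: operator_algebra_simps algebra_simps)
  have "(\<lambda>s. if s \<in> P then U \<Phi> s else 0) = U \<Phi>" for \<Phi> using u by (auto simp: fun_eq_iff)
  then show "\<one>\<^bsub>?B\<^esub> \<otimes>\<^bsub>?B\<^esub> U = U" by (simp add: operator_algebra_simps)
  show "U \<otimes>\<^bsub>?B\<^esub> \<one>\<^bsub>?B\<^esub> = U" using u by (simp add: operator_algebra_simps)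
  assume V: "V \<in> carrier ?B"
  note v = V[unfolded operator_algebra_simps(1)]
  show "U \<oplus>\<^bsub>?B\<^esub> V \<in> carrier ?B" using u v by (simp add: operator_algebra_simps algebra_simps)
  show "U \<otimes>\<^bsub>?B\<^esub> V \<in> carrier ?B" using u v by (simp add: operator_algebra_simps)
next
  show "\<one>\<^bsub>operator_algebra P\<^esub> \<in> carrier (operator_algebra P)"
    by (auto simp: operator_algebra_simps fun_eq_iff)
qed (auto simp: operator_algebra_simps fun_eq_iff algebra_simps)

lemma operator_algebra_finsum:
  assumes "f \<in> S \<rightarrow> carrier (operator_algebra P)"
  shows "(\<Oplus>\<^bsub>operator_algebra P\<^esub>i\<in>S. f i) \<Phi> s = (\<Sum>i\<in>S. f i \<Phi> s)"
proof -
  interpret B: complex_algebra "operator_algebra P" by (rule operator_algebra_complex_algebra)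
  show ?thesis
    using assms by (induct S rule: infinite_finite_induct) (simp_all add: operator_algebra_simps(4,5) Pi_iff)
qed

context gm1_kappa
begin

abbreviation "states \<equiv> carrier G \<times> (UNIV :: nat multiset set)"
abbreviation "M \<equiv> operator_algebra states"

lemma M_complex_algebra: "complex_algebra M"
  by (rule operator_algebra_complex_algebra)

sublocale M: complex_algebra M by (rule M_complex_algebra)

text \<open>
  A function \<open>\<Phi>\<close> on pairs of a group element \<open>x\<close> and a multiset \<open>\<mu>\<close> of indices stands for the sum of the terms
  \<open>\<Phi> (x, \<mu>) z\<^sup>\<mu> \<otimes> x\<close> in \<open>S(V) \<otimes> \<complex>[G]\<close>; infinitely many monomials may occur.  The group acts diagonally, \<open>zop i\<close> multiplies by a
  variable, \<open>sop i j\<close> is the sign \<open>\<sigma>\<^sub>i\<^sub>j\<close>, and \<open>onep\<close> projects to the component of \<open>1 \<in> G\<close>.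
\<close>

definition gop :: "gm1 \<Rightarrow> (gm1 \<times> nat multiset \<Rightarrow> complex) \<Rightarrow> gm1 \<times> nat multiset \<Rightarrow> complex" where
  "gop g \<Phi> = (\<lambda>(x, \<mu>). if x \<in> carrier G
     then \<Phi> (inv\<^bsub>G\<^esub> g \<otimes>\<^bsub>G\<^esub> x, image_mset (fst (inv\<^bsub>G\<^esub> g)) \<mu>) else 0)"

definition zop :: "nat \<Rightarrow> (gm1 \<times> nat multiset \<Rightarrow> complex) \<Rightarrow> gm1 \<times> nat multiset \<Rightarrow> complex" where
  "zop i \<Phi> = (\<lambda>(x, \<mu>). if x \<in> carrier G \<and> i \<in># \<mu> then \<Phi> (x, \<mu> - {#i#}) else 0)"

definition sop :: "nat \<Rightarrow> nat \<Rightarrow> (gm1 \<times> nat multiset \<Rightarrow> complex) \<Rightarrow> gm1 \<times> nat multiset \<Rightarrow> complex" where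
  "sop i j \<Phi> = (\<lambda>(x, \<mu>). if x \<in> carrier G
     then sgn_ij (fst (inv\<^bsub>G\<^esub> x) i) (fst (inv\<^bsub>G\<^esub> x) j) * \<Phi> (x, \<mu>) else 0)"

definition onep :: "(gm1 \<times> nat multiset \<Rightarrow> complex) \<Rightarrow> gm1 \<times> nat multiset \<Rightarrow> complex" where
  "onep \<Phi> = (\<lambda>(x, \<mu>). if x = \<one>\<^bsub>G\<^esub> then \<Phi> (x, \<mu>) else 0)"

lemma gop_closed [simp, intro]: "g \<in> carrier G \<Longrightarrow> gop g \<in> carrier M"
  by (rule operator_algebraI) (auto simp: gop_def split: if_splits)

lemma zop_closed [simp, intro]: "zop i \<in> carrier M"
  by (rule operator_algebraI) (auto simp: zop_def split: if_splits)

lemma sop_closed [simp, intro]: "sop i j \<in> carrier M"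
  by (rule operator_algebraI) (auto simp: sop_def algebra_simps split: if_splits)

lemma onep_closed [simp, intro]: "onep \<in> carrier M"
  by (rule operator_algebraI) (use G.one_closed in \<open>auto simp: onep_def split: if_splits\<close>)

sublocale Mg: gm1_rep m n M gop
proof
  show "gop \<one>\<^bsub>G\<^esub> = \<one>\<^bsub>M\<^esub>"
    by (auto simp: gop_def operator_algebra_simps(3) fun_eq_iff Gm1_fst_one)
  fix x y assume xy: "x \<in> carrier G" "y \<in> carrier G"
  have "inv\<^bsub>G\<^esub> (x \<otimes>\<^bsub>G\<^esub> y) \<otimes>\<^bsub>G\<^esub> z = inv\<^bsub>G\<^esub> y \<otimes>\<^bsub>G\<^esub> (inv\<^bsub>G\<^esub> x \<otimes>\<^bsub>G\<^esub> z)" if "z \<in> carrier G" for z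
    using xy that by (simp add: G.inv_mult_group G.m_assoc)
  moreover have "image_mset (fst (inv\<^bsub>G\<^esub> (x \<otimes>\<^bsub>G\<^esub> y))) \<mu> =
      image_mset (fst (inv\<^bsub>G\<^esub> y)) (image_mset (fst (inv\<^bsub>G\<^esub> x)) \<mu>)" for \<mu>
    using xy by (simp add: G.inv_mult_group Gm1_fst_mult multiset.map_comp)
  ultimately have "gop (x \<otimes>\<^bsub>G\<^esub> y) \<Phi> (z, \<mu>) = (gop x \<otimes>\<^bsub>M\<^esub> gop y) \<Phi> (z, \<mu>)" for \<Phi> z \<mu>
    using xy by (simp add: gop_def operator_algebra_simps(2))
  then show "gop (x \<otimes>\<^bsub>G\<^esub> y) = gop x \<otimes>\<^bsub>M\<^esub> gop y"
    by (simp add: fun_eq_iff)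
qed auto

lemma fst_inv_cancel:
  assumes "x \<in> carrier G"
  shows "fst (inv\<^bsub>G\<^esub> x) (fst x i) = i" "fst x (fst (inv\<^bsub>G\<^esub> x) i) = i"
  using permutes_inverses[OF Gm1_fst_permutes[OF assms]] by (simp_all add: Gm1_fst_inv[OF assms])

lemma gop_zop:
  assumes x: "x \<in> carrier G"
  shows "gop x \<otimes>\<^bsub>M\<^esub> zop i = zop (fst x i) \<otimes>\<^bsub>M\<^esub> gop x"
proof (rule operator_algebra_eqI)
  fix \<Phi> and s :: "gm1 \<times> nat multiset" assume "s \<in> states"
  then obtain y \<mu> where s: "s = (y, \<mu>)" "y \<in> carrier G" by auto
  let ?w = "fst (inv\<^bsub>G\<^esub> x)"
  have inj: "inj ?w" using permutes_inj[OF Gm1_fst_permutes[of "inv\<^bsub>G\<^esub> x"]] x by simp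
  have "i = ?w a \<longleftrightarrow> a = fst x i" for a using fst_inv_cancel[OF x] by metis
  then have mem: "i \<in># image_mset ?w \<mu> \<longleftrightarrow> fst x i \<in># \<mu>" by (auto simp: image_iff)
  have diff: "image_mset ?w \<mu> - {#i#} = image_mset ?w (\<mu> - {#fst x i#})" if "fst x i \<in># \<mu>"
    using that fst_inv_cancel[OF x] by (simp add: image_mset_Diff)
  show "(gop x \<otimes>\<^bsub>M\<^esub> zop i) \<Phi> s = (zop (fst x i) \<otimes>\<^bsub>M\<^esub> gop x) \<Phi> s"
    using s x mem diff by (auto simp: operator_algebra_simps(2) gop_def zop_def)
qed (use x in auto)

text \<open>
  The sign compares the preimages of \<open>i\<close> and \<open>j\<close> under \<open>x\<close>, and these do not change if all of \<open>i\<close>, \<open>j\<close> and \<open>x\<close> are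
  multiplied by the same group element from the left.
\<close>

lemma gop_sop:
  assumes x: "x \<in> carrier G"
  shows "gop x \<otimes>\<^bsub>M\<^esub> sop i j = sop (fst x i) (fst x j) \<otimes>\<^bsub>M\<^esub> gop x"
proof (rule operator_algebra_eqI)
  fix \<Phi> and s :: "gm1 \<times> nat multiset" assume "s \<in> states"
  then obtain y \<mu> where s: "s = (y, \<mu>)" "y \<in> carrier G" by auto
  have "inv\<^bsub>G\<^esub> (inv\<^bsub>G\<^esub> x \<otimes>\<^bsub>G\<^esub> y) = inv\<^bsub>G\<^esub> y \<otimes>\<^bsub>G\<^esub> x" using s x by (simp add: G.inv_mult_group)
  then show "(gop x \<otimes>\<^bsub>M\<^esub> sop i j) \<Phi> s = (sop (fst x i) (fst x j) \<otimes>\<^bsub>M\<^esub> gop x) \<Phi> s"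
    using s x by (auto simp: operator_algebra_simps(2) gop_def sop_def Gm1_fst_mult)
qed (use x in auto)

text \<open>
  The image of \<open>v\<^sub>i\<close>.  It is left multiplication by \<open>v\<^sub>i\<close> on products of a group element \<open>x\<close> and a polynomial in the
  elements \<open>z\<^sub>j = v\<^sub>j - \<kappa> X\<^sub>j\<close> to the right of \<open>x\<close>: as \<open>v\<^sub>i x = x v\<^sub>j = x (z\<^sub>j + \<kappa> X\<^sub>j)\<close> for the preimage \<open>j\<close> of \<open>i\<close> under \<open>x\<close>,
  moving \<open>X\<^sub>j\<close> back to the left of \<open>x\<close> gives the signs of the preimages.
\<close>

definition vop :: "nat \<Rightarrow> (gm1 \<times> nat multiset \<Rightarrow> complex) \<Rightarrow> gm1 \<times> nat multiset \<Rightarrow> complex" where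
  "vop i = zop i \<oplus>\<^bsub>M\<^esub> \<kappa> \<odot>\<^bsub>M\<^esub> (\<Oplus>\<^bsub>M\<^esub>j\<in>{..<n} - {i}. Mg.tau i j \<otimes>\<^bsub>M\<^esub> sop i j)"

sublocale Mv: gm1_equivariant m n M gop vop
proof
  show "vop i \<in> carrier M" if "i < n" for i unfolding vop_def using that by auto
  fix x i assume x: "x \<in> carrier G" and i: "i < n"
  have fi: "fst x i < n" using i Gm1_fst_less[OF x] by simp
  have bij: "bij_betw (fst x) ({..<n} - {i}) ({..<n} - {fst x i})"
  proof -
    have "bij_betw (fst x) {..<n} {..<n}" by (rule permutes_imp_bij[OF Gm1_fst_permutes[OF x]])
    then show ?thesis using i fi by (intro bij_betw_DiffI) auto
  qed
  have "gop x \<otimes>\<^bsub>M\<^esub> (\<Oplus>\<^bsub>M\<^esub>j\<in>{..<n} - {i}. Mg.tau i j \<otimes>\<^bsub>M\<^esub> sop i j) =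
    (\<Oplus>\<^bsub>M\<^esub>j\<in>{..<n} - {i}. gop x \<otimes>\<^bsub>M\<^esub> (Mg.tau i j \<otimes>\<^bsub>M\<^esub> sop i j))"
    by (rule M.finsum_mult_right) (use x i in auto)
  also have "\<dots> = (\<Oplus>\<^bsub>M\<^esub>j\<in>{..<n} - {i}. (Mg.tau (fst x i) (fst x j) \<otimes>\<^bsub>M\<^esub> sop (fst x i) (fst x j)) \<otimes>\<^bsub>M\<^esub> gop x)"
  proof (rule M.add.finprod_cong')
    fix j assume j: "j \<in> {..<n} - {i}"
    have fj: "fst x j < n" "fst x i \<noteq> fst x j" using j Gm1_fst_less[OF x] Gm1_fst_inj[OF x] by auto
    have "gop x \<otimes>\<^bsub>M\<^esub> (Mg.tau i j \<otimes>\<^bsub>M\<^esub> sop i j) = (gop x \<otimes>\<^bsub>M\<^esub> Mg.tau i j) \<otimes>\<^bsub>M\<^esub> sop i j"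
      using x i j by (simp add: M.m_assoc)
    also have "gop x \<otimes>\<^bsub>M\<^esub> Mg.tau i j = Mg.tau (fst x i) (fst x j) \<otimes>\<^bsub>M\<^esub> gop x"
      using x i j by (intro Mg.e_tau) auto
    also have "Mg.tau (fst x i) (fst x j) \<otimes>\<^bsub>M\<^esub> gop x \<otimes>\<^bsub>M\<^esub> sop i j =
       Mg.tau (fst x i) (fst x j) \<otimes>\<^bsub>M\<^esub> (gop x \<otimes>\<^bsub>M\<^esub> sop i j)"
      using x fi fj by (simp add: M.m_assoc)
    also have "\<dots> = (Mg.tau (fst x i) (fst x j) \<otimes>\<^bsub>M\<^esub> sop (fst x i) (fst x j)) \<otimes>\<^bsub>M\<^esub> gop x"
      unfolding gop_sop[OF x] using x fi fj by (simp add: M.m_assoc)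
    finally show "gop x \<otimes>\<^bsub>M\<^esub> (Mg.tau i j \<otimes>\<^bsub>M\<^esub> sop i j) =
      (Mg.tau (fst x i) (fst x j) \<otimes>\<^bsub>M\<^esub> sop (fst x i) (fst x j)) \<otimes>\<^bsub>M\<^esub> gop x" .
  qed (use x i fi Gm1_fst_less[OF x] Gm1_fst_inj[OF x] in auto)
  also have "\<dots> = (\<Oplus>\<^bsub>M\<^esub>j\<in>{..<n} - {fst x i}. (Mg.tau (fst x i) j \<otimes>\<^bsub>M\<^esub> sop (fst x i) j) \<otimes>\<^bsub>M\<^esub> gop x)"
    by (rule M.finsum_bij[OF bij, symmetric]) (use x fi in auto)
  also have "\<dots> = (\<Oplus>\<^bsub>M\<^esub>j\<in>{..<n} - {fst x i}. Mg.tau (fst x i) j \<otimes>\<^bsub>M\<^esub> sop (fst x i) j) \<otimes>\<^bsub>M\<^esub> gop x"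
    by (rule M.finsum_mult_left[symmetric]) (use x fi in auto)
  finally show "gop x \<otimes>\<^bsub>M\<^esub> vop i = vop (fst x i) \<otimes>\<^bsub>M\<^esub> gop x"
    unfolding vop_def using x i fi
    by (simp add: M.r_distr M.l_distr M.smult_mult_left M.smult_mult_right gop_zop)
qed

lemma sop_onep: "sop i j \<otimes>\<^bsub>M\<^esub> onep = sgn_ij i j \<odot>\<^bsub>M\<^esub> onep"
  by (auto simp: operator_algebra_simps(2,6) sop_def onep_def fun_eq_iff Gm1_fst_one)

lemma zop_onep: "zop i \<otimes>\<^bsub>M\<^esub> onep = onep \<otimes>\<^bsub>M\<^esub> zop i"
  by (auto simp: operator_algebra_simps(2) zop_def onep_def fun_eq_iff)

lemma zop_commute: "zop i \<otimes>\<^bsub>M\<^esub> zop j = zop j \<otimes>\<^bsub>M\<^esub> zop i"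
proof (rule operator_algebra_eqI)
  fix \<Phi> and s :: "gm1 \<times> nat multiset" assume "s \<in> states"
  then obtain y \<mu> where s: "s = (y, \<mu>)" "y \<in> carrier G" by auto
  have "i \<in># \<mu> \<and> j \<in># \<mu> - {#i#} \<longleftrightarrow> j \<in># \<mu> \<and> i \<in># \<mu> - {#j#}"
    by (cases "i = j") (auto simp: in_diff_count)
  then show "(zop i \<otimes>\<^bsub>M\<^esub> zop j) \<Phi> s = (zop j \<otimes>\<^bsub>M\<^esub> zop i) \<Phi> s"
    using s by (auto simp: operator_algebra_simps(2) zop_def diff_right_commute add_mset_commute)
qed auto

text \<open>
  On the component of \<open>1 \<in> G\<close> the sign operators are the signs in \<open>X\<^sub>i\<close>.
\<close>

lemma shifted_onep:
  assumes i: "i < n"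
  shows "Mv.shifted \<kappa> i \<otimes>\<^bsub>M\<^esub> onep = zop i \<otimes>\<^bsub>M\<^esub> onep"
proof -
  have "(\<Oplus>\<^bsub>M\<^esub>j\<in>{..<n} - {i}. Mg.tau i j \<otimes>\<^bsub>M\<^esub> sop i j) \<otimes>\<^bsub>M\<^esub> onep
     = (\<Oplus>\<^bsub>M\<^esub>j\<in>{..<n} - {i}. (Mg.tau i j \<otimes>\<^bsub>M\<^esub> sop i j) \<otimes>\<^bsub>M\<^esub> onep)"
    by (rule M.finsum_mult_left) (use i in auto)
  also have "\<dots> = (\<Oplus>\<^bsub>M\<^esub>j\<in>{..<n} - {i}. (sgn_ij i j \<odot>\<^bsub>M\<^esub> Mg.tau i j) \<otimes>\<^bsub>M\<^esub> onep)"
    by (rule M.add.finprod_cong')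
      (use i in \<open>simp_all add: M.m_assoc sop_onep M.smult_mult_left M.smult_mult_right Pi_iff\<close>)
  also have "\<dots> = Mg.X i \<otimes>\<^bsub>M\<^esub> onep"
    unfolding Mg.X_def by (rule M.finsum_mult_left[symmetric]) (use i in auto)
  finally show ?thesis
    unfolding Mv.shifted_def vop_def using i
    by (simp add: M.l_distr M.smult_mult_left a_minus_def M.l_minus M.a_assoc M.r_neg)
qed

lemma shifted_bracket_onep:
  assumes pr: "p < n" "r < n"
  shows "M.bracket (Mv.shifted \<kappa> p) (Mv.shifted \<kappa> r) \<otimes>\<^bsub>M\<^esub> onep = \<zero>\<^bsub>M\<^esub>"
proof -
  have two: "Mv.shifted \<kappa> p \<otimes>\<^bsub>M\<^esub> Mv.shifted \<kappa> r \<otimes>\<^bsub>M\<^esub> onep = zop p \<otimes>\<^bsub>M\<^esub> zop r \<otimes>\<^bsub>M\<^esub> onep"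
    if "p < n" "r < n" for p r
  proof -
    have "Mv.shifted \<kappa> p \<otimes>\<^bsub>M\<^esub> Mv.shifted \<kappa> r \<otimes>\<^bsub>M\<^esub> onep = Mv.shifted \<kappa> p \<otimes>\<^bsub>M\<^esub> (onep \<otimes>\<^bsub>M\<^esub> zop r)"
      using that by (simp add: M.m_assoc shifted_onep zop_onep)
    also have "\<dots> = zop p \<otimes>\<^bsub>M\<^esub> onep \<otimes>\<^bsub>M\<^esub> zop r"
      using that by (simp add: shifted_onep flip: M.m_assoc)
    also have "\<dots> = zop p \<otimes>\<^bsub>M\<^esub> zop r \<otimes>\<^bsub>M\<^esub> onep" by (simp add: M.m_assoc zop_onep[of r])
    finally show ?thesis .
  qed
  have "M.bracket (Mv.shifted \<kappa> p) (Mv.shifted \<kappa> r) \<otimes>\<^bsub>M\<^esub> onep =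
    zop p \<otimes>\<^bsub>M\<^esub> zop r \<otimes>\<^bsub>M\<^esub> onep \<ominus>\<^bsub>M\<^esub> zop r \<otimes>\<^bsub>M\<^esub> zop p \<otimes>\<^bsub>M\<^esub> onep"
    unfolding M.bracket_def using pr two[OF pr] two[OF pr(2,1)] by (simp add: a_minus_def M.l_distr M.l_minus)
  then show ?thesis by (simp add: zop_commute[of r p] a_minus_def M.r_neg)
qed

lemma one_decomp: "\<one>\<^bsub>M\<^esub> = (\<Oplus>\<^bsub>M\<^esub>g\<in>carrier G. gop g \<otimes>\<^bsub>M\<^esub> onep \<otimes>\<^bsub>M\<^esub> gop (inv\<^bsub>G\<^esub> g))"
proof (rule operator_algebra_eqI)
  show "(\<Oplus>\<^bsub>M\<^esub>g\<in>carrier G. gop g \<otimes>\<^bsub>M\<^esub> onep \<otimes>\<^bsub>M\<^esub> gop (inv\<^bsub>G\<^esub> g)) \<in> carrier M"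
    by (rule M.finsum_closed) auto
  fix \<Phi> and s :: "gm1 \<times> nat multiset" assume "s \<in> states"
  then obtain y \<mu> where s: "s = (y, \<mu>)" "y \<in> carrier G" by auto
  have "(gop g \<otimes>\<^bsub>M\<^esub> onep \<otimes>\<^bsub>M\<^esub> gop (inv\<^bsub>G\<^esub> g)) \<Phi> s = (if g = y then \<Phi> s else 0)" if g: "g \<in> carrier G" for g
  proof -
    have "inv\<^bsub>G\<^esub> g \<otimes>\<^bsub>G\<^esub> y = \<one>\<^bsub>G\<^esub> \<longleftrightarrow> g = y"
      using g s(2) by (metis G.inv_closed G.inv_equality G.inv_inv G.l_inv)
    moreover have "image_mset (fst g) (image_mset (fst (inv\<^bsub>G\<^esub> g)) \<mu>) = \<mu>"
      by (simp add: multiset.map_comp comp_def fst_inv_cancel[OF g])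
    ultimately show ?thesis
      using g s by (auto simp: operator_algebra_simps(2) gop_def onep_def)
  qed
  then have "(\<Oplus>\<^bsub>M\<^esub>g\<in>carrier G. gop g \<otimes>\<^bsub>M\<^esub> onep \<otimes>\<^bsub>M\<^esub> gop (inv\<^bsub>G\<^esub> g)) \<Phi> s = (\<Sum>g\<in>carrier G. if g = y then \<Phi> s else 0)"
    by (subst operator_algebra_finsum) (auto intro!: sum.cong)
  then show "\<one>\<^bsub>M\<^esub> \<Phi> s = (\<Oplus>\<^bsub>M\<^esub>g\<in>carrier G. gop g \<otimes>\<^bsub>M\<^esub> onep \<otimes>\<^bsub>M\<^esub> gop (inv\<^bsub>G\<^esub> g)) \<Phi> s"
    using s Gm1_finite by (simp add: operator_algebra_simps(3))
qed simp

text \<open>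
  The commutator is zero on the component of \<open>1 \<in> G\<close>, where it is a commutator of multiplications by variables.  Every other
  component is a translate of this one, and translation turns the commutator into that of the translated indices.
\<close>

lemma M_bracket_shifted:
  assumes pr: "p < n" "r < n"
  shows "M.bracket (Mv.shifted \<kappa> p) (Mv.shifted \<kappa> r) = \<zero>\<^bsub>M\<^esub>"
proof -
  define C where "C p r = M.bracket (Mv.shifted \<kappa> p) (Mv.shifted \<kappa> r)" for p r
  have C [simp]: "C p r \<in> carrier M" if "p < n" "r < n" for p r using that by (simp add: C_def)
  have zero: "C p r \<otimes>\<^bsub>M\<^esub> (gop g \<otimes>\<^bsub>M\<^esub> onep \<otimes>\<^bsub>M\<^esub> gop (inv\<^bsub>G\<^esub> g)) = \<zero>\<^bsub>M\<^esub>" if g: "g \<in> carrier G" for g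
  proof -
    let ?w = "fst (inv\<^bsub>G\<^esub> g)"
    have w: "?w p < n" "?w r < n" using pr Gm1_fst_less[of "inv\<^bsub>G\<^esub> g"] g by auto
    have "C p r \<otimes>\<^bsub>M\<^esub> gop g = gop g \<otimes>\<^bsub>M\<^esub> C (?w p) (?w r)"
      unfolding C_def using Mv.e_bracket_shifted[OF g w, of \<kappa>] by (simp add: fst_inv_cancel[OF g])
    then have "C p r \<otimes>\<^bsub>M\<^esub> (gop g \<otimes>\<^bsub>M\<^esub> onep \<otimes>\<^bsub>M\<^esub> gop (inv\<^bsub>G\<^esub> g)) =
       gop g \<otimes>\<^bsub>M\<^esub> (C (?w p) (?w r) \<otimes>\<^bsub>M\<^esub> onep) \<otimes>\<^bsub>M\<^esub> gop (inv\<^bsub>G\<^esub> g)"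
      using pr w g by (simp flip: M.m_assoc)
    then show ?thesis using shifted_bracket_onep[OF w] g by (simp add: C_def)
  qed
  have "C p r = C p r \<otimes>\<^bsub>M\<^esub> \<one>\<^bsub>M\<^esub>" using pr by simp
  also have "\<dots> = (\<Oplus>\<^bsub>M\<^esub>g\<in>carrier G. C p r \<otimes>\<^bsub>M\<^esub> (gop g \<otimes>\<^bsub>M\<^esub> onep \<otimes>\<^bsub>M\<^esub> gop (inv\<^bsub>G\<^esub> g)))"
    unfolding one_decomp by (rule M.finsum_mult_right) (use pr in auto)
  also have "\<dots> = \<zero>\<^bsub>M\<^esub>" by (rule M.add.finprod_one_eqI) (rule zero)
  finally show ?thesis by (simp add: C_def)
qed

definition std_rep :: "(gm1 \<Rightarrow> nat list \<Rightarrow> complex) \<Rightarrow> (gm1 \<times> nat multiset \<Rightarrow> complex) \<Rightarrow> gm1 \<times> nat multiset \<Rightarrow> complex" where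
  "std_rep = sd.sd_ext M (free_ext M vop) gop"

lemma std_rep_facts:
  shows "std_rep \<in> alg_hom TG M" "\<And>i. i < n \<Longrightarrow> std_rep (var i) = vop i"
    "\<And>g. g \<in> carrier G \<Longrightarrow> std_rep (gelt g) = gop g" "\<And>a. a \<in> I \<Longrightarrow> std_rep a = \<zero>\<^bsub>M\<^esub>"
  using TG_lift[OF Mv.gm1_equivariant_axioms M_bracket_shifted] unfolding std_rep_def by blast+

lemma vop_closed: "vop \<in> {..<n} \<rightarrow> carrier M"
  by auto

lemma std_rep_bas:
  assumes g: "g \<in> carrier G" and u: "u \<in> lists {..<n}"
  shows "std_rep (bas g c u) = c \<odot>\<^bsub>M\<^esub> (word_prod M vop u \<otimes>\<^bsub>M\<^esub> gop g)"
proof -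
  note hom = std_rep_facts(1)
  have wp: "word_prod M vop u \<in> carrier M" if "u \<in> lists {..<n}" for u
    using M.word_prod_closed[OF vop_closed that] .
  have "std_rep (bas g c u) = c \<odot>\<^bsub>M\<^esub> std_rep (bas g 1 u)"
  proof -
    have "bas g c u = c \<odot>\<^bsub>TG\<^esub> bas g 1 u"
      by (auto simp: TG_apply mon_elt_def monomial_def fun_eq_iff tensor_algebra_simps free_algebra_simps restrict_def)
    then show ?thesis using u by (simp add: alg_hom_smult[OF hom])
  qed
  also have "std_rep (bas g 1 u) = word_prod M vop u \<otimes>\<^bsub>M\<^esub> gop g"
    using u
  proof (induct u rule: list.induct)
    case Nil
    then show ?case using std_rep_facts(3)[OF g] g by (simp add: gelt_bas)
  next
    case (Cons i u)
    then have i: "i < n" "u \<in> lists {..<n}" by auto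
    have "var i \<otimes>\<^bsub>TG\<^esub> bas g 1 u = bas g 1 (i # u)"
      using bas_mult[OF G.one_closed g, of "[i]" u 1 1] i g
      by (simp add: alg_elt_eq_mon letter_eq_monomial Gm1_fst_one)
    then have "std_rep (bas g 1 (i # u)) = std_rep (var i) \<otimes>\<^bsub>M\<^esub> std_rep (bas g 1 u)"
      using i by (simp flip: alg_hom_mult[OF hom])
    then show ?case using Cons(1)[OF i(2)] i g wp by (simp add: std_rep_facts(2) M.m_assoc)
  qed
  finally show ?thesis .
qed

definition vacuum :: "gm1 \<times> nat multiset \<Rightarrow> complex" where
  "vacuum = (\<lambda>s. if s = (\<one>\<^bsub>G\<^esub>, {#}) then 1 else 0)"

lemma gop_vacuum:
  assumes g: "g \<in> carrier G" and x: "x \<in> carrier G"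
  shows "gop g vacuum (x, \<mu>) = (if x = g \<and> \<mu> = {#} then 1 else 0)"
proof -
  have "inv\<^bsub>G\<^esub> g \<otimes>\<^bsub>G\<^esub> x = \<one>\<^bsub>G\<^esub> \<longleftrightarrow> x = g"
    using g x by (metis G.inv_closed G.inv_equality G.inv_inv G.l_inv)
  then show ?thesis using x by (simp add: gop_def vacuum_def)
qed

lemma tau_apply:
  assumes "i < n" "j < n" "i \<noteq> j"
  shows "Mg.tau i j \<Phi> s = (\<Sum>l<m. gop (tau_elt i j l) \<Phi> s)"
  unfolding Mg.tau_def by (rule operator_algebra_finsum) (use assms tau_elt_closed in auto)

lemma vop_apply:
  assumes "i < n"
  shows "vop i \<Phi> s = zop i \<Phi> s + \<kappa> * (\<Sum>j\<in>{..<n} - {i}. \<Sum>l<m. gop (tau_elt i j l) (sop i j \<Phi>) s)"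
proof -
  have "(\<Oplus>\<^bsub>M\<^esub>j\<in>{..<n} - {i}. Mg.tau i j \<otimes>\<^bsub>M\<^esub> sop i j) \<Phi> s = (\<Sum>j\<in>{..<n} - {i}. (Mg.tau i j \<otimes>\<^bsub>M\<^esub> sop i j) \<Phi> s)"
    by (rule operator_algebra_finsum) (use assms in auto)
  also have "\<dots> = (\<Sum>j\<in>{..<n} - {i}. \<Sum>l<m. gop (tau_elt i j l) (sop i j \<Phi>) s)"
    by (rule sum.cong) (use assms in \<open>auto simp: operator_algebra_simps(2) tau_apply\<close>)
  finally show ?thesis by (simp add: vop_def operator_algebra_simps(5,6))
qed

text \<open>
  The leading term of a word applied to the constant 1.  The group elements in \<open>vop\<close> preserve the degree of a monomial, so
  only the multiplications by variables reach the top degree.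
\<close>

lemma word_vacuum:
  assumes g: "g \<in> carrier G" and u: "u \<in> lists {..<n}" and x: "x \<in> carrier G" and \<mu>: "size \<mu> \<ge> length u"
  shows "(word_prod M vop u \<otimes>\<^bsub>M\<^esub> gop g) vacuum (x, \<mu>) = (if x = g \<and> \<mu> = mset u then 1 else 0)"
  using u x \<mu>
proof (induct u arbitrary: x \<mu> rule: list.induct)
  case Nil
  then show ?case using g by (simp add: gop_vacuum)
next
  case (Cons i u)
  then have i: "i < n" "u \<in> lists {..<n}" by auto
  let ?F = "(word_prod M vop u \<otimes>\<^bsub>M\<^esub> gop g) vacuum"
  have wp: "word_prod M vop u \<in> carrier M" using M.word_prod_closed[OF vop_closed i(2)] .
  \<comment> \<open>The degree of \<open>\<mu>\<close> exceeds that of the word \<open>u\<close>, so the term of \<open>\<tau>\<^sub>i\<^sub>j\<close> vanishes here.\<close>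
  have low: "gop (tau_elt i j l) (sop i j ?F) (x, \<mu>) = 0" if j: "j \<in> {..<n} - {i}" for j l
  proof -
    let ?t = "inv\<^bsub>G\<^esub> (tau_elt i j l)"
    have t: "tau_elt i j l \<in> carrier G" using i j tau_elt_closed by auto
    then have y: "?t \<otimes>\<^bsub>G\<^esub> x \<in> carrier G" using Cons(3) by simp
    have "image_mset (fst ?t) \<mu> \<noteq> mset u" using Cons(4) by (metis size_image_mset size_mset length_Cons not_less_eq_eq order_refl)
    then have "?F (?t \<otimes>\<^bsub>G\<^esub> x, image_mset (fst ?t) \<mu>) = 0"
      using Cons(1)[OF i(2) y, of "image_mset (fst ?t) \<mu>"] Cons(4) by simp
    then show ?thesis using Cons(3) y by (simp add: gop_def sop_def)
  qed
  have "word_prod M vop (i # u) \<otimes>\<^bsub>M\<^esub> gop g = vop i \<otimes>\<^bsub>M\<^esub> (word_prod M vop u \<otimes>\<^bsub>M\<^esub> gop g)"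
    using i wp g by (simp add: M.m_assoc)
  then have "(word_prod M vop (i # u) \<otimes>\<^bsub>M\<^esub> gop g) vacuum (x, \<mu>) = vop i ?F (x, \<mu>)"
    by (simp add: operator_algebra_simps(2))
  also have "\<dots> = zop i ?F (x, \<mu>)" by (simp add: vop_apply[OF i(1)] low)
  also have "\<dots> = (if x = g \<and> \<mu> = mset (i # u) then 1 else 0)"
  proof (cases "i \<in># \<mu>")
    case True
    then have "size (\<mu> - {#i#}) \<ge> length u" using Cons(4) by (simp add: size_Diff_singleton)
    moreover have "\<mu> - {#i#} = mset u \<longleftrightarrow> \<mu> = mset (i # u)" using insert_DiffM[OF True] by auto
    ultimately show ?thesis
      using Cons(1)[OF i(2) Cons(3), of "\<mu> - {#i#}"] True Cons(3) by (simp add: zop_def)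
  next
    case False
    then have "\<mu> \<noteq> mset (i # u)" by auto
    then show ?thesis using False by (simp add: zop_def)
  qed
  finally show ?case .
qed

lemma std_rep_homog_part_vacuum:
  assumes f: "f \<in> carrier TG" and x: "x \<in> carrier G" and \<mu>: "size \<mu> \<ge> i"
  shows "std_rep (homog_part i f) vacuum (x, \<mu>) = (if size \<mu> = i then mset_sum (f x) \<mu> else 0)"
  using f
proof (induct f rule: TG_induct)
  case (bas g c u)
  have "mset_sum (bas g c u x) \<mu> = (if x = g \<and> \<mu> = mset u then c else 0)"
    unfolding mset_sum_def bas_apply[OF x] using finite_mset_eq[of \<mu>]
    by (cases "x = g") (auto simp: sum.delta)
  then show ?case
    using bas x \<mu> word_vacuum[of g u x \<mu>]
    by (auto simp: homog_part_bas std_rep_bas operator_algebra_simps(6))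
next
  case (add f f')
  have "mset_sum ((f \<oplus>\<^bsub>TG\<^esub> f') x) \<mu> = mset_sum (f x) \<mu> + mset_sum (f' x) \<mu>"
    using x by (simp add: TG_apply mset_sum_def sum.distrib)
  then show ?case
    using add by (simp add: homog_part_add alg_hom_add[OF std_rep_facts(1)] operator_algebra_simps(5))
qed

lemma TG_le_decomp:
  assumes "f \<in> TG_le i"
  shows "f = (\<Oplus>\<^bsub>TG\<^esub>j\<in>{..i}. homog_part j f)"
proof -
  have f: "f \<in> carrier TG" using assms by (rule TG_le_carrier)
  have fin: "(\<Oplus>\<^bsub>TG\<^esub>j\<in>S. homog_part j f) g w = (\<Sum>j\<in>S. homog_part j f g w)" if "finite S" "g \<in> carrier G" for S g w
    using that
  proof (induct S rule: finite_induct)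
    case (insert j S)
    then show ?case using f by (simp add: Pi_iff) (simp add: TG_apply)
  qed (simp add: TG_apply)
  show ?thesis
  proof (rule TG_eqI[OF f])
    show "(\<Oplus>\<^bsub>TG\<^esub>j\<in>{..i}. homog_part j f) \<in> carrier TG" by (rule TG.finsum_closed) (use f in auto)
    fix g w assume g: "g \<in> carrier G"
    have "(\<Oplus>\<^bsub>TG\<^esub>j\<in>{..i}. homog_part j f) g w = (\<Sum>j\<in>{..i}. if length w = j then f g w else 0)"
      using g by (simp add: fin) (simp add: homog_part_def)
    also have "\<dots> = f g w" using assms g by (auto simp: TG_le_def)
    finally show "f g w = (\<Oplus>\<^bsub>TG\<^esub>j\<in>{..i}. homog_part j f) g w" ..
  qed
qed

lemma std_rep_low_vacuum:
  assumes f: "f \<in> TG_le i" and x: "x \<in> carrier G" and \<mu>: "size \<mu> > i"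
  shows "std_rep f vacuum (x, \<mu>) = 0"
proof -
  have fc: "f \<in> carrier TG" using f by (rule TG_le_carrier)
  have "std_rep f = (\<Oplus>\<^bsub>M\<^esub>j\<in>{..i}. std_rep (homog_part j f))"
    by (subst TG_le_decomp[OF f], rule alg_hom_finsum[OF TG.complex_algebra_axioms M.complex_algebra_axioms std_rep_facts(1)])
      (use fc in auto)
  then have "std_rep f vacuum (x, \<mu>) = (\<Sum>j\<in>{..i}. std_rep (homog_part j f) vacuum (x, \<mu>))"
    using fc alg_hom_closed[OF std_rep_facts(1)] by (simp add: operator_algebra_finsum Pi_iff)
  also have "\<dots> = 0" by (rule sum.neutral) (use fc x \<mu> std_rep_homog_part_vacuum in auto)
  finally show ?thesis .
qed

text \<open>
  Suppose that the part of degree \<open>i\<close> of \<open>f\<close> agrees in the quotient with an element \<open>h\<close> of degree less than \<open>i\<close>.  Both have the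
  same image under the representation, and applied to the constant 1 the image of \<open>h\<close> has no terms of degree \<open>i\<close>.  But
  the terms of degree \<open>i\<close> for \<open>f\<close> are the coefficients of its symbol.
\<close>

lemma symbol_kernel_subset:
  assumes f: "f \<in> carrier TG" and low: "\<And>i. q (homog_part i f) \<in> Hf.below i" and x: "x \<in> carrier G"
  shows "f x \<in> SI"
proof (rule sym_ideal_criterion[OF TG_apply_closed[OF f x]])
  fix \<mu> :: "nat multiset"
  define i where "i = size \<mu>"
  have "std_rep (homog_part i f) vacuum (x, \<mu>) = 0"
  proof (cases i)
    case 0
    then have "q (homog_part i f) = \<zero>\<^bsub>H\<^esub>" using low[of i] by (simp add: Hf.below_simps)
    then have "homog_part i f \<in> I" using q_zero_iff[of "homog_part i f"] f by simp
    then show ?thesis using std_rep_facts(4) by (simp add: operator_algebra_simps(4))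
  next
    case (Suc j)
    then obtain h where h: "h \<in> TG_le j" "q (homog_part i f) = q h"
      using low[of i] by (auto simp: Hf.below_simps Fil_eq)
    have hc: "h \<in> carrier TG" using h by (simp add: TG_le_carrier)
    have "homog_part i f \<ominus>\<^bsub>TG\<^esub> h \<in> I" using h hc f q_eq_iff by simp
    then have "std_rep (homog_part i f) \<ominus>\<^bsub>M\<^esub> std_rep h = \<zero>\<^bsub>M\<^esub>"
      using std_rep_facts(4) hc f
      by (simp flip: alg_hom_minus[OF TG.complex_algebra_axioms M.complex_algebra_axioms std_rep_facts(1)])
    then have "std_rep (homog_part i f) = std_rep h"
      using hc f alg_hom_closed[OF std_rep_facts(1)] by (simp add: M.eq_iff_minus_zero[THEN iffD2])
    then show ?thesis using std_rep_low_vacuum[OF h(1) x, of \<mu>] Suc by (simp add: i_def)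
  qed
  then show "mset_sum (f x) \<mu> = 0"
    using std_rep_homog_part_vacuum[OF f x, of i \<mu>] by (simp add: i_def)
qed

lemma symbol_zero_iff: "symbol f = \<zero>\<^bsub>GR\<^esub> \<longleftrightarrow> (\<forall>i. q (homog_part i f) \<in> Hf.below i)" if "f \<in> carrier TG"
  using that Hf.below_coset_eq_iff[of "q (homog_part i f)" "\<zero>\<^bsub>H\<^esub>" i for i]
  by (simp add: symbol_def Hf.cls_def assoc_graded_def fun_eq_iff Hf.below_coset_zero a_minus_def)

lemma GR_complex_algebra: "complex_algebra GR"
proof (rule hom_image_complex_algebra[OF symbol_hom symbol_surj _ TG.complex_algebra_axioms])
  have "homog_part i \<zero>\<^bsub>TG\<^esub> = \<zero>\<^bsub>TG\<^esub>" for i by (auto simp: homog_part_def TG_apply fun_eq_iff)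
  then show "symbol \<zero>\<^bsub>TG\<^esub> = \<zero>\<^bsub>GR\<^esub>" by (simp add: symbol_zero_iff q_zero Hf.below_zero)
qed

lemma homog_part_gelt: "homog_part k (gelt g) = (if k = 0 then gelt g else \<zero>\<^bsub>TG\<^esub>)"
  by (simp add: gelt_bas homog_part_bas bas_zero)

lemma homog_part_vec_elt: "homog_part i (vec_elt w) = (if i = 1 then vec_elt w else \<zero>\<^bsub>TG\<^esub>)"
  by (auto simp: homog_part_def TG_apply alg_elt_def tensor_vec_def fun_eq_iff restrict_def tensor_algebra_simps
      free_algebra_simps split: list.splits)

text \<open>
  The commutator of two vectors is homogeneous of degree 2, but in the quotient it equals an element of degree 0.
\<close>

lemma symbol_sym_rel:
  assumes uv: "u \<in> carrier_vec n" "v \<in> carrier_vec n"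
  shows "symbol (alg_elt G T (sym_rel u v)) = \<zero>\<^bsub>GR\<^esub>"
proof -
  have s: "alg_elt G T (sym_rel u v) \<in> carrier TG"
    using uv sym_rels_subset by (intro alg_hom_closed[OF alg_elt_TG_hom]) blast
  let ?s = "alg_elt G T (sym_rel u v)" and ?f = "\<Oplus>\<^bsub>TG\<^esub>g\<in>carrier G. b g u v \<odot>\<^bsub>TG\<^esub> gelt g"
  have f: "?f \<in> carrier TG" by (rule TG.finsum_closed) auto
  have s_eq: "?s = vec_elt u \<otimes>\<^bsub>TG\<^esub> vec_elt v \<ominus>\<^bsub>TG\<^esub> vec_elt v \<otimes>\<^bsub>TG\<^esub> vec_elt u"
    unfolding sym_rel_def using uv tensor_vec_closed
    by (simp add: alg_hom_minus[OF sd.T.complex_algebra_axioms TG.complex_algebra_axioms alg_elt_TG_hom]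
        alg_hom_mult[OF alg_elt_TG_hom])
  have h2: "homog_part i (vec_elt u \<otimes>\<^bsub>TG\<^esub> vec_elt v) = (if i = 2 then vec_elt u \<otimes>\<^bsub>TG\<^esub> vec_elt v else \<zero>\<^bsub>TG\<^esub>)"
    if uv: "u \<in> carrier_vec n" "v \<in> carrier_vec n" for u v i
  proof -
    have "homog_part i (vec_elt u \<otimes>\<^bsub>TG\<^esub> vec_elt v) = (\<Oplus>\<^bsub>TG\<^esub>j\<in>{..i}. homog_part j (vec_elt u) \<otimes>\<^bsub>TG\<^esub> homog_part (i - j) (vec_elt v))"
      using uv by (intro homog_part_mult) auto
    also have "\<dots> = (if i = 2 then vec_elt u \<otimes>\<^bsub>TG\<^esub> vec_elt v else \<zero>\<^bsub>TG\<^esub>)"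
    proof (cases "i = 2")
      case True
      have "(\<Oplus>\<^bsub>TG\<^esub>j\<in>{..i}. homog_part j (vec_elt u) \<otimes>\<^bsub>TG\<^esub> homog_part (i - j) (vec_elt v))
        = homog_part 1 (vec_elt u) \<otimes>\<^bsub>TG\<^esub> homog_part (i - 1) (vec_elt v)"
        by (rule TG.finsum_single) (use uv True in \<open>auto simp: homog_part_vec_elt\<close>)
      then show ?thesis using True uv by (simp add: homog_part_vec_elt)
    next
      case False
      have "(\<Oplus>\<^bsub>TG\<^esub>j\<in>{..i}. homog_part j (vec_elt u) \<otimes>\<^bsub>TG\<^esub> homog_part (i - j) (vec_elt v)) = \<zero>\<^bsub>TG\<^esub>"
        by (rule TG.add.finprod_one_eqI) (use uv False in \<open>auto simp: homog_part_vec_elt\<close>)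
      then show ?thesis using False by simp
    qed
    finally show ?thesis .
  qed
  have hs: "homog_part i ?s = (if i = 2 then ?s else \<zero>\<^bsub>TG\<^esub>)" for i
  proof -
    have "?s = vec_elt u \<otimes>\<^bsub>TG\<^esub> vec_elt v \<oplus>\<^bsub>TG\<^esub> (- 1) \<odot>\<^bsub>TG\<^esub> (vec_elt v \<otimes>\<^bsub>TG\<^esub> vec_elt u)"
      unfolding s_eq using uv by (simp add: a_minus_def)
    then have "homog_part i ?s = homog_part i (vec_elt u \<otimes>\<^bsub>TG\<^esub> vec_elt v) \<oplus>\<^bsub>TG\<^esub> (- 1) \<odot>\<^bsub>TG\<^esub> homog_part i (vec_elt v \<otimes>\<^bsub>TG\<^esub> vec_elt u)"
      by (simp only: homog_part_add homog_part_smult)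
    then show ?thesis using uv s_eq by (simp add: h2 a_minus_def)
  qed
  have "?s \<ominus>\<^bsub>TG\<^esub> ?f \<in> I"
    using comm_rels_subset TG.genideal_self[OF comm_rels_subset] uv
    unfolding I_eq s_eq comm_rel_def[symmetric] by blast
  then have "q ?s = q ?f" using q_eq_iff[of ?s ?f] s f by simp
  moreover have "?f \<in> TG_le 1"
  proof -
    have "(\<Oplus>\<^bsub>TG\<^esub>g\<in>S. b g u v \<odot>\<^bsub>TG\<^esub> gelt g) \<in> TG_le 1" if "finite S" for S
      using that
    proof (induct S rule: finite_induct)
      case empty
      have "homog_part i \<zero>\<^bsub>TG\<^esub> = \<zero>\<^bsub>TG\<^esub>" for i by (auto simp: homog_part_def TG_apply fun_eq_iff)
      then show ?case by (simp add: TG_le_iff)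
    next
      case (insert g S)
      then show ?case by (auto simp: TG_le_iff Pi_iff homog_part_add homog_part_smult homog_part_gelt)
    qed
    then show ?thesis using Gm1_finite by blast
  qed
  ultimately have "q ?s \<in> Hf.below 2" by (simp add: numeral_2_eq_2 Hf.below_simps Fil_eq)
  then show ?thesis using Hf.below_zero s by (simp add: symbol_zero_iff hs q_zero)
qed

text \<open>
  The kernel of the homomorphism from \<open>T(V)\<close> to the graded algebra is an ideal that contains the commutators of vectors.
\<close>

lemma symbol_of_SI:
  assumes f: "f \<in> carrier TG" and SI: "\<And>x. x \<in> carrier G \<Longrightarrow> f x \<in> SI"
  shows "symbol f = \<zero>\<^bsub>GR\<^esub>"
proof -
  interpret GR: complex_algebra GR by (rule GR_complex_algebra)
  have ac: "alg_elt G T (f g) \<in> carrier TG" if "g \<in> carrier G" for g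
    by (rule alg_hom_closed[OF alg_elt_TG_hom TG_apply_closed[OF f that]])
  have zero: "symbol (alg_elt G T (f g)) = \<zero>\<^bsub>GR\<^esub>" if "g \<in> carrier G" for g
    by (rule alg_hom_kills_genideal[OF sd.T.complex_algebra_axioms GR_complex_algebra
          alg_hom_comp[OF alg_elt_TG_hom symbol_hom] sym_rels_subset _ SI[OF that, unfolded SI_eq]])
      (use symbol_sym_rel in auto)
  have "f = (\<Oplus>\<^bsub>TG\<^esub>g\<in>carrier G. mon_elt G T g (f g))"
    using sd.mon_decomp[of f] f by (simp add: TG_eq)
  also have "\<dots> = (\<Oplus>\<^bsub>TG\<^esub>g\<in>carrier G. alg_elt G T (f g) \<otimes>\<^bsub>TG\<^esub> gelt g)"
    by (rule TG.add.finprod_cong') (use ac sd.mon_eq_mult TG_apply_closed[OF f] in \<open>auto simp flip: TG_eq\<close>)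
  finally have "symbol f = symbol (\<Oplus>\<^bsub>TG\<^esub>g\<in>carrier G. alg_elt G T (f g) \<otimes>\<^bsub>TG\<^esub> gelt g)"
    by (rule arg_cong)
  also have "\<dots> = (\<Oplus>\<^bsub>GR\<^esub>g\<in>carrier G. symbol (alg_elt G T (f g) \<otimes>\<^bsub>TG\<^esub> gelt g))"
    by (rule alg_hom_finsum[OF TG.complex_algebra_axioms GR_complex_algebra symbol_hom]) (use ac in auto)
  also have "\<dots> = \<zero>\<^bsub>GR\<^esub>"
    by (rule GR.add.finprod_one_eqI)
      (use ac zero alg_hom_closed[OF symbol_hom] in \<open>simp add: alg_hom_mult[OF symbol_hom]\<close>)
  finally show ?thesis .
qed

lemma symbol_eq_iff:
  assumes f: "f \<in> carrier TG" "f' \<in> carrier TG"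
  shows "to_sym f = to_sym f' \<longleftrightarrow> symbol f = symbol f'"
proof -
  interpret GR: complex_algebra GR by (rule GR_complex_algebra)
  let ?d = "f \<ominus>\<^bsub>TG\<^esub> f'"
  have d: "?d \<in> carrier TG" using f by simp
  have "to_sym f = to_sym f' \<longleftrightarrow> (\<forall>x\<in>carrier G. ?d x \<in> SI)" using to_sym_eq_iff[OF f] .
  also have "\<dots> \<longleftrightarrow> symbol ?d = \<zero>\<^bsub>GR\<^esub>"
    using symbol_kernel_subset[OF d] symbol_of_SI[OF d] symbol_zero_iff[OF d] by blast
  also have "\<dots> \<longleftrightarrow> symbol f = symbol f'"
    using f alg_hom_closed[OF symbol_hom]
    by (simp add: alg_hom_minus[OF TG.complex_algebra_axioms GR_complex_algebra symbol_hom] GR.eq_iff_minus_zero)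
  finally show ?thesis .
qed

text \<open>
  The maps \<open>to_sym\<close> and \<open>symbol\<close> are surjective with the same kernel, and they send \<open>g\<close> and \<open>v\<close> to the elements
  that the natural map has to match.
\<close>

theorem PBW_do_form: "PBW G n (perm_rep n) b"
proof -
  obtain \<chi> where \<chi>: "\<chi> \<in> alg_iso SG GR" and \<chi>\<sigma>: "\<And>f. f \<in> carrier TG \<Longrightarrow> \<chi> (to_sym f) = symbol f"
    by (rule alg_iso_of_same_kernel[OF to_sym_hom to_sym_surj symbol_hom symbol_surj _ TG.complex_algebra_axioms])
      (use symbol_eq_iff in auto)
  have "symbol (gelt g) = homogeneous_class H Fil 0 (q (gelt g))" for g
    by (simp add: symbol_def Hf.homogeneous_class_eq homog_part_gelt q_zero if_distrib[of q] cong: if_cong)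
  then have "\<chi> (group_elt G SA g) = homogeneous_class H Fil 0 (q (gelt g))" for g
    using \<chi>\<sigma>[of "gelt g"] by (simp add: to_sym_group_elt)
  moreover have "symbol (vec_elt v) = homogeneous_class H Fil 1 (q (vec_elt v))" for v
    by (simp add: symbol_def Hf.homogeneous_class_eq homog_part_vec_elt q_zero if_distrib[of q] cong: if_cong)
  then have "\<chi> (alg_elt G SA (sym_vec n v)) = homogeneous_class H Fil 1 (q (vec_elt v))" if "v \<in> carrier_vec n" for v
    using \<chi>\<sigma>[of "vec_elt v"] that by (simp add: to_sym_vec_elt)
  ultimately show ?thesis unfolding PBW_def using \<chi> by blast
qed

end

theorem theorem4p15:
  fixes m n :: nat and \<kappa> :: complex
  assumes "m \<ge> 1" and "n \<ge> 1"
  shows "drinfeld_algebra (Gm1 m n) n (perm_rep n) (do_form m n \<kappa>)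
       \<and> alg_isomorphic (H_DO m n \<kappa>)
           (commutator_algebra (Gm1 m n) n (perm_rep n) (do_form m n \<kappa>))"
proof -
  interpret gm1_kappa m n \<kappa> by unfold_locales (rule assms(1))
  show ?thesis
    unfolding drinfeld_algebra_def
    using Gm1_group Gm1_finite perm_rep_representation do_form_skew_bilinear PBW_do_form H_DO_isomorphic
    by blast
qed

end
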